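(* Let $N,R\ge 1$ be integers, let $b$ be a birth rate on $\mathcal X=\{0,1,\dots,N\}^{\mathbb Z}$ satisfying translation invariance, finite range of interaction (with range $R$) and non-degeneracy, and let $(\eta_t)_{t\ge 0}$ be the birth process with birth rate $b$ and initial condition $\eta_0(k)=\mathbf 1\{k=0\}$, $k\in\mathbb Z$. Then there exist constants $\lambda_r,\lambda_l>0$ such that for every $\varepsilon>0$, almost surely, for all sufficiently large $t$, $$\Big((1-\varepsilon)[-\lambda_l t,\lambda_r t]\cap\mathbb Z\Big)\subset \mathrm{occ}(\eta_t)\subset(1+\varepsilon)[-\lambda_l t,\lambda_r t].$$
   Context: Fix integers $N,R\ge1$. The state space is $\mathcal X=\{0,1,\dots,N\}^{\mathbb Z}$ with the product topology; $\eta(x)$ is the number of particles at $x$. For $\eta\in\mathcal X$ let $\mathrm{occ}(\eta)=\{z\in\mathbb Z:\eta(z)>0\}$, and for $y\in\mathbb Z$ let $\eta\odot y\in\mathcal X$ be the shift $[\eta\odot y](x)=\eta(x-y)$. A birth rate is a map $b:\mathbb Z\times\mathcal X\to\mathbb R_+=[0,\infty)$. Conditions on $b$: (1) Translation invariance: $b(x+y,\eta\odot y)=b(x,\eta)$ for all $x,y\in\mathbb Z$, $\eta\in\mathcal X$. (2) Finite range of interaction, with range $R$: $b(x,\eta)=b(x,\xi)$ whenever $x\in\mathbb Z$, $\eta,\xi\in\mathcal X$ and $\eta(z)=\xi(z)$ for all $z\in\mathbb Z$ with $|x-z|\le R$. (3) Non-degeneracy: for every $x\in\mathbb Z$ and $\eta\in\mathcal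 X$, $b(x,\eta)>0$ if and only if there exists $y\in\mathrm{occ}(\eta)$ with $|x-y|\le R$. The birth process with birth rate $b$: when the system is in state $\eta$, for each $x\in\mathbb Z$ with $\eta(x)<N$ a single particle is added at $x$ (i.e. $\eta(x)$ increases by $1$) at rate $b(x,\eta)$; no particle is added at $x$ once $\eta(x)=N$; particles never move or die. Formally, $(\eta_t)_{t\ge0}$ is the (pathwise unique) càdlàg $\mathcal X$-valued solution of $$\eta_t(k)=\eta_0(k)+\int_{(0,t]\times\{k\}\times[0,\infty)}\mathbf 1\{\eta_{s-}(i)<N\}\,\mathbf 1_{[0,b(i,\eta_{s-})]}(u)\,P(ds,di,du),\quad t\ge0,\ k\in\mathbb Z,$$ where $P$ is a Poisson point process on $\mathbb R_+\times\mathbb Z\times\mathbb R_+$ with intensity $ds\times\#\times du$ ($\#$ is counting measure on $\mathbb Z$). Started from finitely many particles, it is a non-explosive continuous-time Markov chain on the countable set of finitely supported configurations. For an interval $[a,a']\subset\mathbb R$ and $c\in\mathbb R$, $c[a,a']$ denotes the interval $[ca,ca']$ (empty if $ca>ca'$). *)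

theory Defs
  imports "HOL-Probability.Probability"
begin

section \<open>Configurations and birth rates\<close>

type_synonym config = "int \<Rightarrow> nat"

text \<open>The state space \<open>{0, \<dots>, N}\<^sup>\<int>\<close>.  Its topology is the one of the library on functions
  (the product topology, \<open>nat\<close> being discrete).\<close>

definition configs :: "nat \<Rightarrow> config set" where
  "configs N = {\<eta>. \<forall>x. \<eta> x \<le> N}"

text \<open>The underlying space of this measurable space is \<^term>\<open>configs N\<close>; the index set is countable,
  so the product sigma-algebra is the Borel sigma-algebra of the product topology.\<close>

definition config_space :: "nat \<Rightarrow> config measure" where
  "config_space N = (\<Pi>\<^sub>M x\<in>UNIV. count_space {0..N})"

definition occ :: "config \<Rightarrow> int set" where
  "occ \<eta> = {z. \<eta> z > 0}"

definition shift :: "config \<Rightarrow> int \<Rightarrow> config" where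
  "shift \<eta> y = (\<lambda>x. \<eta> (x - y))"

text \<open>A birth rate is a total function here; only its values on \<^term>\<open>configs N\<close> are meaningful,
  and every condition below is restricted to these.\<close>

type_synonym rate = "int \<Rightarrow> config \<Rightarrow> real"

definition birth_rate :: "nat \<Rightarrow> rate \<Rightarrow> bool" where
  "birth_rate N b \<longleftrightarrow> (\<forall>x. \<forall>\<eta>\<in>configs N. 0 \<le> b x \<eta>)"

definition translation_invariant :: "nat \<Rightarrow> rate \<Rightarrow> bool" where
  "translation_invariant N b \<longleftrightarrow>
     (\<forall>x y. \<forall>\<eta>\<in>configs N. b (x + y) (shift \<eta> y) = b x \<eta>)"

definition finite_range :: "nat \<Rightarrow> nat \<Rightarrow> rate \<Rightarrow> bool" where
  "finite_range N R b \<longleftrightarrow>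
     (\<forall>x. \<forall>\<eta>\<in>configs N. \<forall>\<xi>\<in>configs N.
        (\<forall>z. \<bar>x - z\<bar> \<le> int R \<longrightarrow> \<eta> z = \<xi> z) \<longrightarrow> b x \<eta> = b x \<xi>)"

definition nondegenerate :: "nat \<Rightarrow> nat \<Rightarrow> rate \<Rightarrow> bool" where
  "nondegenerate N R b \<longleftrightarrow>
     (\<forall>x. \<forall>\<eta>\<in>configs N. b x \<eta> > 0 \<longleftrightarrow> (\<exists>y\<in>occ \<eta>. \<bar>x - y\<bar> \<le> int R))"


section \<open>Poisson point processes\<close>

text \<open>A point process with intensity \<open>\<mu>\<close> is a random measure with values in
  \<open>{0, 1, 2, \<dots>} \<union> {\<infinity>}\<close>.  It is Poisson if the mass of each set of finite intensity is Poisson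
  distributed (with \<open>0 ^ 0 = 1\<close>, the formula covers intensity \<open>0\<close>) and the masses of pairwise
  disjoint sets are independent.  Finitely many disjoint sets are covered by completing them to a
  sequence with empty sets.\<close>

definition poisson_point_process ::
    "'w measure \<Rightarrow> 'a measure \<Rightarrow> ('w \<Rightarrow> 'a measure) \<Rightarrow> bool" where
  "poisson_point_process M \<mu> P \<longleftrightarrow>
     (\<forall>\<omega>\<in>space M. sets (P \<omega>) = sets \<mu>) \<and>
     (\<forall>\<omega>\<in>space M. \<forall>A\<in>sets \<mu>. emeasure (P \<omega>) A \<in> insert \<infinity> (range of_nat)) \<and>
     (\<forall>A\<in>sets \<mu>. (\<lambda>\<omega>. emeasure (P \<omega>) A) \<in> borel_measurable M) \<and>
     (\<forall>A\<in>sets \<mu>. emeasure \<mu> A < \<infinity> \<longrightarrow>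
        (\<forall>n::nat. measure M {\<omega>\<in>space M. emeasure (P \<omega>) A = of_nat n} =
           measure \<mu> A ^ n / fact n * exp (- measure \<mu> A))) \<and>
     (\<forall>A::nat \<Rightarrow> 'a set. range A \<subseteq> sets \<mu> \<longrightarrow> disjoint_family A \<longrightarrow>
        prob_space.indep_vars M (\<lambda>_. borel) (\<lambda>i \<omega>. emeasure (P \<omega>) (A i)) UNIV)"

text \<open>The intensity \<open>ds \<times> # \<times> du\<close> on \<open>\<real>\<^sub>+ \<times> \<int> \<times> \<real>\<^sub>+\<close>.\<close>

definition driving_intensity :: "(real \<times> int \<times> real) measure" where
  "driving_intensity =
     restrict_space lborel {0..} \<Otimes>\<^sub>M (count_space UNIV \<Otimes>\<^sub>M restrict_space lborel {0..})"


section \<open>The birth process\<close>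

definition cadlag :: "(real \<Rightarrow> config) \<Rightarrow> bool" where
  "cadlag f \<longleftrightarrow>
     (\<forall>t\<ge>0. (f \<longlongrightarrow> f t) (at_right t)) \<and> (\<forall>t>0. \<exists>l. (f \<longlongrightarrow> l) (at_left t))"

text \<open>This is \<open>Lim (at_left s) f\<close> written out, since \<^typ>\<open>config\<close> is not an instance of the
  Hausdorff class of the library.\<close>

definition left_lim :: "(real \<Rightarrow> config) \<Rightarrow> real \<Rightarrow> config" where
  "left_lim f s = (THE \<xi>. (f \<longlongrightarrow> \<xi>) (at_left s))"

text \<open>A path \<open>f\<close> solves the integral equation with initial condition \<open>\<eta>\<^sub>0\<close> and driving measure \<open>p\<close>.
  All terms are nonnegative, so the integral is taken in the extended nonnegative reals.\<close>

definition birth_equation ::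
    "nat \<Rightarrow> rate \<Rightarrow> config \<Rightarrow> (real \<times> int \<times> real) measure \<Rightarrow> (real \<Rightarrow> config) \<Rightarrow> bool" where
  "birth_equation N b \<eta>\<^sub>0 p f \<longleftrightarrow>
     (\<forall>t\<ge>0. \<forall>k.
        (of_nat (f t k) :: ennreal) = of_nat (\<eta>\<^sub>0 k) +
          (\<integral>\<^sup>+ (s, i, u). indicator ({0<..t} \<times> {k} \<times> {0..}) (s, i, u) *
             (indicator {\<xi>. \<xi> i < N} (left_lim f s) * indicator {0..b i (left_lim f s)} u) \<partial>p))"

text \<open>The paths are indexed by all reals; only nonnegative times are constrained.\<close>

definition birth_process ::
    "'w measure \<Rightarrow> nat \<Rightarrow> rate \<Rightarrow> config \<Rightarrow> (real \<Rightarrow> 'w \<Rightarrow> config) \<Rightarrow> bool" where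
  "birth_process M N b \<eta>\<^sub>0 \<eta> \<longleftrightarrow>
     (\<forall>t\<ge>0. \<eta> t \<in> M \<rightarrow>\<^sub>M config_space N) \<and>
     (AE \<omega> in M. cadlag (\<lambda>t. \<eta> t \<omega>)) \<and>
     (\<exists>P. poisson_point_process M driving_intensity P \<and>
        (AE \<omega> in M. birth_equation N b \<eta>\<^sub>0 (P \<omega>) (\<lambda>t. \<eta> t \<omega>)))"


section \<open>Dilated intervals\<close>

text \<open>The interval \<open>c[a, a'] = [ca, ca']\<close>, empty if \<open>ca > ca'\<close>; it is not the image of \<open>[a, a']\<close>
  under multiplication by \<open>c\<close> when \<open>c < 0\<close>.\<close>

definition scaled_interval :: "real \<Rightarrow> real \<Rightarrow> real \<Rightarrow> real set" where
  "scaled_interval c a a' = {c * a..c * a'}"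

end

theory Submission
  imports Defs "HOL-Library.Discrete_Functions"
begin

text \<open>
  The right front of the process regenerates.  If the rightmost particle sits at \<open>x\<close> and the \<open>R\<close> sites
  \<open>x - R + 1, \<dots>, x\<close> are full, then they stay full, and since rates have range \<open>R\<close> nothing to the left
  of this block influences what happens to the right of \<open>x\<close> any more.  From then on the front moves like
  a fresh copy of the front of the process started from a full block.  In every unit of time such a block
  is produced by an event that has a fixed probability \<open>p > 0\<close>, whatever the past: the \<open>R\<close> sites ahead
  of the front receive no relevant point of the driving process, and the \<open>R\<close> sites at its rear receive
  enough low points.  Hence the displacement of the front in a unit of time decorrelates exponentially fast from
  the past.  Its conditional second moment is bounded, because the front cannot pass \<open>R\<close> consecutive
  sites without points.  So there is a speed \<open>\<lambda>\<close> for which the position \<open>X\<^sub>n\<close> of the front at time \<open>n\<close>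
  satisfies \<open>E (X\<^sub>n - \<lambda> n)\<^sup>2 \<le> v n\<close>, and \<open>\<lambda> > 0\<close> since the front advances in a unit of time with a
  probability that is bounded below.  Along the squares \<open>n = j\<^sup>2\<close> the bound is summable after division
  by \<open>n\<^sup>2\<close>, and since the front never recedes, \<open>X\<^sub>n / n\<close> converges to \<open>\<lambda>\<close> almost surely.  The left front is
  the right front of the reflected process.

  To avoid strong Markov arguments in continuous time, time is cut into cells of length \<open>1 / S\<close>.  In the
  discretised process all sites are updated simultaneously, at each site according to the lowest point in
  the corresponding space-time cell.  The lowest points, recorded as marks, form an independent identically
  distributed field, and the Markov property takes the following simple form
  (\<open>expectation_markov\<close>): seen at a later time from a position determined by the past, the field is a fresh
  copy of itself.  The fluctuation bound (\<open>fluctuation_bound\<close>) has constants that do not depend on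
  \<open>S\<close>.  Almost surely the discretised process agrees at each integer time with the given solution of the
  integral equation when \<open>S = N 2\<^sup>n\<close> and \<open>n\<close> is large (\<open>run_eq_state\<close>), because then no relevant cell
  contains two points.  Here one has to exclude that particles invade from infinity; in one dimension this
  follows from the stretches of \<open>R\<close> sites without points, which almost surely exist arbitrarily far out
  in each unit of time.  Fatou's lemma transports the fluctuation bound to the solution
  (\<open>front_speed_exists\<close>).

  Finally, each site between the two fronts is within distance \<open>R\<close> of a particle (\<open>no_gaps_run\<close>), so if
  it is empty, then it is filled at a rate bounded below.  The probability that some site in a range of order \<open>k\<close>
  waits longer than \<open>\<delta> k\<close> is summable over \<open>k\<close> (\<open>AE_no_long_void\<close>), so the holes do not matter on
  the linear scale.
\<close>

section \<open>Rates of a non-degenerate birth process\<close>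

text \<open>The mark of a time step and a site stands for the height of the lowest point of the driving process
  in the corresponding space-time cell: a particle is born if the mark is at most the rate.\<close>

type_synonym marks = "nat \<times> int \<Rightarrow> real"

definition fshift :: "nat \<Rightarrow> int \<Rightarrow> marks \<Rightarrow> marks" where
  "fshift T x w = (\<lambda>(t, i). w (T + t, x + i))"

lemma fshift_fshift: "fshift S y (fshift T x w) = fshift (T + S) (x + y) w"
  by (simp add: fshift_def fun_eq_iff add.assoc)

definition front :: "config \<Rightarrow> int" where
  "front \<eta> = Max (occ \<eta>)"

definition single :: config where "single = (\<lambda>k. if k = 0 then 1 else 0)"

lemma occ_single: "occ single = {0}"
  by (auto simp: single_def occ_def)

locale birth_model =
  fixes N R :: nat and b :: rate
  assumes N_pos: "N \<ge> 1" and R_pos: "R \<ge> 1"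
    and rate: "birth_rate N b"
    and transl: "translation_invariant N b"
    and frange: "finite_range N R b"
    and nondeg: "nondegenerate N R b"
begin

definition pos_rates :: "real set" where
  "pos_rates = {b x \<eta> |x \<eta>. \<eta> \<in> configs N \<and> b x \<eta> > 0}"

definition bmax :: real where "bmax = Max pos_rates"
definition bmin :: real where "bmin = Min pos_rates"

lemma shift_configs: "\<eta> \<in> configs N \<Longrightarrow> shift \<eta> x \<in> configs N"
  by (auto simp: configs_def shift_def)

lemma b_cong:
  assumes "\<eta> \<in> configs N" "\<xi> \<in> configs N" "\<And>z. \<bar>x - z\<bar> \<le> int R \<Longrightarrow> \<eta> z = \<xi> z"
  shows "b x \<eta> = b x \<xi>"
  using frange assms unfolding finite_range_def by blast

lemma b_shift:
  assumes "\<eta> \<in> configs N" shows "b (x + y) (shift \<eta> y) = b x \<eta>"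
  using transl assms unfolding translation_invariant_def by blast

lemma b_nonneg: "\<eta> \<in> configs N \<Longrightarrow> b x \<eta> \<ge> 0"
  using rate unfolding birth_rate_def by blast

lemma b_pos_iff:
  "\<eta> \<in> configs N \<Longrightarrow> b x \<eta> > 0 \<longleftrightarrow> (\<exists>y\<in>occ \<eta>. \<bar>x - y\<bar> \<le> int R)"
  using nondeg unfolding nondegenerate_def by blast

lemma single_configs: "single \<in> configs N"
  using N_pos by (auto simp: single_def configs_def)

text \<open>Configurations that vanish outside \<open>I\<close>: a rate sees a configuration only through such a
  window around its site.\<close>

definition window :: "int set \<Rightarrow> config set" where
  "window I = {c \<in> configs N. \<forall>z. z \<notin> I \<longrightarrow> c z = 0}"

lemma finite_window: assumes "finite I" shows "finite (window I)"
proof -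
  have "finite {c :: config. \<forall>z. (z \<in> I \<longrightarrow> c z \<in> {0..N}) \<and> (z \<notin> I \<longrightarrow> c z = 0)}"
    by (rule finite_set_of_finite_funs) (use assms in simp_all)
  then show ?thesis by (rule finite_subset[rotated]) (auto simp: window_def configs_def)
qed

lemma windowI: "\<eta> \<in> configs N \<Longrightarrow> (\<lambda>z. if z \<in> I then \<eta> z else 0) \<in> window I"
  by (simp add: window_def configs_def)

text \<open>By translation invariance and finite range a rate only depends on a window of
  \<open>2 R + 1\<close> occupation numbers, for which there are finitely many possibilities.\<close>

lemma finite_pos_rates: "finite pos_rates"
proof -
  have "pos_rates \<subseteq> b 0 ` window {- int R..int R}"
  proof
    fix v assume "v \<in> pos_rates"
    then obtain x \<eta> where v: "v = b x \<eta>" and \<eta>: "\<eta> \<in> configs N"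
      by (auto simp: pos_rates_def)
    define \<xi> where "\<xi> = (\<lambda>z. if z \<in> {- int R..int R} then shift \<eta> (- x) z else 0)"
    have \<xi>: "\<xi> \<in> window {- int R..int R}"
      unfolding \<xi>_def by (intro windowI shift_configs \<eta>)
    have "v = b (x + (- x)) (shift \<eta> (- x))"
      unfolding v by (rule b_shift[symmetric]) fact
    also have "\<dots> = b 0 (shift \<eta> (- x))" by simp
    also have "\<dots> = b 0 \<xi>"
      by (rule b_cong) (use \<eta> \<xi> in \<open>auto simp: shift_configs \<xi>_def window_def\<close>)
    finally show "v \<in> b 0 ` window {- int R..int R}" using \<xi> by blast
  qed
  then show ?thesis by (rule finite_surj[OF finite_window, rotated]) simp
qed

lemma pos_rates_nonempty: "pos_rates \<noteq> {}"
proof -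
  have "b 0 single > 0"
    unfolding b_pos_iff[OF single_configs] occ_single by simp
  then show ?thesis using single_configs unfolding pos_rates_def by blast
qed

lemma pos_rates_pos: "v \<in> pos_rates \<Longrightarrow> v > 0"
  by (auto simp: pos_rates_def)

lemma pos_rates_bounds: "v \<in> pos_rates \<Longrightarrow> bmin \<le> v \<and> v \<le> bmax"
  unfolding bmin_def bmax_def using finite_pos_rates by simp

lemma bmin_in: "bmin \<in> pos_rates"
  unfolding bmin_def using finite_pos_rates pos_rates_nonempty by simp

lemma bmax_in: "bmax \<in> pos_rates"
  unfolding bmax_def using finite_pos_rates pos_rates_nonempty by simp

lemma bmin_pos: "bmin > 0" using bmin_in pos_rates_pos by blast

lemma bmax_pos: "bmax > 0" using bmax_in pos_rates_pos by blast

lemma b_pos_rates: "\<eta> \<in> configs N \<Longrightarrow> b x \<eta> > 0 \<Longrightarrow> b x \<eta> \<in> pos_rates"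
  by (auto simp: pos_rates_def)

lemma b_le_bmax: "\<eta> \<in> configs N \<Longrightarrow> b x \<eta> \<le> bmax"
  using b_pos_rates[of \<eta> x] pos_rates_bounds[of "b x \<eta>"] b_nonneg[of \<eta> x] bmax_pos
  by (cases "b x \<eta> > 0") auto

lemma b_ge_bmin:
  "\<eta> \<in> configs N \<Longrightarrow> y \<in> occ \<eta> \<Longrightarrow> \<bar>x - y\<bar> \<le> int R \<Longrightarrow> bmin \<le> b x \<eta>"
  using b_pos_iff[of \<eta> x] b_pos_rates[of \<eta> x] pos_rates_bounds by blast

lemma b_eq_0:
  "\<eta> \<in> configs N \<Longrightarrow> (\<And>y. y \<in> occ \<eta> \<Longrightarrow> \<bar>x - y\<bar> > int R) \<Longrightarrow> b x \<eta> = 0"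
  using b_pos_iff[of \<eta> x] b_nonneg[of \<eta> x] by force


section \<open>The time-discretised process\<close>

definition step :: "config \<Rightarrow> (int \<Rightarrow> real) \<Rightarrow> config" where
  "step \<eta> u = (\<lambda>i. if \<eta> i < N \<and> 0 < b i \<eta> \<and> u i \<le> b i \<eta> then Suc (\<eta> i) else \<eta> i)"

primrec run :: "config \<Rightarrow> marks \<Rightarrow> nat \<Rightarrow> config" where
  "run \<eta> w 0 = \<eta>"
| "run \<eta> w (Suc t) = step (run \<eta> w t) (\<lambda>i. w (t, i))"

definition fin_configs :: "config set" where
  "fin_configs = {\<eta> \<in> configs N. finite (occ \<eta>) \<and> occ \<eta> \<noteq> {}}"

lemma fin_configsD: "\<eta> \<in> fin_configs \<Longrightarrow> \<eta> \<in> configs N"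
  "\<eta> \<in> fin_configs \<Longrightarrow> finite (occ \<eta>)" "\<eta> \<in> fin_configs \<Longrightarrow> occ \<eta> \<noteq> {}"
  by (auto simp: fin_configs_def)

lemma single_fin: "single \<in> fin_configs"
  using single_configs occ_single by (auto simp: fin_configs_def)

lemma front_in: "\<eta> \<in> fin_configs \<Longrightarrow> front \<eta> \<in> occ \<eta>"
  unfolding front_def using fin_configsD by (simp add: Max_in)

lemma front_ge: "\<eta> \<in> fin_configs \<Longrightarrow> y \<in> occ \<eta> \<Longrightarrow> y \<le> front \<eta>"
  unfolding front_def using fin_configsD by simp

lemma front_eqI:
  "\<eta> \<in> fin_configs \<Longrightarrow> x \<in> occ \<eta> \<Longrightarrow> (\<And>y. y \<in> occ \<eta> \<Longrightarrow> y \<le> x) \<Longrightarrow> front \<eta> = x"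
  unfolding front_def using fin_configsD by (intro Max_eqI) auto

lemma step_configs: "\<eta> \<in> configs N \<Longrightarrow> step \<eta> u \<in> configs N"
  by (auto simp: step_def configs_def)

lemma step_ge: "\<eta> i \<le> step \<eta> u i"
  by (auto simp: step_def)

lemma occ_step:
  assumes "\<eta> \<in> configs N" "y \<in> occ (step \<eta> u)"
  shows "\<exists>z\<in>occ \<eta>. \<bar>y - z\<bar> \<le> int R"
proof (cases "y \<in> occ \<eta>")
  case True then show ?thesis by (intro bexI[of _ y]) auto
next
  case False
  then have "b y \<eta> > 0" using assms(2) by (auto simp: occ_def step_def split: if_splits)
  then show ?thesis using b_pos_iff assms(1) by blast
qed

lemma run_configs: "\<eta> \<in> configs N \<Longrightarrow> run \<eta> w t \<in> configs N"
  by (induction t) (auto simp: step_configs)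

lemma run_mono: "s \<le> t \<Longrightarrow> run \<eta> w s i \<le> run \<eta> w t i"
proof (induction t rule: dec_induct)
  case (step t)
  then show ?case using step_ge[of "run \<eta> w t" i "\<lambda>i. w (t, i)"] by simp
qed simp

lemma occ_run_mono: "s \<le> t \<Longrightarrow> occ (run \<eta> w s) \<subseteq> occ (run \<eta> w t)"
proof
  fix y assume "s \<le> t" "y \<in> occ (run \<eta> w s)"
  then show "y \<in> occ (run \<eta> w t)" using run_mono[of s t \<eta> w y] by (simp add: occ_def)
qed

lemma occ_run:
  assumes "\<eta> \<in> configs N" "y \<in> occ (run \<eta> w t)"
  shows "\<exists>z\<in>occ \<eta>. \<bar>y - z\<bar> \<le> int (R * t)"
  using assms(2)
proof (induction t arbitrary: y)
  case 0 then show ?case by auto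
next
  case (Suc t)
  then obtain z where z: "z \<in> occ (run \<eta> w t)" "\<bar>y - z\<bar> \<le> int R"
    using occ_step[OF run_configs[OF assms(1)], of y w t "\<lambda>i. w (t, i)"]
    unfolding run.simps by blast
  then obtain z' where "z' \<in> occ \<eta>" "\<bar>z - z'\<bar> \<le> int (R * t)" using Suc.IH by blast
  with z show ?case by (intro bexI[of _ z']) auto
qed

lemma run_fin: assumes "\<eta> \<in> fin_configs" shows "run \<eta> w t \<in> fin_configs"
proof -
  have "occ (run \<eta> w t) \<subseteq> (\<Union>z\<in>occ \<eta>. {z - int (R * t)..z + int (R * t)})"
    using occ_run[OF fin_configsD(1)[OF assms]] by force
  then have "finite (occ (run \<eta> w t))"
    by (rule finite_subset) (use assms in \<open>auto simp: fin_configs_def\<close>)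
  moreover have "occ (run \<eta> w t) \<noteq> {}"
    using occ_run_mono[of 0 t \<eta> w] fin_configsD(3)[OF assms] by auto
  ultimately show ?thesis using assms run_configs by (auto simp: fin_configs_def)
qed

lemma run_add: "run \<eta> w (s + t) = run (run \<eta> w s) (fshift s 0 w) t"
  by (induction t) (auto simp: fshift_def)

lemma run_shift:
  assumes "\<eta> \<in> configs N"
  shows "run (shift \<eta> x) w t = shift (run \<eta> (fshift 0 x w) t) x"
proof (induction t)
  case (Suc t)
  have *: "b i (shift (run \<eta> (fshift 0 x w) t) x) = b (i - x) (run \<eta> (fshift 0 x w) t)" for i
    using b_shift[OF run_configs[OF assms], of "i - x" x] by simp
  show ?case
    unfolding run.simps Suc
    by (rule ext) (auto simp: step_def * , auto simp: shift_def fshift_def)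
qed simp

lemma run_cong:
  assumes "\<And>s i. s < t \<Longrightarrow> w (s, i) = w' (s, i)"
  shows "run \<eta> w t = run \<eta> w' t"
  using assms by (induction t) auto

lemma occ_shift: "y \<in> occ (shift \<eta> x) \<longleftrightarrow> y - x \<in> occ \<eta>"
  by (auto simp: occ_def shift_def)

lemma shift_fin: assumes "\<eta> \<in> fin_configs" shows "shift \<eta> x \<in> fin_configs"
proof -
  have "occ (shift \<eta> x) = (\<lambda>y. y + x) ` occ \<eta>"
    by (force simp: occ_shift image_iff)
  then show ?thesis using assms shift_configs by (auto simp: fin_configs_def)
qed

lemma front_shift: assumes "\<eta> \<in> fin_configs" shows "front (shift \<eta> x) = front \<eta> + x"
proof (rule front_eqI[OF shift_fin[OF assms]])
  show "front \<eta> + x \<in> occ (shift \<eta> x)" using front_in[OF assms] by (simp add: occ_shift)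
  fix y assume "y \<in> occ (shift \<eta> x)"
  then have "y - x \<le> front \<eta>" using front_ge[OF assms] by (simp add: occ_shift)
  then show "y \<le> front \<eta> + x" by simp
qed

lemma front_run_mono:
  assumes "\<eta> \<in> fin_configs" "s \<le> t" shows "front (run \<eta> w s) \<le> front (run \<eta> w t)"
  using front_ge[OF run_fin[OF assms(1)]] front_in[OF run_fin[OF assms(1)]]
    occ_run_mono[OF assms(2)] by blast

lemma front_run_bound:
  assumes "\<eta> \<in> fin_configs" shows "front (run \<eta> w t) \<le> front \<eta> + int (R * t)"
proof -
  obtain z where "z \<in> occ \<eta>" "\<bar>front (run \<eta> w t) - z\<bar> \<le> int (R * t)"
    using occ_run[OF fin_configsD(1)[OF assms] front_in[OF run_fin[OF assms]]] by blast
  then show ?thesis using front_ge[OF assms, of z] by linarith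
qed

text \<open>Every step inherits this property, since new particles appear only within distance \<open>R\<close> of old ones.
  It makes the rates between the outermost particles positive.\<close>

definition no_gaps :: "config \<Rightarrow> bool" where
  "no_gaps \<eta> \<longleftrightarrow> (\<forall>x. (\<exists>y\<in>occ \<eta>. y \<le> x) \<longrightarrow> (\<exists>y\<in>occ \<eta>. x \<le> y) \<longrightarrow>
     (\<exists>y\<in>occ \<eta>. \<bar>x - y\<bar> \<le> int R))"

lemma no_gaps_step:
  assumes "\<eta> \<in> configs N" "no_gaps \<eta>" shows "no_gaps (step \<eta> u)"
  unfolding no_gaps_def
proof (intro allI impI)
  fix x assume "\<exists>y\<in>occ (step \<eta> u). y \<le> x" "\<exists>y\<in>occ (step \<eta> u). x \<le> y"
  then obtain y1 y2 where y: "y1 \<in> occ (step \<eta> u)" "y1 \<le> x" "y2 \<in> occ (step \<eta> u)" "x \<le> y2"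
    by blast
  obtain z1 z2 where z: "z1 \<in> occ \<eta>" "\<bar>y1 - z1\<bar> \<le> int R" "z2 \<in> occ \<eta>" "\<bar>y2 - z2\<bar> \<le> int R"
    using occ_step[OF assms(1)] y by meson
  have sub: "occ \<eta> \<subseteq> occ (step \<eta> u)"
    by (auto simp: occ_def step_def)
  have "\<exists>z\<in>occ \<eta>. \<bar>x - z\<bar> \<le> int R"
  proof (cases "(\<exists>y\<in>occ \<eta>. y \<le> x) \<and> (\<exists>y\<in>occ \<eta>. x \<le> y)")
    case True then show ?thesis using assms(2) unfolding no_gaps_def by blast
  next
    case False
    then have "\<not> (z1 \<le> x \<and> x \<le> z2)" "\<not> (z2 \<le> x \<and> x \<le> z1)"
      using z(1,3) by blast+
    then have "\<bar>x - z1\<bar> \<le> int R \<or> \<bar>x - z2\<bar> \<le> int R"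
      using y(2,4) z(2,4) by linarith
    then show ?thesis using z by blast
  qed
  then show "\<exists>y\<in>occ (step \<eta> u). \<bar>x - y\<bar> \<le> int R" using sub by blast
qed

lemma no_gaps_run: "no_gaps (run single w t)"
proof (induction t)
  case 0 show ?case by (auto simp: no_gaps_def occ_single)
next
  case (Suc t) then show ?case using no_gaps_step run_configs single_configs by simp
qed


section \<open>Regeneration of the front\<close>

definition block :: config where
  "block = (\<lambda>i. if - int R < i \<and> i \<le> 0 then N else 0)"

lemma occ_block: "occ block = {- int R<..0}"
  using N_pos by (auto simp: occ_def block_def)

lemma block_fin: "block \<in> fin_configs"
  using occ_block R_pos by (auto simp: fin_configs_def configs_def block_def)

lemma front_block: "front block = 0"
  using block_fin R_pos by (intro front_eqI) (auto simp: occ_block)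

text \<open>All sites within distance \<open>R\<close> of a site to the right of the block are in the block or to its right,
  and a full block does not change any more.\<close>

lemma run_block_screen:
  assumes \<eta>: "\<eta> \<in> configs N" and full: "\<And>i. - int R < i \<Longrightarrow> i \<le> 0 \<Longrightarrow> \<eta> i = N"
    and empty: "\<And>i. i > 0 \<Longrightarrow> \<eta> i = 0"
  shows "i > - int R \<Longrightarrow> run \<eta> w t i = run block w t i"
proof (induction t arbitrary: i)
  case 0 then show ?case using full empty by (auto simp: block_def)
next
  case (Suc t)
  have c: "run \<eta> w t \<in> configs N" "run block w t \<in> configs N"
    using \<eta> block_fin run_configs fin_configsD by blast+
  show ?case
  proof (cases "i \<le> 0")
    case True
    have "run block w t i \<ge> N"
      using run_mono[of 0 t block w i] True Suc.prems by (simp add: block_def)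
    then show ?thesis using Suc.IH[OF Suc.prems] by (simp add: step_def)
  next
    case False
    have "b i (run \<eta> w t) = b i (run block w t)"
      by (rule b_cong[OF c]) (use False Suc.IH in auto)
    then show ?thesis using Suc.IH[OF Suc.prems] by (simp add: step_def)
  qed
qed

lemma front_run_block_screen:
  assumes \<eta>: "\<eta> \<in> fin_configs" and x: "front \<eta> = x"
    and full: "\<And>i. x - int R < i \<Longrightarrow> i \<le> x \<Longrightarrow> \<eta> i = N"
  shows "front (run \<eta> w t) = x + front (run block (fshift 0 x w) t)"
proof -
  define \<xi> where "\<xi> = shift \<eta> (- x)"
  have \<xi>: "\<xi> \<in> fin_configs" unfolding \<xi>_def using \<eta> by (rule shift_fin)
  have \<eta>\<xi>: "\<eta> = shift \<xi> x" by (auto simp: \<xi>_def shift_def)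
  have emp: "\<xi> i = 0" if "i > 0" for i
    using front_ge[OF \<eta>, of "i + x"] x that by (auto simp: \<xi>_def shift_def occ_def)
  define v where "v = fshift 0 x w"
  have agree: "run \<xi> v t i = run block v t i" if "i > - int R" for i
    by (rule run_block_screen) (use that full emp fin_configsD(1)[OF \<xi>] in \<open>auto simp: \<xi>_def shift_def\<close>)
  have in_iff: "i \<in> occ (run \<xi> v t) \<longleftrightarrow> i \<in> occ (run block v t)" if "i > - int R" for i
    using agree[OF that] by (simp add: occ_def)
  have fb: "front (run block v t) \<ge> 0"
    using front_run_mono[OF block_fin, of 0 t v] front_block by simp
  have "front (run \<xi> v t) = front (run block v t)"
  proof (rule front_eqI[OF run_fin[OF \<xi>]])
    show "front (run block v t) \<in> occ (run \<xi> v t)"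
      using front_in[OF run_fin[OF block_fin]] in_iff fb R_pos by auto
    fix y assume "y \<in> occ (run \<xi> v t)"
    then show "y \<le> front (run block v t)"
      using in_iff[of y] front_ge[OF run_fin[OF block_fin], of y v t] fb R_pos by force
  qed
  moreover have "front (run \<eta> w t) = front (run \<xi> v t) + x"
    unfolding \<eta>\<xi> v_def run_shift[OF fin_configsD(1)[OF \<xi>]] by (rule front_shift[OF run_fin[OF \<xi>]])
  ultimately show ?thesis unfolding v_def by simp
qed

text \<open>The first particle beyond \<open>a\<close> would need a particle within distance \<open>R\<close> that is already present, so
  it would have to be born in the stretch, where the marks exceed every rate.\<close>

lemma empty_stretch_blocks:
  assumes \<eta>: "\<eta> \<in> fin_configs" and a: "front \<eta> \<le> a"
    and marks: "\<And>t i. t < T \<Longrightarrow> a < i \<Longrightarrow> i \<le> a + int R \<Longrightarrow> w (t, i) > bmax"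
  shows "front (run \<eta> w T) \<le> a"
proof -
  have "\<forall>y\<in>occ (run \<eta> w t). y \<le> a" if "t \<le> T" for t
    using that
  proof (induction t)
    case 0 then show ?case using front_ge[OF \<eta>] a by force
  next
    case (Suc t)
    have c: "run \<eta> w t \<in> configs N" using \<eta> run_configs fin_configsD by blast
    show ?case
    proof (intro ballI leI notI)
      fix y assume y: "y \<in> occ (run \<eta> w (Suc t))" "a < y"
      have "y \<notin> occ (run \<eta> w t)" using Suc y by force
      then have pos: "b y (run \<eta> w t) > 0" and le: "w (t, y) \<le> b y (run \<eta> w t)"
        using y by (auto simp: occ_def step_def split: if_splits)
      obtain z where "z \<in> occ (run \<eta> w t)" "\<bar>y - z\<bar> \<le> int R"
        using pos b_pos_iff[OF c] by blast
      then have "y \<le> a + int R" using Suc by force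
      then have "w (t, y) > bmax" using marks[of t y] Suc.prems y by auto
      then show False using le b_le_bmax[OF c, of y] by linarith
    qed
  qed
  then show ?thesis using front_in[OF run_fin[OF \<eta>]] by blast
qed

text \<open>With \<open>S = N * L\<close> steps in a time slab, the following event for the field seen from the front
  freezes the front during the slab and fills the \<open>R\<close> sites behind it.\<close>

definition regen :: "nat \<Rightarrow> marks set" where
  "regen L = {w. (\<forall>i\<in>{1..int R}. \<forall>t<N * L. w (t, i) > bmax) \<and>
     (\<forall>i\<in>{- int R<..0}. \<forall>r<N. \<exists>t\<in>{r * L..<Suc r * L}. w (t, i) \<le> bmin)}"

text \<open>As long as the site is not full, each group of \<open>L\<close> steps adds a particle, because the rate at \<open>i\<close> is
  at least \<open>bmin\<close> from the beginning.\<close>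

lemma fill_site:
  assumes c: "\<eta> \<in> configs N" and near: "y \<in> occ \<eta>" "\<bar>i - y\<bar> \<le> int R"
    and marks: "\<And>r. r < n \<Longrightarrow> \<exists>t\<in>{r * L..<Suc r * L}. w (t, i) \<le> bmin" and "n \<le> N"
  shows "run \<eta> w (n * L) i \<ge> n"
  using marks \<open>n \<le> N\<close>
proof (induction n)
  case (Suc n)
  have IH: "run \<eta> w (n * L) i \<ge> n" using Suc by auto
  obtain t where t: "n * L \<le> t" "t < Suc n * L" "w (t, i) \<le> bmin" using Suc.prems(1)[of n] by auto
  have ge: "run \<eta> w t i \<ge> n" using IH run_mono[OF t(1), of \<eta> w i] by simp
  have le: "run \<eta> w (Suc t) i \<le> run \<eta> w (Suc n * L) i"
    by (rule run_mono) (use t in auto)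
  have "y \<in> occ (run \<eta> w t)" using near(1) occ_run_mono[of 0 t \<eta> w] by auto
  then have bb: "bmin \<le> b i (run \<eta> w t)"
    using b_ge_bmin[OF run_configs[OF c]] near(2) by blast
  have "run \<eta> w (Suc t) i \<ge> Suc n"
  proof (cases "run \<eta> w t i < N")
    case True
    then have "run \<eta> w (Suc t) i = Suc (run \<eta> w t i)"
      using bb t(3) bmin_pos by (simp add: step_def)
    then show ?thesis using ge by simp
  next
    case False
    then show ?thesis
      using Suc.prems(2) step_ge[of "run \<eta> w t" i "\<lambda>i. w (t, i)"] unfolding run.simps by linarith
  qed
  then show ?case using le by linarith
qed simp

lemma regen_effect:
  assumes \<eta>: "\<eta> \<in> fin_configs" and w: "fshift 0 (front \<eta>) w \<in> regen L"
  shows "front (run \<eta> w (N * L)) = front \<eta>"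
    and "front \<eta> - int R < i \<Longrightarrow> i \<le> front \<eta> \<Longrightarrow> run \<eta> w (N * L) i = N"
proof -
  have m: "w (t, front \<eta> + i) > bmax" if "i \<in> {1..int R}" "t < N * L" for t i
    using w that by (auto simp: regen_def fshift_def)
  have "front (run \<eta> w (N * L)) \<le> front \<eta>"
  proof (rule empty_stretch_blocks[OF \<eta> order_refl])
    fix t i assume "t < N * L" "front \<eta> < i" "i \<le> front \<eta> + int R"
    then show "w (t, i) > bmax" using m[of "i - front \<eta>" t] by auto
  qed
  moreover have "front \<eta> \<le> front (run \<eta> w (N * L))" using front_run_mono[OF \<eta>, of 0] by simp
  ultimately show "front (run \<eta> w (N * L)) = front \<eta>" by simp
  assume i: "front \<eta> - int R < i" "i \<le> front \<eta>"
  have "run \<eta> w (N * L) i \<ge> N"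
  proof (rule fill_site[OF fin_configsD(1)[OF \<eta>] front_in[OF \<eta>]])
    fix r assume "r < N"
    moreover have "\<forall>i\<in>{- int R<..0}. \<forall>r<N. \<exists>t\<in>{r * L..<Suc r * L}. fshift 0 (front \<eta>) w (t, i) \<le> bmin"
      using w by (simp add: regen_def)
    moreover have "i - front \<eta> \<in> {- int R<..0}" using i by auto
    ultimately have "\<exists>t\<in>{r * L..<Suc r * L}. fshift 0 (front \<eta>) w (t, i - front \<eta>) \<le> bmin"
      by blast
    then show "\<exists>t\<in>{r * L..<Suc r * L}. w (t, i) \<le> bmin"
      by (simp add: fshift_def)
  qed (use i in auto)
  moreover have "run \<eta> w (N * L) i \<le> N"
    using run_configs[OF fin_configsD(1)[OF \<eta>]] by (auto simp: configs_def)
  ultimately show "run \<eta> w (N * L) i = N" by simp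
qed

text \<open>After a regeneration the front moves like the front started from a full block, driven by the
  later marks as seen from the current front.\<close>

lemma front_after_regen:
  assumes \<eta>: "\<eta> \<in> fin_configs" and w: "fshift 0 (front \<eta>) w \<in> regen L"
  shows "front (run \<eta> w (N * L + t)) = front \<eta> + front (run block (fshift (N * L) (front \<eta>) w) t)"
  unfolding run_add
  using front_run_block_screen[OF run_fin[OF \<eta>] regen_effect(1)[OF \<eta> w] regen_effect(2)[OF \<eta> w],
      of "fshift (N * L) 0 w" t]
  by (simp add: fshift_fshift)

end

section \<open>Independent identically distributed marks\<close>

definition depends_on :: "'i set \<Rightarrow> (('i \<Rightarrow> 'a) \<Rightarrow> 'b) \<Rightarrow> bool" where
  "depends_on A f \<longleftrightarrow> (\<forall>w w'. (\<forall>j\<in>A. w j = w' j) \<longrightarrow> f w = f w')"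

lemma depends_onD: "depends_on A f \<Longrightarrow> (\<And>j. j \<in> A \<Longrightarrow> w j = w' j) \<Longrightarrow> f w = f w'"
  unfolding depends_on_def by blast

lemma depends_on_mono: "depends_on A f \<Longrightarrow> A \<subseteq> B \<Longrightarrow> depends_on B f"
  unfolding depends_on_def by blast

lemma depends_on_compose: "depends_on A f \<Longrightarrow> depends_on A (\<lambda>w. h (f w))"
  unfolding depends_on_def by (intro allI impI arg_cong[where f = h]) blast

lemma depends_on_compose2: "depends_on A f \<Longrightarrow> depends_on A g \<Longrightarrow> depends_on A (\<lambda>w. h (f w) (g w))"
  unfolding depends_on_def by (intro allI impI arg_cong2[where f = h]) blast+

lemma depends_on_const: "depends_on A (\<lambda>_. c)"
  unfolding depends_on_def by simp

lemma depends_on_indicator: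
  "depends_on A (\<lambda>w. w \<in> E) \<Longrightarrow> depends_on A (indicator E :: _ \<Rightarrow> real)"
  using depends_on_compose[of A "\<lambda>w. w \<in> E" "\<lambda>x. if x then 1 else 0 :: real"]
  by (simp add: indicator_def[abs_def] of_bool_def)

lemma depends_on_Ball:
  "(\<And>j. j \<in> J \<Longrightarrow> depends_on A (\<lambda>w. Q j w)) \<Longrightarrow> depends_on A (\<lambda>w. \<forall>j\<in>J. Q j w)"
  unfolding depends_on_def by blast

locale iid_field =
  fixes \<nu> :: "real measure"
  assumes prob_\<nu>: "prob_space \<nu>" and sets_\<nu> [measurable_cong]: "sets \<nu> = sets borel"
begin

definition P :: "marks measure" where "P = (\<Pi>\<^sub>M j\<in>UNIV. \<nu>)"

sublocale prd: product_prob_space "\<lambda>_ :: nat \<times> int. \<nu>" UNIV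
  using prob_\<nu> by (simp add: product_prob_spaceI)

sublocale P: prob_space P
  unfolding P_def by (rule prob_space_PiM) (rule prob_\<nu>)

sublocale PP: pair_prob_space P P ..

lemma space_P [simp]: "space P = UNIV"
  using sets_eq_imp_space_eq[OF sets_\<nu>] by (simp add: P_def space_PiM)

lemma sets_P [measurable_cong]: "sets P = sets (\<Pi>\<^sub>M j\<in>UNIV. borel)"
  unfolding P_def by (rule sets_PiM_cong) (simp_all add: sets_\<nu>)

lemma mark_measurable [measurable]: "(\<lambda>w. w j) \<in> borel_measurable P"
  by measurable

lemma measurable_P: "(\<And>j. (\<lambda>x. f x j) \<in> borel_measurable Q) \<Longrightarrow> f \<in> Q \<rightarrow>\<^sub>M P"
  unfolding measurable_cong_sets[OF refl sets_P]
  by (rule measurable_PiM_single') (auto simp: space_PiM)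

lemma prob_marks:
  assumes "finite J" "\<And>j. j \<in> J \<Longrightarrow> X j \<in> sets borel"
  shows "P.prob {w. \<forall>j\<in>J. w j \<in> X j} = (\<Prod>j\<in>J. measure \<nu> (X j))"
proof -
  have "{w. \<forall>j\<in>J. w j \<in> X j} = prod_emb UNIV (\<lambda>_. \<nu>) J (Pi\<^sub>E J X)"
    using sets_eq_imp_space_eq[OF sets_\<nu>] by (auto simp: prod_emb_def space_PiM Pi_iff)
  then show ?thesis
    using prd.measure_PiM_emb[of J X] assms sets_\<nu> unfolding P_def by simp
qed

text \<open>Taking the marks in \<open>A\<close> from one field and the others from an independent copy gives a field
  with the same law.\<close>

definition splice :: "(nat \<times> int) set \<Rightarrow> marks \<times> marks \<Rightarrow> marks" where
  "splice A = (\<lambda>(w1, w2) j. if j \<in> A then w1 j else w2 j)"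

lemma splice_measurable [measurable]: "splice A \<in> P \<Otimes>\<^sub>M P \<rightarrow>\<^sub>M P"
proof (rule measurable_P)
  fix j show "(\<lambda>x. splice A x j) \<in> borel_measurable (P \<Otimes>\<^sub>M P)"
    unfolding splice_def split_beta by (cases "j \<in> A") simp_all
qed

lemma distr_splice: "distr (P \<Otimes>\<^sub>M P) P (splice A) = P"
proof -
  have "distr (P \<Otimes>\<^sub>M P) P (splice A) = PiM UNIV (\<lambda>_. \<nu>)"
  proof (rule prd.PiM_eq)
    show "sets (distr (P \<Otimes>\<^sub>M P) P (splice A)) = sets (PiM UNIV (\<lambda>_. \<nu>))" by (simp add: P_def)
  next
    fix J :: "(nat \<times> int) set" and F
    assume J: "finite J" and F: "\<And>j. j \<in> J \<Longrightarrow> F j \<in> sets \<nu>"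
    let ?C = "\<lambda>J. {w :: marks. \<forall>j\<in>J. w j \<in> F j}"
    have emb: "prod_emb UNIV (\<lambda>_. \<nu>) J (Pi\<^sub>E J F) = ?C J" if "J \<subseteq> UNIV" for J
      using sets_eq_imp_space_eq[OF sets_\<nu>] by (auto simp: prod_emb_def space_PiM Pi_iff)
    have em: "emeasure P (?C J') = (\<Prod>j\<in>J'. emeasure \<nu> (F j))" if "J' \<subseteq> J" for J'
      unfolding P_def emb[symmetric, OF subset_UNIV]
      by (rule prd.emeasure_PiM_emb) (use that F finite_subset[OF that J] in auto)
    have Cm: "?C J' \<in> sets P" if "J' \<subseteq> J" for J'
      unfolding P_def emb[symmetric, OF subset_UNIV]
      by (rule sets_PiM_I) (use that J F finite_subset in auto)
    have "emeasure (distr (P \<Otimes>\<^sub>M P) P (splice A)) (?C J)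
        = emeasure (P \<Otimes>\<^sub>M P) (?C (J \<inter> A) \<times> ?C (J - A))"
    proof (subst emeasure_distr)
      have "splice A -` ?C J \<inter> space (P \<Otimes>\<^sub>M P) = ?C (J \<inter> A) \<times> ?C (J - A)"
        by (auto simp: splice_def space_pair_measure split: if_splits)
      then show "emeasure (P \<Otimes>\<^sub>M P) (splice A -` ?C J \<inter> space (P \<Otimes>\<^sub>M P))
        = emeasure (P \<Otimes>\<^sub>M P) (?C (J \<inter> A) \<times> ?C (J - A))" by simp
    qed (use Cm in auto)
    also have "\<dots> = emeasure P (?C (J \<inter> A)) * emeasure P (?C (J - A))"
      by (rule P.emeasure_pair_measure_Times) (use Cm in auto)
    also have "\<dots> = (\<Prod>j\<in>J. emeasure \<nu> (F j))"
      using J by (simp add: em prod.Int_Diff[of J _ A])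
    finally show "emeasure (distr (P \<Otimes>\<^sub>M P) P (splice A)) (prod_emb UNIV (\<lambda>_. \<nu>) J (Pi\<^sub>E J F))
        = (\<Prod>j\<in>J. emeasure \<nu> (F j))"
      by (simp add: emb)
  qed
  then show ?thesis by (simp add: P_def)
qed

definition bdd :: "(marks \<Rightarrow> real) \<Rightarrow> bool" where
  "bdd f \<longleftrightarrow> f \<in> borel_measurable P \<and> (\<exists>c. \<forall>w. \<bar>f w\<bar> \<le> c)"

lemma bddI: "f \<in> borel_measurable P \<Longrightarrow> (\<And>w. \<bar>f w\<bar> \<le> c) \<Longrightarrow> bdd f"
  unfolding bdd_def by blast

lemma bdd_measurable [measurable_dest]: "bdd f \<Longrightarrow> f \<in> borel_measurable P"
  by (simp add: bdd_def)

lemma bdd_integrable: assumes "bdd f" shows "integrable P f"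
proof -
  obtain c where "\<And>w. \<bar>f w\<bar> \<le> c" using assms by (auto simp: bdd_def)
  then show ?thesis using assms by (intro P.integrable_const_bound[where B = c]) (auto simp: bdd_def)
qed

lemma bdd_const: "bdd (\<lambda>_. c)" by (rule bddI[where c = "\<bar>c\<bar>"]) auto

lemma bdd_mult: assumes "bdd f" "bdd g" shows "bdd (\<lambda>w. f w * g w)"
proof -
  obtain c d where cd: "\<And>w. \<bar>f w\<bar> \<le> c" "\<And>w. \<bar>g w\<bar> \<le> d" using assms by (auto simp: bdd_def)
  show ?thesis
  proof (rule bddI[where c = "c * d"])
    fix w show "\<bar>f w * g w\<bar> \<le> c * d"
      unfolding abs_mult by (rule mult_mono) (use cd order_trans[OF abs_ge_zero cd(1)] in auto)
  qed (use assms in measurable)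
qed

lemma bdd_add: assumes "bdd f" "bdd g" shows "bdd (\<lambda>w. f w + g w)"
proof -
  obtain c d where cd: "\<And>w. \<bar>f w\<bar> \<le> c" "\<And>w. \<bar>g w\<bar> \<le> d" using assms by (auto simp: bdd_def)
  show ?thesis
  proof (rule bddI[where c = "c + d"])
    fix w show "\<bar>f w + g w\<bar> \<le> c + d" using cd[of w] by linarith
  qed (use assms in measurable)
qed

lemma bdd_diff: "bdd f \<Longrightarrow> bdd g \<Longrightarrow> bdd (\<lambda>w. f w - g w)"
  using bdd_add[of f "\<lambda>w. - 1 * g w"] bdd_mult[OF bdd_const[of "-1"], of g] by simp

lemma bdd_power2: "bdd f \<Longrightarrow> bdd (\<lambda>w. (f w)\<^sup>2)"
  using bdd_mult[of f f] by (simp add: power2_eq_square)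

lemma bdd_sum: "(\<And>i. i \<in> I \<Longrightarrow> bdd (f i)) \<Longrightarrow> bdd (\<lambda>w. \<Sum>i\<in>I. f i w)"
  by (induction I rule: infinite_finite_induct) (auto intro: bdd_const bdd_add)

lemma bdd_indicator: "E \<in> sets P \<Longrightarrow> bdd (indicator E)"
  by (rule bddI[where c = 1]) (auto simp: indicator_def)

lemma bdd_compose: "bdd g \<Longrightarrow> T \<in> P \<rightarrow>\<^sub>M P \<Longrightarrow> bdd (\<lambda>w. g (T w))"
  unfolding bdd_def by (auto intro: measurable_compose)

text \<open>Splicing turns independence of disjoint sets of marks into Fubini's theorem.\<close>

lemma expectation_splice:
  assumes "bdd f"
  shows "P.expectation f = (\<integral>w1. (\<integral>w2. f (splice A (w1, w2)) \<partial>P) \<partial>P)"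
proof -
  note [measurable] = bdd_measurable[OF assms]
  obtain c where c: "\<And>w. \<bar>f w\<bar> \<le> c" using assms by (auto simp: bdd_def)
  have "P.expectation f = integral\<^sup>L (distr (P \<Otimes>\<^sub>M P) P (splice A)) f"
    by (simp add: distr_splice)
  also have "\<dots> = integral\<^sup>L (P \<Otimes>\<^sub>M P) (\<lambda>x. f (splice A x))"
    by (intro integral_distr) measurable
  also have "\<dots> = (\<integral>w1. (\<integral>w2. f (splice A (w1, w2)) \<partial>P) \<partial>P)"
    by (rule PP.integral_fst'[symmetric], rule PP.P.integrable_const_bound[where B = c]) (use c in auto)
  finally show ?thesis .
qed

lemma fshift_measurable [measurable]:
  assumes [measurable]: "X \<in> Q \<rightarrow>\<^sub>M count_space UNIV" "W \<in> Q \<rightarrow>\<^sub>M P"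
  shows "(\<lambda>x. fshift T (X x :: int) (W x)) \<in> Q \<rightarrow>\<^sub>M P"
proof (rule measurable_P)
  fix j :: "nat \<times> int"
  obtain t i where j: "j = (t, i)" by force
  have "(\<lambda>x. (\<lambda>y z. W z (T + t, y + i)) (X x) x) \<in> borel_measurable Q"
    by (rule measurable_compose_countable[OF _ assms(1)])
      (rule measurable_compose[OF assms(2) mark_measurable])
  then show "(\<lambda>x. fshift T (X x) (W x) j) \<in> borel_measurable Q"
    by (simp add: fshift_def j)
qed

lemma distr_fshift: "distr P P (fshift T x) = P"
proof -
  have "distr (PiM UNIV (\<lambda>_. \<nu>)) (PiM UNIV (\<lambda>_. \<nu>))
      (\<lambda>\<omega>. \<lambda>n\<in>UNIV. \<omega> ((\<lambda>(t, i). (T + t, x + i)) n)) = PiM UNIV (\<lambda>_ :: nat \<times> int. \<nu>)"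
    by (rule distr_PiM_reindex) (auto simp: inj_on_def prob_\<nu>)
  moreover have "(\<lambda>\<omega>. \<lambda>n\<in>UNIV. \<omega> ((\<lambda>(t, i). (T + t, x + i)) n)) = (fshift T x :: marks \<Rightarrow> marks)"
    by (auto simp: fshift_def fun_eq_iff)
  ultimately show ?thesis by (simp add: P_def)
qed

lemma expectation_fshift:
  assumes "bdd g" shows "P.expectation (\<lambda>w. g (fshift T x w)) = P.expectation g"
proof -
  have [measurable]: "fshift T x \<in> P \<rightarrow>\<^sub>M P"
    using fshift_measurable[of "\<lambda>_. x" P "\<lambda>w. w" T] by simp
  have "P.expectation g = integral\<^sup>L (distr P P (fshift T x)) g" by (simp add: distr_fshift)
  also have "\<dots> = P.expectation (\<lambda>w. g (fshift T x w))"
    using assms by (intro integral_distr) auto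
  finally show ?thesis by simp
qed

text \<open>Seen at a later time from a site determined by the past, the field is a fresh copy that is
  independent of the past.\<close>

lemma expectation_markov:
  assumes Y: "bdd Y" "depends_on {(t, i). t < T} Y"
    and X: "X \<in> P \<rightarrow>\<^sub>M count_space UNIV" "depends_on {(t, i). t < T} X" and g: "bdd g"
  shows "P.expectation (\<lambda>w. Y w * g (fshift T (X w :: int) w)) = P.expectation Y * P.expectation g"
proof -
  define A :: "(nat \<times> int) set" where "A = {(t, i). t < T}"
  note [measurable] = X(1)
  have XA: "X (splice A (w1, w2)) = X w1" and YA: "Y (splice A (w1, w2)) = Y w1" for w1 w2
    using depends_onD[OF X(2), of "splice A (w1, w2)" w1] depends_onD[OF Y(2), of "splice A (w1, w2)" w1]
    by (auto simp: splice_def A_def)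
  have sh: "fshift T x (splice A (w1, w2)) = fshift T x w2" for x w1 w2
    by (auto simp: fshift_def splice_def A_def)
  have b: "bdd (\<lambda>w. Y w * g (fshift T (X w) w))"
    by (intro bdd_mult Y(1) bdd_compose[OF g]) measurable
  have "P.expectation (\<lambda>w. Y w * g (fshift T (X w) w))
      = (\<integral>w1. (\<integral>w2. Y w1 * g (fshift T (X w1) w2) \<partial>P) \<partial>P)"
    unfolding expectation_splice[OF b, of A] XA YA sh ..
  then show ?thesis using expectation_fshift[OF g] by simp
qed

lemma expectation_indep:
  assumes f: "bdd f" "depends_on A f" and g: "bdd g" "depends_on (- A) g"
  shows "P.expectation (\<lambda>w. f w * g w) = P.expectation f * P.expectation g"
proof -
  have fA: "f (splice A (w1, w2)) = f w1" and gA: "g (splice A (w1, w2)) = g w2" for w1 w2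
    using depends_onD[OF f(2), of "splice A (w1, w2)" w1] depends_onD[OF g(2), of "splice A (w1, w2)" w2]
    by (auto simp: splice_def)
  show ?thesis unfolding expectation_splice[OF bdd_mult[OF f(1) g(1)], of A] fA gA by simp
qed

lemma prob_inter_indep:
  assumes "finite J" and "\<And>j. j \<in> J \<Longrightarrow> E j \<in> sets P"
    and "\<And>j. j \<in> J \<Longrightarrow> depends_on (B j) (\<lambda>w. w \<in> E j)" and "disjoint_family_on B J"
  shows "P.prob {w. \<forall>j\<in>J. w \<in> E j} = (\<Prod>j\<in>J. P.prob (E j))"
  using assms
proof (induction J)
  case empty show ?case using P.prob_space by simp
next
  case (insert k J)
  have [measurable]: "E k \<in> sets P" using insert.prems by simp
  have [measurable]: "{w. \<forall>j\<in>J. w \<in> E j} \<in> sets P"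
  proof -
    have "{w \<in> space P. \<forall>j\<in>J. w \<in> E j} \<in> sets P"
      by (rule sets.sets_Collect_finite_All) (use insert in auto)
    then show ?thesis by simp
  qed
  have "P.prob {w. \<forall>j\<in>insert k J. w \<in> E j}
      = P.expectation (\<lambda>w. indicator (E k) w * indicator {w. \<forall>j\<in>J. w \<in> E j} w)"
  proof -
    have "(\<lambda>w. indicator (E k) w * indicator {w. \<forall>j\<in>J. w \<in> E j} w :: real)
        = indicator {w. \<forall>j\<in>insert k J. w \<in> E j}"
      by (auto simp: indicator_def fun_eq_iff)
    then show ?thesis by simp
  qed
  also have "\<dots> = P.expectation (indicator (E k)) * P.expectation (indicator {w. \<forall>j\<in>J. w \<in> E j})"
  proof (rule expectation_indep[where A = "B k"])
    have "depends_on (B k) (\<lambda>w. w \<in> E k)" using insert.prems by simp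
    then show "depends_on (B k) (indicator (E k) :: _ \<Rightarrow> real)"
      by (rule depends_on_indicator)
    have "depends_on (- B k) (\<lambda>w. w \<in> E j)" if "j \<in> J" for j
    proof (rule depends_on_mono)
      show "depends_on (B j) (\<lambda>w. w \<in> E j)" using insert.prems(2) that by simp
      have "j \<noteq> k" using insert.hyps that by blast
      then have "B j \<inter> B k = {}"
        using insert.prems(3) that unfolding disjoint_family_on_def by simp
      then show "B j \<subseteq> - B k" by blast
    qed
    then have "depends_on (- B k) (\<lambda>w. \<forall>j\<in>J. w \<in> E j)" by (rule depends_on_Ball)
    then show "depends_on (- B k) (indicator {w. \<forall>j\<in>J. w \<in> E j} :: _ \<Rightarrow> real)"
      by (intro depends_on_indicator) simp
  qed (auto intro: bdd_indicator)
  also have "\<dots> = P.prob (E k) * (\<Prod>j\<in>J. P.prob (E j))"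
    using insert by (auto simp: disjoint_family_on_def)
  finally show ?case using insert.hyps by simp
qed

end

section \<open>The front in time slabs\<close>

text \<open>The derivative of the geometric series, in a form that also gives summability.\<close>

lemma sum_mult_geometric_le:
  assumes "0 \<le> x" "x < (1::real)"
  shows "(\<Sum>m<n. (real m + 1) * x ^ m) \<le> 1 / (1 - x)\<^sup>2"
proof -
  have "(1 - x)\<^sup>2 * (\<Sum>m<n. (real m + 1) * x ^ m) = 1 - (real n + 1) * x ^ n + real n * x ^ Suc n"
    by (induction n) (simp_all add: algebra_simps power2_eq_square)
  also have "\<dots> \<le> 1"
  proof -
    have "real n * x ^ Suc n \<le> (real n + 1) * x ^ n"
      using assms by (intro mult_mono) (auto simp: mult_left_le_one_le)
    then show ?thesis by simp
  qed
  finally show ?thesis using assms by (simp add: field_simps)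
qed

text \<open>A step lasts \<open>1 / (N L)\<close> units of time, so that a unit of time consists of \<open>N\<close> groups of \<open>L\<close> steps.  The
  regeneration event compares marks only with the two extreme rates, for which the field has to match an
  exponential clock.\<close>

locale front_chain = birth_model N R b + iid_field \<nu>
  for N R :: nat and b :: rate and \<nu> :: "real measure" +
  fixes L :: nat
  assumes L_pos: "L \<ge> 1"
    and mark_above: "\<And>v. v = bmax \<or> v = bmin \<Longrightarrow> measure \<nu> {v<..} = exp (- v / (N * L))"
begin

definition S :: nat where "S = N * L"

lemma S_pos: "S \<ge> 1" using N_pos L_pos by (simp add: S_def)

subsection \<open>Measurability\<close>

text \<open>Measurability of the discretised process is a matter of countably many values: every function of
  its state is then measurable.\<close>

lemma countable_fin_configs: "countable fin_configs"
proof (rule countable_subset)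
  show "countable (\<Union>n. window {- int n..int n})"
    by (auto intro: countable_finite finite_window)
  show "fin_configs \<subseteq> (\<Union>n. window {- int n..int n})"
  proof
    fix \<eta> assume \<eta>: "\<eta> \<in> fin_configs"
    define n where "n = nat (Max ((\<lambda>z. \<bar>z\<bar>) ` occ \<eta>))"
    have le: "\<bar>z\<bar> \<le> int n" if "z \<in> occ \<eta>" for z
    proof -
      have "\<bar>z\<bar> \<le> Max ((\<lambda>z. \<bar>z\<bar>) ` occ \<eta>)" using that fin_configsD[OF \<eta>] by simp
      then show ?thesis unfolding n_def by linarith
    qed
    have "\<eta> z = 0" if "z \<notin> {- int n..int n}" for z
    proof -
      have "z \<notin> occ \<eta>" using le[of z] that by auto
      then show ?thesis by (simp add: occ_def)
    qed
    then show "\<eta> \<in> (\<Union>n. window {- int n..int n})"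
      using fin_configsD(1)[OF \<eta>] unfolding window_def by blast
  qed
qed

lemma run_measurable:
  assumes "\<eta> \<in> fin_configs" shows "(\<lambda>w. run \<eta> w t) \<in> P \<rightarrow>\<^sub>M count_space fin_configs"
proof (induction t)
  case 0 then show ?case using assms by simp
next
  case (Suc t)
  have "(\<lambda>w. step c (\<lambda>i. w (t, i))) \<in> P \<rightarrow>\<^sub>M count_space fin_configs" if c: "c \<in> fin_configs" for c
  proof (subst measurable_count_space_eq_countable[OF countable_fin_configs], intro conjI ballI)
    have "step c u = run c (\<lambda>(t, i). u i) 1" for u by simp
    then show "(\<lambda>w. step c (\<lambda>i. w (t, i))) \<in> space P \<rightarrow> fin_configs"
      using run_fin[OF c] by (metis Pi_I)
    fix d
    have "Measurable.pred P (\<lambda>w. step c (\<lambda>i. w (t, i)) i = d i)" for i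
      unfolding step_def by measurable
    then have "Measurable.pred P (\<lambda>w. \<forall>i. step c (\<lambda>i. w (t, i)) i = d i)"
      by (intro pred_intros_countable)
    then have "{w \<in> space P. \<forall>i. step c (\<lambda>i. w (t, i)) i = d i} \<in> sets P" by (simp add: pred_def)
    moreover have "(\<lambda>w. step c (\<lambda>i. w (t, i))) -` {d} \<inter> space P
        = {w \<in> space P. \<forall>i. step c (\<lambda>i. w (t, i)) i = d i}"
      by (auto simp: fun_eq_iff)
    ultimately show "(\<lambda>w. step c (\<lambda>i. w (t, i))) -` {d} \<inter> space P \<in> sets P" by simp
  qed
  from measurable_compose_countable'[OF this Suc countable_fin_configs] show ?case by simp
qed

lemma front_run_measurable [measurable]:
  assumes "\<eta> \<in> fin_configs"
  shows "(\<lambda>w. front (run \<eta> w t)) \<in> P \<rightarrow>\<^sub>M count_space UNIV"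
  using run_measurable[OF assms] by (rule measurable_compose) simp

lemma front_run_bdd:
  assumes "\<eta> \<in> fin_configs" shows "bdd (\<lambda>w. real_of_int (front (run \<eta> w t)))"
proof (rule bddI)
  note [measurable] = front_run_measurable[OF assms]
  show "(\<lambda>w. real_of_int (front (run \<eta> w t))) \<in> borel_measurable P" by measurable
  fix w
  have "front \<eta> \<le> front (run \<eta> w t)" using front_run_mono[OF assms, of 0 t w] by simp
  moreover have "front (run \<eta> w t) \<le> front \<eta> + int (R * t)" by (rule front_run_bound[OF assms])
  ultimately show "\<bar>real_of_int (front (run \<eta> w t))\<bar> \<le> \<bar>real_of_int (front \<eta>)\<bar> + R * t"
    using of_int_le_iff[where 'a = real, of "front \<eta>" "front (run \<eta> w t)"]
      of_int_le_iff[where 'a = real, of "front (run \<eta> w t)" "front \<eta> + int (R * t)"]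
    by simp
qed

lemma front_run_depends: "depends_on {(s, i). s < t} (\<lambda>w. front (run \<eta> w t))"
  unfolding depends_on_def
proof (intro allI impI)
  fix w w' :: marks assume "\<forall>j\<in>{(s, i). s < t}. w j = w' j"
  then have "run \<eta> w t = run \<eta> w' t" by (intro run_cong) auto
  then show "front (run \<eta> w t) = front (run \<eta> w' t)" by simp
qed

subsection \<open>Increments of the front\<close>

definition X :: "nat \<Rightarrow> marks \<Rightarrow> int" where "X k w = front (run single w (k * S))"

definition D :: "nat \<Rightarrow> marks \<Rightarrow> real" where "D k w = real_of_int (X (Suc k) w - X k w)"

text \<open>The stretches of \<open>R\<close> sites ahead of the front, seen from the front; an empty one stops the front.  If
  the first \<open>m\<close> of them are not empty, then the squared increment may be as large as \<open>(m R)\<^sup>2\<close>, which is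
  written as a sum of odd numbers in order to use the probabilities of these events directly.\<close>

definition stretch :: "nat \<Rightarrow> marks set" where
  "stretch m = {w. \<forall>t<S. \<forall>i\<in>{int (m * R)<..int (m * R) + int R}. w (t, i) > bmax}"

definition none_empty :: "nat \<Rightarrow> marks set" where
  "none_empty m = {w. \<forall>m'\<in>{..m}. w \<in> - stretch m'}"

definition sq_bound :: "marks \<Rightarrow> real" where
  "sq_bound w = (real R)\<^sup>2 * (\<Sum>m<S. (2 * real m + 1) * indicator (none_empty m) w)"

lemma X_measurable [measurable]: "X k \<in> P \<rightarrow>\<^sub>M count_space UNIV"
  unfolding X_def[abs_def] by (rule front_run_measurable[OF single_fin])

lemma X_depends: "depends_on {(t, i). t < k * S} (X k)"
  unfolding X_def[abs_def] by (rule front_run_depends)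

lemma D_bdd: "bdd (D k)"
  using bdd_diff[OF front_run_bdd[OF single_fin, of "Suc k * S"] front_run_bdd[OF single_fin, of "k * S"]]
  by (simp add: D_def[abs_def] X_def)

lemma D_depends: "depends_on {(t, i). t < Suc k * S} (D k)"
proof -
  have "depends_on {(t, i). t < Suc k * S} (X k)"
    by (rule depends_on_mono[OF X_depends]) auto
  from depends_on_compose2[OF X_depends[of "Suc k"] this, of "\<lambda>x y. real_of_int (x - y)"]
  show ?thesis by (simp add: D_def[abs_def])
qed

lemma X_slab: "X (Suc k) w = front (run (run single w (k * S)) (fshift (k * S) 0 w) S)"
  using run_add[of single w "k * S" S] by (simp add: X_def add.commute)

lemma X_mono: "X k w \<le> X (Suc k) w"
  unfolding X_def by (rule front_run_mono[OF single_fin]) simp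

lemma D_nonneg: "D k w \<ge> 0" using X_mono by (simp add: D_def)

lemma D_le_sq: "D k w \<le> (D k w)\<^sup>2"
proof -
  define d where "d = X (Suc k) w - X k w"
  have "d \<ge> 0" using X_mono by (simp add: d_def)
  then have "d \<le> d\<^sup>2" unfolding power2_eq_square by (cases "d = 0") (auto simp: mult_le_cancel_left1)
  then have "real_of_int d \<le> real_of_int (d\<^sup>2)" by (simp only: of_int_le_iff)
  then show ?thesis by (simp add: D_def d_def)
qed

lemma stretch_sets [measurable]: "stretch m \<in> sets P"
proof -
  have "{w \<in> space P. \<forall>t\<in>{..<S}. \<forall>i\<in>{int (m * R)<..int (m * R) + int R}. bmax < w (t, i)} \<in> sets P"
    by measurable
  then show ?thesis by (simp add: stretch_def Ball_def)
qed

lemma prob_stretch: "P.prob (stretch m) = exp (- bmax * R)"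
proof -
  have card: "card ({..<S} \<times> {int (m * R)<..int (m * R) + int R}) = S * R"
    by (simp add: card_cartesian_product)
  have "stretch m = {w. \<forall>j\<in>{..<S} \<times> {int (m * R)<..int (m * R) + int R}. w j \<in> {bmax<..}}"
    by (auto simp: stretch_def)
  then have "P.prob (stretch m) = (\<Prod>j\<in>{..<S} \<times> {int (m * R)<..int (m * R) + int R}. measure \<nu> {bmax<..})"
    using prob_marks[of "{..<S} \<times> {int (m * R)<..int (m * R) + int R}" "\<lambda>_. {bmax<..}"] by simp
  also have "\<dots> = exp (- bmax / S) ^ (S * R)"
    using mark_above[of bmax] card by (simp add: S_def)
  also have "\<dots> = exp (- bmax * R)"
    using S_pos by (simp add: exp_of_nat_mult[symmetric])
  finally show ?thesis .
qed

definition \<theta> :: real where "\<theta> = 1 - exp (- bmax * R)"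

lemma \<theta>: "0 \<le> \<theta>" "\<theta> < 1"
  using bmax_pos by (auto simp: \<theta>_def)

lemma none_empty_sets [measurable]: "none_empty m \<in> sets P"
proof -
  have "{w \<in> space P. \<forall>m'\<in>{..m}. w \<in> - stretch m'} \<in> sets P"
    by (rule sets.sets_Collect_finite_All) (auto simp: Compl_eq_Diff_UNIV space_P[symmetric] simp del: space_P)
  then show ?thesis by (simp add: none_empty_def)
qed

lemma prob_none_empty: "P.prob (none_empty m) = \<theta> ^ Suc m"
proof -
  have c: "P.prob (- stretch m') = \<theta>" for m'
    using P.prob_compl[OF stretch_sets[of m']] by (simp add: prob_stretch \<theta>_def Compl_eq_Diff_UNIV)
  have "P.prob (none_empty m) = (\<Prod>m'\<in>{..m}. P.prob (- stretch m'))"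
    unfolding none_empty_def
  proof (rule prob_inter_indep[where B = "\<lambda>m. {..<S} \<times> {int (m * R)<..int (m * R) + int R}"])
    fix m' show "- stretch m' \<in> sets P"
      using sets.compl_sets[OF stretch_sets[of m']] by (simp add: Compl_eq_Diff_UNIV)
    show "depends_on ({..<S} \<times> {int (m' * R)<..int (m' * R) + int R}) (\<lambda>w. w \<in> - stretch m')"
      unfolding depends_on_def stretch_def by simp
  next
    have lt: "int (m * R) + int R \<le> int (n * R)" if "m < n" for m n
    proof -
      have "Suc m * R \<le> n * R" using that by (intro mult_right_mono) auto
      then show ?thesis by (simp flip: of_nat_add add: add.commute del: of_nat_mult)
    qed
    have dj: "{int (m * R)<..int (m * R) + int R} \<inter> {int (n * R)<..int (n * R) + int R} = {}"
      if "m < n" for m n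
      using lt[OF that] by auto
    show "disjoint_family_on (\<lambda>m. {..<S} \<times> {int (m * R)<..int (m * R) + int R}) {..m}"
      unfolding disjoint_family_on_def
    proof (intro ballI impI)
      fix m n :: nat assume "m \<noteq> n"
      then have "{int (m * R)<..int (m * R) + int R} \<inter> {int (n * R)<..int (n * R) + int R} = {}"
        using dj[of m n] dj[of n m] by (cases "m < n") (auto simp: Int_commute)
      then show "{..<S} \<times> {int (m * R)<..int (m * R) + int R} \<inter>
          {..<S} \<times> {int (n * R)<..int (n * R) + int R} = {}" by blast
    qed
  qed simp
  then show ?thesis by (simp add: c)
qed

text \<open>A bound for the conditional second moment of an increment, independent of the mesh.\<close>

definition C :: real where "C = 2 * (real R)\<^sup>2 * exp (2 * bmax * R)"

lemma C_pos: "C > 0" using R_pos by (simp add: C_def)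

lemma sq_bound_bdd: "bdd sq_bound"
  unfolding sq_bound_def[abs_def]
  by (intro bdd_mult[OF bdd_const] bdd_sum bdd_indicator) measurable

lemma expectation_sq_bound: "P.expectation sq_bound \<le> C"
proof -
  have "P.expectation sq_bound
      = (real R)\<^sup>2 * (\<Sum>m<S. P.expectation (\<lambda>w. (2 * real m + 1) * indicator (none_empty m) w))"
    unfolding sq_bound_def[abs_def] integral_mult_right_zero
    by (subst Bochner_Integration.integral_sum)
      (auto intro!: bdd_integrable bdd_mult bdd_const bdd_indicator)
  also have "\<dots> = (real R)\<^sup>2 * (\<Sum>m<S. (2 * real m + 1) * \<theta> ^ Suc m)"
    unfolding integral_mult_right_zero by (simp add: prob_none_empty)
  also have "\<dots> \<le> (real R)\<^sup>2 * (\<Sum>m<S. 2 * ((real m + 1) * \<theta> ^ m))"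
  proof (intro mult_left_mono sum_mono)
    fix m
    have "(2 * real m + 1) * \<theta> ^ Suc m \<le> (2 * (real m + 1)) * \<theta> ^ m"
      using \<theta> by (intro mult_mono) (auto simp: mult_left_le_one_le)
    then show "(2 * real m + 1) * \<theta> ^ Suc m \<le> 2 * ((real m + 1) * \<theta> ^ m)" by (simp only: mult.assoc)
  qed simp
  also have "\<dots> \<le> (real R)\<^sup>2 * (2 * (1 / (1 - \<theta>)\<^sup>2))"
    using sum_mult_geometric_le[OF \<theta>, of S]
    by (intro mult_left_mono) (auto simp: sum_distrib_left[symmetric])
  also have "\<dots> = C"
    unfolding C_def \<theta>_def by (simp add: exp_minus field_simps power2_eq_square exp_add[symmetric])
  finally show ?thesis .
qed

lemma sum_odd: "(\<Sum>m<n. 2 * real m + 1) = (real n)\<^sup>2"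
  by (induction n) (auto simp: power2_eq_square algebra_simps)

text \<open>The front moves at most to the first empty stretch ahead of it.  It also moves at most \<open>R\<close> sites per
  step, which covers the case that the first \<open>S\<close> stretches are not empty.\<close>

lemma increment_sq_le:
  assumes \<eta>: "\<eta> \<in> fin_configs"
  shows "(real_of_int (front (run \<eta> w S) - front \<eta>))\<^sup>2 \<le> sq_bound (fshift 0 (front \<eta>) w)"
proof -
  define v where "v = fshift 0 (front \<eta>) w"
  define m where "m = (LEAST m. v \<in> stretch m \<or> m = S)"
  have m: "v \<in> stretch m \<or> m = S" unfolding m_def by (rule LeastI_ex) blast
  have "m \<le> S" unfolding m_def by (rule Least_le) simp
  have not: "v \<notin> stretch m'" if "m' < m" for m'
    using not_less_Least[of m' "\<lambda>m. v \<in> stretch m \<or> m = S"] that unfolding m_def by blast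
  have "front (run \<eta> w S) \<le> front \<eta> + int (m * R)"
  proof (cases "m = S")
    case True then show ?thesis using front_run_bound[OF \<eta>, of w S] by (simp add: mult.commute)
  next
    case False
    then have "v \<in> stretch m" using m by blast
    then have st: "v (t, i) > bmax" if "t < S" "int (m * R) < i" "i \<le> int (m * R) + int R" for t i
      using that by (simp add: stretch_def)
    show ?thesis
    proof (rule empty_stretch_blocks[OF \<eta>])
      fix t i assume "t < S" "front \<eta> + int (m * R) < i" "i \<le> front \<eta> + int (m * R) + int R"
      then show "w (t, i) > bmax" using st[of t "i - front \<eta>"] by (simp add: v_def fshift_def)
    qed simp
  qed
  moreover have "front \<eta> \<le> front (run \<eta> w S)" using front_run_mono[OF \<eta>, of 0 S w] by simp
  ultimately have "(real_of_int (front (run \<eta> w S) - front \<eta>))\<^sup>2 \<le> (real_of_int (int (m * R)))\<^sup>2"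
    unfolding of_int_power[symmetric] of_int_le_iff by (intro power_mono) auto
  also have "\<dots> = (real R)\<^sup>2 * (\<Sum>m'<m. (2 * real m' + 1) * indicator (none_empty m') v)"
  proof -
    have "(\<Sum>m'<m. (2 * real m' + 1) * indicator (none_empty m') v) = (\<Sum>m'<m. 2 * real m' + 1)"
      using not by (intro sum.cong) (auto simp: none_empty_def indicator_def)
    then show ?thesis by (simp add: sum_odd power_mult_distrib)
  qed
  also have "\<dots> \<le> sq_bound v"
    unfolding sq_bound_def using \<open>m \<le> S\<close>
    by (intro mult_left_mono sum_mono2) (auto intro!: mult_nonneg_nonneg)
  finally show ?thesis unfolding v_def .
qed

lemma D_sq_le: "(D k w)\<^sup>2 \<le> sq_bound (fshift (k * S) (X k w) w)"
  using increment_sq_le[OF run_fin[OF single_fin], of w "k * S" "fshift (k * S) 0 w"]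
  by (simp add: D_def X_slab fshift_fshift) (simp add: X_def)

end

context front_chain
begin

subsection \<open>Decorrelation by regeneration\<close>

lemma prob_UNIV [simp]: "P.prob UNIV = 1"
  using P.prob_space by simp

definition past :: "nat \<Rightarrow> (marks \<Rightarrow> real) \<Rightarrow> bool" where
  "past k Y \<longleftrightarrow> bdd Y \<and> depends_on {(t, i). t < k * S} Y"

lemma past_mono: "past k Y \<Longrightarrow> k \<le> l \<Longrightarrow> past l Y"
  unfolding past_def by (auto intro: depends_on_mono order_less_le_trans mult_right_mono)

lemma past_const: "past k (\<lambda>_. c)"
  by (auto simp: past_def bdd_const depends_on_const)

lemma past_mult: "past k Y \<Longrightarrow> past k Z \<Longrightarrow> past k (\<lambda>w. Y w * Z w)"
  unfolding past_def by (auto intro: bdd_mult depends_on_compose2)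

lemma past_diff: "past k Y \<Longrightarrow> past k Z \<Longrightarrow> past k (\<lambda>w. Y w - Z w)"
  unfolding past_def by (auto intro: bdd_diff depends_on_compose2)

lemma past_prod: "(\<And>i. i \<in> I \<Longrightarrow> past k (f i)) \<Longrightarrow> past k (\<lambda>w. \<Prod>i\<in>I. f i w)"
  by (induction I rule: infinite_finite_induct) (auto intro: past_const past_mult)

lemma past_D: "past (Suc k) (D k)"
  unfolding past_def using D_bdd D_depends by blast

lemma expectation_past:
  assumes "past k Y" "bdd g"
  shows "P.expectation (\<lambda>w. Y w * g (fshift (k * S) (X k w) w)) = P.expectation Y * P.expectation g"
  using assms by (intro expectation_markov) (auto simp: past_def X_depends X_measurable)

lemma bdd_fshift: "bdd g \<Longrightarrow> bdd (\<lambda>w. g (fshift (k * S) (X k w) w))"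
  by (rule bdd_compose) measurable

lemma expectation_mono_bdd:
  "bdd f \<Longrightarrow> bdd g \<Longrightarrow> (\<And>w. f w \<le> g w) \<Longrightarrow> P.expectation f \<le> P.expectation g"
  by (intro integral_mono bdd_integrable) auto

lemma expectation_D_sq:
  assumes "past k Y" "\<And>w. Y w \<ge> 0"
  shows "P.expectation (\<lambda>w. Y w * (D k w)\<^sup>2) \<le> C * P.expectation Y"
proof -
  have Yb: "bdd Y" using assms by (simp add: past_def)
  have Y0: "P.expectation Y \<ge> 0" using assms by simp
  have "P.expectation (\<lambda>w. Y w * (D k w)\<^sup>2)
      \<le> P.expectation (\<lambda>w. Y w * sq_bound (fshift (k * S) (X k w) w))"
    by (intro expectation_mono_bdd bdd_mult bdd_power2 Yb D_bdd bdd_fshift sq_bound_bdd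
      mult_left_mono D_sq_le assms)
  also have "\<dots> = P.expectation Y * P.expectation sq_bound"
    by (rule expectation_past[OF assms(1) sq_bound_bdd])
  also have "\<dots> \<le> C * P.expectation Y"
    using mult_left_mono[OF expectation_sq_bound Y0] by (simp add: mult.commute)
  finally show ?thesis .
qed

lemma expectation_D:
  assumes "past k Y" "\<And>w. Y w \<ge> 0"
  shows "P.expectation (\<lambda>w. Y w * D k w) \<le> C * P.expectation Y"
proof -
  have Yb: "bdd Y" using assms by (simp add: past_def)
  have "P.expectation (\<lambda>w. Y w * D k w) \<le> P.expectation (\<lambda>w. Y w * (D k w)\<^sup>2)"
    by (intro expectation_mono_bdd bdd_mult bdd_power2 Yb D_bdd mult_left_mono D_le_sq assms)
  then show ?thesis using expectation_D_sq[OF assms] by linarith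
qed

definition G :: "nat \<Rightarrow> marks \<Rightarrow> real" where
  "G k w = indicator (regen L) (fshift (k * S) (X k w) w)"

definition p :: real where "p = P.prob (regen L)"

lemma regen_sets [measurable]: "regen L \<in> sets P"
proof -
  have "{w \<in> space P. (\<forall>i\<in>{1..int R}. \<forall>t\<in>{..<N * L}. w (t, i) > bmax) \<and>
     (\<forall>i\<in>{- int R<..0}. \<forall>r\<in>{..<N}. \<exists>t\<in>{r * L..<Suc r * L}. w (t, i) \<le> bmin)} \<in> sets P"
    by measurable
  then show ?thesis by (simp add: regen_def Ball_def)
qed

lemma G_01: "G k w = 0 \<or> G k w = 1" "0 \<le> G k w" "G k w \<le> 1"
  by (auto simp: G_def indicator_def)

lemma G_bdd: "bdd (G k)"
  unfolding G_def[abs_def] by (intro bdd_fshift bdd_indicator) measurable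

lemma regen_cong: "(\<And>t i. t < S \<Longrightarrow> w (t, i) = w' (t, i)) \<Longrightarrow> w \<in> regen L \<longleftrightarrow> w' \<in> regen L"
proof -
  assume eq: "\<And>t i. t < S \<Longrightarrow> w (t, i) = w' (t, i)"
  have *: "t < S" if "r < N" "t \<in> {r * L..<Suc r * L}" for r t
  proof -
    have "Suc r * L \<le> N * L" using that by (intro mult_right_mono) auto
    moreover have "t < Suc r * L" using that by simp
    ultimately show ?thesis unfolding S_def by (rule less_le_trans[rotated])
  qed
  have 1: "(\<exists>t\<in>{r * L..<Suc r * L}. w (t, i) \<le> bmin) \<longleftrightarrow> (\<exists>t\<in>{r * L..<Suc r * L}. w' (t, i) \<le> bmin)"
    if "r < N" for r i
    using eq *[OF that] by (intro bex_cong) auto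
  show ?thesis
    using 1 eq unfolding regen_def S_def[symmetric] by simp
qed

lemma G_past: "past (Suc k) (G k)"
  unfolding past_def depends_on_def
proof (intro conjI G_bdd allI impI)
  fix w w' :: marks assume eq: "\<forall>j\<in>{(t, i). t < Suc k * S}. w j = w' j"
  then have "X k w = X k w'" by (intro depends_onD[OF X_depends]) auto
  moreover have "fshift (k * S) x w \<in> regen L \<longleftrightarrow> fshift (k * S) x w' \<in> regen L" for x
    by (rule regen_cong) (use eq in \<open>auto simp: fshift_def\<close>)
  ultimately show "G k w = G k w'" by (simp add: G_def indicator_def)
qed

lemma expectation_G: "past k Y \<Longrightarrow> P.expectation (\<lambda>w. Y w * G k w) = P.expectation Y * p"
  unfolding G_def[abs_def] p_def
  by (subst expectation_past) (auto intro: bdd_indicator)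

definition no_regen :: "nat \<Rightarrow> nat \<Rightarrow> marks \<Rightarrow> real" where
  "no_regen l k w = (\<Prod>j\<in>{l..<k}. 1 - G j w)"

lemma no_regen_nonneg: "no_regen l k w \<ge> 0"
  unfolding no_regen_def using G_01 by (intro prod_nonneg) (auto simp: algebra_simps)

lemma past_no_regen: "past k (no_regen l k)"
  unfolding no_regen_def[abs_def]
  by (intro past_prod past_diff past_const past_mono[OF G_past]) auto

lemma past_bdd: "past k Y \<Longrightarrow> bdd Y" by (simp add: past_def)

text \<open>Regeneration is attempted in each slab with fresh marks, hence succeeds independently of the past.\<close>

lemma expectation_no_regen:
  assumes Y: "past l Y" and "l \<le> k"
  shows "P.expectation (\<lambda>w. Y w * no_regen l k w) = P.expectation Y * (1 - p) ^ (k - l)"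
  using \<open>l \<le> k\<close>
proof (induction k rule: dec_induct)
  case base then show ?case by (simp add: no_regen_def)
next
  case (step k)
  have past: "past k (\<lambda>w. Y w * no_regen l k w)"
    by (intro past_mult past_no_regen past_mono[OF Y step(1)])
  have "P.expectation (\<lambda>w. Y w * no_regen l (Suc k) w)
      = P.expectation (\<lambda>w. Y w * no_regen l k w - (Y w * no_regen l k w) * G k w)"
    using step(1) by (simp add: no_regen_def algebra_simps)
  also have "\<dots> = P.expectation (\<lambda>w. Y w * no_regen l k w) - P.expectation (\<lambda>w. Y w * no_regen l k w) * p"
    by (subst Bochner_Integration.integral_diff)
      (auto intro!: bdd_integrable bdd_mult G_bdd simp: past_bdd[OF past] expectation_G[OF past]
        past_bdd[OF Y] past_bdd[OF past_no_regen])
  also have "\<dots> = P.expectation Y * (1 - p) ^ (Suc k - l)"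
    using step by (simp add: Suc_diff_le algebra_simps)
  finally show ?case .
qed

lemma first_regen: "l \<le> k \<Longrightarrow> 1 = no_regen l k w + (\<Sum>j\<in>{l..<k}. no_regen l j w * G j w)"
proof (induction k rule: dec_induct)
  case base then show ?case by (simp add: no_regen_def)
next
  case (step k)
  then show ?case by (simp add: no_regen_def algebra_simps)
qed

text \<open>The increment of the front in the slab with index \<open>m\<close> after a regeneration, as a function of
  the field seen from the front when the regeneration begins.\<close>

definition later_incr :: "nat \<Rightarrow> marks \<Rightarrow> real" where
  "later_incr m w = indicator (regen L) w *
     real_of_int (front (run block (fshift S 0 w) (Suc m * S)) - front (run block (fshift S 0 w) (m * S)))"

definition d :: "nat \<Rightarrow> real" where "d m = P.expectation (later_incr m)"

lemma later_incr_bdd: "bdd (later_incr m)"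
proof -
  have "bdd (\<lambda>w. real_of_int (front (run block (fshift S 0 w) t)))" for t
    by (rule bdd_compose[OF front_run_bdd[OF block_fin], of "fshift S 0"]) measurable
  then show ?thesis
    unfolding later_incr_def[abs_def] of_int_diff by (intro bdd_mult bdd_indicator bdd_diff) measurable
qed

lemma D_after_regen: "G j w * D (j + Suc m) w = later_incr m (fshift (j * S) (X j w) w)"
proof (cases "fshift (j * S) (X j w) w \<in> regen L")
  case True
  define \<eta> where "\<eta> = run single w (j * S)"
  have \<eta>: "\<eta> \<in> fin_configs" unfolding \<eta>_def by (rule run_fin[OF single_fin])
  have x: "front \<eta> = X j w" by (simp add: \<eta>_def X_def)
  have reg: "fshift 0 (front \<eta>) (fshift (j * S) 0 w) \<in> regen L"
    using True by (simp add: x fshift_fshift)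
  have "X (j + Suc m) w = X j w + front (run block (fshift S 0 (fshift (j * S) (X j w) w)) (m * S))" for m
  proof -
    have "(j + Suc m) * S = j * S + (S + m * S)" by (simp add: algebra_simps)
    then have "X (j + Suc m) w = front (run \<eta> (fshift (j * S) 0 w) (S + m * S))"
      unfolding X_def \<eta>_def by (simp only: run_add)
    also have "\<dots> = X j w + front (run block (fshift S 0 (fshift (j * S) (X j w) w)) (m * S))"
      using front_after_regen[OF \<eta> reg, of "m * S"] by (simp add: S_def[symmetric] x fshift_fshift add.commute)
    finally show ?thesis .
  qed
  from this[of "Suc m"] this[of m] show ?thesis
    using True by (simp add: later_incr_def G_def D_def)
qed (simp add: later_incr_def G_def)

text \<open>The mean increment \<open>m\<close> slabs later on the event that a regeneration has occurred by then, decomposed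
  according to the slab of the first one.\<close>

definition c :: "nat \<Rightarrow> real" where
  "c m = (\<Sum>i<m. (1 - p) ^ i * d (m - 1 - i))"

lemma p_01: "0 \<le> p" "p \<le> 1" by (auto simp: p_def)

text \<open>After the first regeneration the past has been forgotten.  The event that no regeneration occurs
  between the slabs \<open>l\<close> and \<open>k\<close> contributes at most \<open>C (1 - p) ^ (k - l)\<close>, by the conditional
  moment bound for the increment in slab \<open>k\<close>.\<close>

lemma expectation_D_decorrelated:
  assumes Y: "past l Y" and Y0: "\<And>w. Y w \<ge> 0" and "l \<le> k"
  shows "P.expectation Y * c (k - l) \<le> P.expectation (\<lambda>w. Y w * D k w)"
    and "P.expectation (\<lambda>w. Y w * D k w) \<le> P.expectation Y * (c (k - l) + C * (1 - p) ^ (k - l))"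
proof -
  have YN: "past k (\<lambda>w. Y w * no_regen l k w)"
    by (intro past_mult past_no_regen past_mono[OF Y \<open>l \<le> k\<close>])
  have bD: "bdd (\<lambda>w. Y w * no_regen l k w * D k w)"
    by (intro bdd_mult past_bdd[OF YN] D_bdd)
  have trm: "P.expectation (\<lambda>w. Y w * no_regen l j w * G j w * D k w)
      = P.expectation Y * ((1 - p) ^ (j - l) * d (k - 1 - j))" and
      bterm: "bdd (\<lambda>w. Y w * no_regen l j w * G j w * D k w)" if "j \<in> {l..<k}" for j
  proof -
    have YNj: "past j (\<lambda>w. Y w * no_regen l j w)"
      by (intro past_mult past_no_regen past_mono[OF Y]) (use that in simp)
    show "bdd (\<lambda>w. Y w * no_regen l j w * G j w * D k w)"
      by (intro bdd_mult past_bdd[OF YNj] D_bdd G_bdd)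
    have k: "k = j + Suc (k - 1 - j)" using that by auto
    have "P.expectation (\<lambda>w. Y w * no_regen l j w * G j w * D k w)
        = P.expectation (\<lambda>w. Y w * no_regen l j w * later_incr (k - 1 - j) (fshift (j * S) (X j w) w))"
      using D_after_regen[of j _ "k - 1 - j"] k by (simp add: mult.assoc)
    also have "\<dots> = P.expectation (\<lambda>w. Y w * no_regen l j w) * d (k - 1 - j)"
      unfolding d_def by (rule expectation_past[OF YNj later_incr_bdd])
    also have "P.expectation (\<lambda>w. Y w * no_regen l j w) = P.expectation Y * (1 - p) ^ (j - l)"
      by (rule expectation_no_regen[OF Y]) (use that in simp)
    finally show "P.expectation (\<lambda>w. Y w * no_regen l j w * G j w * D k w)
      = P.expectation Y * ((1 - p) ^ (j - l) * d (k - 1 - j))" by simp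
  qed
  have "Y w * D k w = Y w * no_regen l k w * D k w + (\<Sum>j\<in>{l..<k}. Y w * no_regen l j w * G j w * D k w)" for w
  proof -
    have "Y w * D k w = Y w * D k w * 1" by simp
    also have "\<dots> = Y w * D k w * (no_regen l k w + (\<Sum>j\<in>{l..<k}. no_regen l j w * G j w))"
      by (subst first_regen[OF \<open>l \<le> k\<close>, of w]) simp
    also have "\<dots> = Y w * no_regen l k w * D k w + (\<Sum>j\<in>{l..<k}. Y w * no_regen l j w * G j w * D k w)"
      by (simp add: distrib_left sum_distrib_left mult_ac)
    finally show ?thesis .
  qed
  then have "P.expectation (\<lambda>w. Y w * D k w) = P.expectation (\<lambda>w. Y w * no_regen l k w * D k w
      + (\<Sum>j\<in>{l..<k}. Y w * no_regen l j w * G j w * D k w))"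
    by (simp only:)
  also have "\<dots> = P.expectation (\<lambda>w. Y w * no_regen l k w * D k w)
      + P.expectation (\<lambda>w. \<Sum>j\<in>{l..<k}. Y w * no_regen l j w * G j w * D k w)"
    by (intro Bochner_Integration.integral_add bdd_integrable bD bdd_sum bterm)
  also have "P.expectation (\<lambda>w. \<Sum>j\<in>{l..<k}. Y w * no_regen l j w * G j w * D k w)
      = (\<Sum>j\<in>{l..<k}. P.expectation Y * ((1 - p) ^ (j - l) * d (k - 1 - j)))"
    using bterm trm by (subst Bochner_Integration.integral_sum) (auto simp: bdd_integrable)
  also have "\<dots> = P.expectation Y * c (k - l)"
    unfolding c_def sum_distrib_left[symmetric]
    by (rule arg_cong2[where f = "(*)"], simp, rule sum.reindex_bij_witness[where i = "\<lambda>i. l + i" and j = "\<lambda>j. j - l"])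
      auto
  finally have eq: "P.expectation (\<lambda>w. Y w * D k w)
      = P.expectation (\<lambda>w. Y w * no_regen l k w * D k w) + P.expectation Y * c (k - l)" .
  have "P.expectation (\<lambda>w. Y w * no_regen l k w * D k w) \<ge> 0"
    using Y0 no_regen_nonneg D_nonneg by (intro Bochner_Integration.integral_nonneg) auto
  then show "P.expectation Y * c (k - l) \<le> P.expectation (\<lambda>w. Y w * D k w)" using eq by simp
  have "P.expectation (\<lambda>w. Y w * no_regen l k w * D k w) \<le> C * P.expectation (\<lambda>w. Y w * no_regen l k w)"
    using Y0 no_regen_nonneg by (intro expectation_D[OF YN]) auto
  also have "\<dots> = C * (P.expectation Y * (1 - p) ^ (k - l))"
    using expectation_no_regen[OF Y \<open>l \<le> k\<close>] by simp
  finally show "P.expectation (\<lambda>w. Y w * D k w) \<le> P.expectation Y * (c (k - l) + C * (1 - p) ^ (k - l))"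
    using eq by (simp add: algebra_simps)
qed

subsection \<open>Speed and fluctuations\<close>

text \<open>The \<open>S R\<close> marks ahead of the front exceed \<open>bmax\<close> with the first factor as probability, and each of the
  \<open>R N\<close> groups of \<open>L\<close> marks behind it contains one below \<open>bmin\<close> with probability \<open>1 - exp (- bmin / N)\<close>.
  None of this depends on the mesh.\<close>

definition p_min :: real where
  "p_min = exp (- bmax * R) * (1 - exp (- bmin / N)) ^ (R * N)"

lemma p_min_pos: "p_min > 0"
  using bmin_pos N_pos by (simp add: p_min_def)

lemma prob_all_above:
  assumes "finite J" "v = bmax \<or> v = bmin"
  shows "P.prob {w. \<forall>j\<in>J. w j > v} = exp (- v / S * card J)"
proof -
  have "P.prob {w. \<forall>j\<in>J. w j > v} = (\<Prod>j\<in>J. measure \<nu> {v<..})"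
    using prob_marks[OF assms(1), of "\<lambda>_. {v<..}"] by simp
  also have "\<dots> = exp (- v / S) ^ card J"
    using mark_above[OF assms(2)] by (simp add: S_def)
  also have "\<dots> = exp (- v / S * card J)"
    by (simp add: exp_of_nat_mult[symmetric] mult.commute)
  finally show ?thesis .
qed

lemma prob_some_below:
  assumes "finite J"
  shows "P.prob {w. \<exists>j\<in>J. w j \<le> bmin} = 1 - exp (- bmin / S * card J)"
    and "{w. \<exists>j\<in>J. w j \<le> bmin} \<in> sets P"
proof -
  have "{w \<in> space P. \<forall>j\<in>J. w j > bmin} \<in> sets P"
    by (rule sets.sets_Collect_finite_All) (use assms in measurable)
  then have m: "{w. \<forall>j\<in>J. w j > bmin} \<in> sets P" by simp
  have eq: "{w. \<exists>j\<in>J. w j \<le> bmin} = space P - {w. \<forall>j\<in>J. w j > bmin}"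
    by (simp add: set_eq_iff) (meson not_le)
  show "{w. \<exists>j\<in>J. w j \<le> bmin} \<in> sets P" unfolding eq by (rule sets.compl_sets[OF m])
  show "P.prob {w. \<exists>j\<in>J. w j \<le> bmin} = 1 - exp (- bmin / S * card J)"
    unfolding eq P.prob_compl[OF m] by (subst prob_all_above[OF assms]) auto
qed

lemma p_eq: "p = p_min"
proof -
  define E where "E = {w :: marks. \<forall>j\<in>{..<S} \<times> {1..int R}. w j > bmax}"
  define F where "F = (\<lambda>(i, r). {w :: marks. \<exists>j\<in>{r * L..<Suc r * L} \<times> {i :: int}. w j \<le> bmin})"
  define B where "B = (\<lambda>(i, r). {r * L..<Suc r * L} \<times> {i :: int})"
  define J where "J = {- int R<..0} \<times> {..<N}"
  have fJ: "finite J" and cJ: "card J = R * N" by (auto simp: J_def card_cartesian_product)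
  have Fm: "F j \<in> sets P" for j
    unfolding F_def by (cases j) (simp only: prod.case, rule prob_some_below(2), simp)
  have Em: "E \<in> sets P"
  proof -
    have "{w \<in> space P. \<forall>j\<in>{..<S} \<times> {1..int R}. w j > bmax} \<in> sets P"
      by (rule sets.sets_Collect_finite_All) measurable
    then show ?thesis by (simp add: E_def)
  qed
  have FJm: "{w. \<forall>j\<in>J. w \<in> F j} \<in> sets P"
  proof -
    have "{w \<in> space P. \<forall>j\<in>J. w \<in> F j} \<in> sets P"
      by (rule sets.sets_Collect_finite_All[OF _ fJ]) (use Fm in simp)
    then show ?thesis by simp
  qed
  have PE: "P.prob E = exp (- bmax * R)"
    unfolding E_def using S_pos by (subst prob_all_above) (auto simp: card_cartesian_product)
  have PF: "P.prob (F j) = 1 - exp (- bmin / N)" for j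
  proof -
    obtain i r where j: "j = (i, r)" by force
    have "P.prob (F j) = 1 - exp (- bmin / S * card ({r * L..<Suc r * L} \<times> {i}))"
      unfolding F_def j by (simp only: prod.case) (rule prob_some_below(1), simp)
    also have "- bmin / S * card ({r * L..<Suc r * L} \<times> {i}) = - bmin / N"
      using L_pos N_pos by (simp add: card_cartesian_product S_def)
    finally show ?thesis .
  qed
  have PFJ: "P.prob {w. \<forall>j\<in>J. w \<in> F j} = (1 - exp (- bmin / N)) ^ (R * N)"
  proof -
    have "P.prob {w. \<forall>j\<in>J. w \<in> F j} = (\<Prod>j\<in>J. P.prob (F j))"
    proof (rule prob_inter_indep[OF fJ Fm, where B = B])
      show "depends_on (B j) (\<lambda>w. w \<in> F j)" for j
        unfolding depends_on_def B_def F_def by (cases j) simp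
      have "B (i, r) \<inter> B (i', r') = {}" if ne: "(i, r) \<noteq> (i', r')" for i i' r r'
      proof (rule ccontr)
        assume "B (i, r) \<inter> B (i', r') \<noteq> {}"
        then obtain t where t: "i = i'" "r * L \<le> t" "t < Suc r * L" "r' * L \<le> t" "t < Suc r' * L"
          by (auto simp: B_def simp del: mult_Suc)
        then have "t div L = r" "t div L = r'"
          using L_pos by (auto intro!: div_nat_eqI simp: mult.commute simp del: mult_Suc)
        then show False using t ne by simp
      qed
      then show "disjoint_family_on B J"
        unfolding disjoint_family_on_def by (metis surj_pair)
    qed
    then show ?thesis by (simp add: PF cJ)
  qed
  have regen_eq: "regen L = E \<inter> {w. \<forall>j\<in>J. w \<in> F j}"
    unfolding regen_def E_def F_def J_def S_def[symmetric]
    by (auto simp del: mult_Suc)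
  have "p = P.expectation (\<lambda>w. indicator E w * indicator {w. \<forall>j\<in>J. w \<in> F j} w)"
  proof -
    have "(\<lambda>w. indicator E w * indicator {w. \<forall>j\<in>J. w \<in> F j} w :: real) = indicator (regen L)"
      unfolding regen_eq by (auto simp: indicator_def fun_eq_iff)
    then show ?thesis by (simp add: p_def)
  qed
  also have "\<dots> = P.expectation (indicator E) * P.expectation (indicator {w. \<forall>j\<in>J. w \<in> F j})"
  proof (rule expectation_indep[where A = "{(t, i). i > 0}"])
    show "depends_on {(t, i). i > 0} (indicator E :: _ \<Rightarrow> real)"
      by (intro depends_on_indicator) (auto simp: depends_on_def E_def)
    show "depends_on (- {(t, i). i > 0}) (indicator {w. \<forall>j\<in>J. w \<in> F j} :: _ \<Rightarrow> real)"
    proof (rule depends_on_indicator, unfold mem_Collect_eq, rule depends_on_Ball)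
      fix j assume "j \<in> J"
      then show "depends_on (- {(t, i). i > 0}) (\<lambda>w. w \<in> F j)"
        unfolding depends_on_def F_def J_def by (auto simp del: mult_Suc)
    qed
  qed (use Em FJm in \<open>auto intro: bdd_indicator\<close>)
  finally show ?thesis using PE PFJ by (simp add: p_min_def)
qed

lemma p_pos: "p > 0" using p_eq p_min_pos by simp

definition speed_min :: real where "speed_min = 1 - exp (- bmin)"

lemma speed_min_pos: "speed_min > 0" using bmin_pos by (simp add: speed_min_def)

lemma D_ge_mark:
  assumes "fshift (k * S) (X k w) w \<in> {w. \<exists>j\<in>{..<S} \<times> {1}. w j \<le> bmin}"
  shows "D k w \<ge> 1"
proof -
  define \<eta> where "\<eta> = run single w (k * S)"
  have \<eta>: "\<eta> \<in> fin_configs" unfolding \<eta>_def by (rule run_fin[OF single_fin])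
  have x: "front \<eta> = X k w" by (simp add: \<eta>_def X_def)
  have "run \<eta> (fshift (k * S) 0 w) (1 * S) (X k w + 1) \<ge> 1"
    by (rule fill_site[OF fin_configsD(1)[OF \<eta>] front_in[OF \<eta>]])
      (use assms R_pos N_pos x in \<open>auto simp: fshift_def\<close>)
  then have "X k w + 1 \<in> occ (run \<eta> (fshift (k * S) 0 w) S)" by (simp add: occ_def)
  then have "X k w + 1 \<le> X (Suc k) w"
    unfolding X_slab using front_ge[OF run_fin[OF \<eta>]] by (simp add: \<eta>_def)
  then show ?thesis by (simp add: D_def)
qed

lemma expectation_D_ge: "P.expectation (D k) \<ge> speed_min"
proof -
  define E where "E = {w :: marks. \<exists>j\<in>{..<S} \<times> {1 :: int}. w j \<le> bmin}"
  have E: "E \<in> sets P" "P.prob E = speed_min"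
    using prob_some_below[of "{..<S} \<times> {1}"] S_pos by (auto simp: E_def speed_min_def card_cartesian_product)
  have "P.prob E = P.expectation (\<lambda>w. 1 * indicator E (fshift (k * S) (X k w) w))"
    using E by (subst expectation_past[OF past_const bdd_indicator]) auto
  also have "\<dots> \<le> P.expectation (D k)"
  proof (rule expectation_mono_bdd)
    show "bdd (\<lambda>w. 1 * indicator E (fshift (k * S) (X k w) w))"
      by (intro bdd_mult bdd_const bdd_fshift bdd_indicator E)
    fix w show "1 * indicator E (fshift (k * S) (X k w) w) \<le> D k w"
      using D_ge_mark[of k w] D_nonneg[of k w] by (auto simp: E_def indicator_def)
  qed (rule D_bdd)
  finally show ?thesis using E by simp
qed

lemma expectation_D_le: "P.expectation (D k) \<le> C"
  using expectation_D[OF past_const[of k 1]] by simp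

text \<open>All mean increments with index at least \<open>m\<close> lie between \<open>c m\<close> and \<open>c m + C (1 - p) ^ m\<close>.  Hence they
  converge, and the limit is the supremum of the lower bounds.\<close>

definition speed :: real where "speed = (SUP m. c m)"

lemma c_le_D: "m \<le> k \<Longrightarrow> c m \<le> P.expectation (D k)"
  and D_le_c: "m \<le> k \<Longrightarrow> P.expectation (D k) \<le> c m + C * (1 - p) ^ m"
  using expectation_D_decorrelated[OF past_const[of "k - m" 1], of k] by simp_all

lemma bdd_above_c: "bdd_above (range c)"
  using order_trans[OF c_le_D[OF order_refl] expectation_D_le] by (rule bdd_aboveI2)

lemma c_le_speed: "c m \<le> speed"
  unfolding speed_def by (rule cSUP_upper[OF _ bdd_above_c]) simp

lemma speed_le_c: "speed \<le> c m + C * (1 - p) ^ m"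
  unfolding speed_def
proof (rule cSUP_least)
  fix m' show "c m' \<le> c m + C * (1 - p) ^ m"
    using c_le_D[of m' "max m m'"] D_le_c[of m "max m m'"] by simp
qed simp

lemma speed_le: "speed \<le> C"
  unfolding speed_def by (rule cSUP_least) (simp, rule order_trans[OF c_le_D[OF order_refl] expectation_D_le])

lemma speed_ge: "speed_min \<le> speed"
proof -
  have "speed_min - C * (1 - p) ^ m \<le> speed" for m
    using expectation_D_ge[of m] D_le_c[of m m] c_le_speed[of m] by simp
  moreover have "(\<lambda>m. speed_min - C * (1 - p) ^ m) \<longlonglongrightarrow> speed_min - C * 0"
    using p_pos p_01 by (intro tendsto_intros LIMSEQ_power_zero) auto
  ultimately show ?thesis
    by (intro LIMSEQ_le_const2[where X = "\<lambda>m. speed_min - C * (1 - p) ^ m"]) auto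
qed

lemma expectation_D_speed:
  assumes Y: "past l Y" "\<And>w. Y w \<ge> 0" and "l \<le> k"
  shows "\<bar>P.expectation (\<lambda>w. Y w * (D k w - speed))\<bar> \<le> C * (1 - p) ^ (k - l) * P.expectation Y"
proof -
  have Y0: "P.expectation Y \<ge> 0" using Y by simp
  have "P.expectation (\<lambda>w. Y w * (D k w - speed))
      = P.expectation (\<lambda>w. Y w * D k w) - P.expectation Y * speed"
    unfolding right_diff_distrib
    by (subst Bochner_Integration.integral_diff)
      (auto intro!: bdd_integrable bdd_mult past_bdd[OF Y(1)] D_bdd bdd_const)
  moreover note expectation_D_decorrelated[OF Y \<open>l \<le> k\<close>]
  moreover have "P.expectation Y * c (k - l) \<le> P.expectation Y * speed"
    "P.expectation Y * speed \<le> P.expectation Y * (c (k - l) + C * (1 - p) ^ (k - l))"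
    using Y0 c_le_speed speed_le_c by (auto intro: mult_left_mono)
  ultimately show ?thesis by (simp add: algebra_simps abs_le_iff)
qed

lemma X_eq_sum: "real_of_int (X n w) = (\<Sum>k<n. D k w)"
proof (induction n)
  case 0
  have "front single = 0" using single_fin by (intro front_eqI) (auto simp: occ_single)
  then show ?case by (simp add: X_def)
qed (simp add: D_def)

definition var_rate :: real where "var_rate = 4 * C\<^sup>2 / p_min + C + C\<^sup>2"

lemma correlation_le:
  assumes "i < n"
  shows "P.expectation (\<lambda>w. (D i w - speed) * (D n w - speed)) \<le> 2 * C\<^sup>2 * (1 - p) ^ (n - Suc i)"
proof -
  let ?r = "(1 - p) ^ (n - Suc i)"
  have r0: "?r \<ge> 0" using p_01 by simp
  have sp: "0 \<le> speed" "speed \<le> C" using speed_ge speed_min_pos speed_le by auto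
  have bd: "bdd (\<lambda>w. D n w - speed)" by (intro bdd_diff D_bdd bdd_const)
  have "P.expectation (\<lambda>w. (D i w - speed) * (D n w - speed))
      = P.expectation (\<lambda>w. D i w * (D n w - speed)) - P.expectation (\<lambda>w. speed * (D n w - speed))"
    unfolding left_diff_distrib
    by (subst Bochner_Integration.integral_diff)
      (auto intro!: bdd_integrable bdd_mult bd D_bdd bdd_const simp flip: left_diff_distrib)
  also have "\<dots> \<le> C * ?r * P.expectation (D i) + C * ?r * speed"
  proof -
    have "P.expectation (\<lambda>w. D i w * (D n w - speed)) \<le> C * ?r * P.expectation (D i)"
      using expectation_D_speed[OF past_D D_nonneg, of i n] assms by (simp add: abs_le_iff)
    moreover have "- P.expectation (\<lambda>w. speed * (D n w - speed)) \<le> C * ?r * speed"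
      using expectation_D_speed[OF past_const[of "Suc i" speed], of n] assms sp
      by (simp add: abs_le_iff P.prob_space)
    ultimately show ?thesis by linarith
  qed
  also have "\<dots> \<le> C * ?r * C + C * ?r * C"
    using C_pos r0 sp expectation_D_le[of i] by (intro add_mono mult_left_mono) auto
  finally show ?thesis by (simp add: power2_eq_square algebra_simps)
qed

lemma sum_correlations_le:
  "(\<Sum>i<n. P.expectation (\<lambda>w. (D i w - speed) * (D n w - speed))) \<le> 2 * C\<^sup>2 / p"
proof -
  have "(\<Sum>i<n. P.expectation (\<lambda>w. (D i w - speed) * (D n w - speed)))
      \<le> (\<Sum>i<n. 2 * C\<^sup>2 * (1 - p) ^ (n - Suc i))"
    by (intro sum_mono correlation_le) simp
  also have "\<dots> = 2 * C\<^sup>2 * (\<Sum>i<n. (1 - p) ^ i)"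
    using sum.nat_diff_reindex[of "\<lambda>i. (1 - p) ^ i" n] by (simp add: sum_distrib_left[symmetric])
  also have "\<dots> = 2 * C\<^sup>2 * ((1 - (1 - p) ^ n) / p)"
    using p_pos by (simp add: sum_gp_strict)
  also have "\<dots> \<le> 2 * C\<^sup>2 / p"
    using p_pos p_01 C_pos by (simp add: divide_right_mono mult_left_le)
  finally show ?thesis .
qed

text \<open>The variance grows by a bounded amount per slab, since the correlations of an increment with the
  earlier ones are summable.\<close>

lemma fluctuation_bound: "P.expectation (\<lambda>w. (real_of_int (X n w) - speed * n)\<^sup>2) \<le> var_rate * n"
proof (induction n)
  case 0 show ?case by (simp add: X_eq_sum)
next
  case (Suc n)
  let ?Z = "\<lambda>w. real_of_int (X n w) - speed * n" and ?\<Delta> = "\<lambda>i w. D i w - speed"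
  have b\<Delta>: "bdd (?\<Delta> i)" for i by (intro bdd_diff D_bdd bdd_const)
  have Z: "?Z w = (\<Sum>i<n. ?\<Delta> i w)" for w
    by (simp add: X_eq_sum sum_subtractf mult.commute)
  have bZ: "bdd ?Z" unfolding Z by (intro bdd_sum b\<Delta>)
  have ZS: "real_of_int (X (Suc n) w) - speed * Suc n = ?Z w + ?\<Delta> n w" for w
    by (simp add: D_def algebra_simps)
  have sq: "(x + y)\<^sup>2 = x\<^sup>2 + 2 * (x * y) + y\<^sup>2" for x y :: real
    by (simp add: power2_sum)
  have "P.expectation (\<lambda>w. (real_of_int (X (Suc n) w) - speed * Suc n)\<^sup>2)
      = P.expectation (\<lambda>w. (?Z w)\<^sup>2 + 2 * (?Z w * ?\<Delta> n w) + (?\<Delta> n w)\<^sup>2)"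
    unfolding ZS sq ..
  also have "\<dots> = P.expectation (\<lambda>w. (?Z w)\<^sup>2) + 2 * P.expectation (\<lambda>w. ?Z w * ?\<Delta> n w)
      + P.expectation (\<lambda>w. (?\<Delta> n w)\<^sup>2)"
    by (subst Bochner_Integration.integral_add, intro bdd_integrable bdd_add bdd_power2 bdd_mult bZ b\<Delta> bdd_const,
      intro bdd_integrable bdd_power2 b\<Delta>,
      subst Bochner_Integration.integral_add, intro bdd_integrable bdd_power2 bZ,
      intro bdd_integrable bdd_mult bZ b\<Delta> bdd_const, simp)
  finally have eq: "P.expectation (\<lambda>w. (real_of_int (X (Suc n) w) - speed * Suc n)\<^sup>2)
      = P.expectation (\<lambda>w. (?Z w)\<^sup>2) + 2 * P.expectation (\<lambda>w. ?Z w * ?\<Delta> n w)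
        + P.expectation (\<lambda>w. (?\<Delta> n w)\<^sup>2)" .
  have "P.expectation (\<lambda>w. ?Z w * ?\<Delta> n w) = (\<Sum>i<n. P.expectation (\<lambda>w. ?\<Delta> i w * ?\<Delta> n w))"
    unfolding Z sum_distrib_right
    by (rule Bochner_Integration.integral_sum) (intro bdd_integrable bdd_mult b\<Delta>)
  then have "P.expectation (\<lambda>w. ?Z w * ?\<Delta> n w) \<le> 2 * C\<^sup>2 / p" using sum_correlations_le by simp
  moreover have "P.expectation (\<lambda>w. (?\<Delta> n w)\<^sup>2) \<le> C + C\<^sup>2"
  proof -
    have sp: "0 \<le> speed" "speed \<le> C" using speed_ge speed_min_pos speed_le by auto
    have "P.expectation (\<lambda>w. (?\<Delta> n w)\<^sup>2) \<le> P.expectation (\<lambda>w. 1 * (D n w)\<^sup>2 + C\<^sup>2)"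
    proof (rule expectation_mono_bdd)
      fix w
      have "(?\<Delta> n w)\<^sup>2 \<le> (D n w)\<^sup>2 + speed\<^sup>2"
        using mult_nonneg_nonneg[OF D_nonneg[of n w] sp(1)] by (simp add: power2_diff)
      moreover have "speed\<^sup>2 \<le> C\<^sup>2" using sp by (intro power_mono) auto
      ultimately show "(?\<Delta> n w)\<^sup>2 \<le> 1 * (D n w)\<^sup>2 + C\<^sup>2" by simp
    qed (intro bdd_power2 bdd_add bdd_mult b\<Delta> bdd_const D_bdd)+
    also have "\<dots> = P.expectation (\<lambda>w. 1 * (D n w)\<^sup>2) + C\<^sup>2"
      by (subst Bochner_Integration.integral_add)
        (auto intro!: bdd_integrable bdd_power2 D_bdd simp: P.prob_space)
    also have "P.expectation (\<lambda>w. 1 * (D n w)\<^sup>2) \<le> C"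
      using expectation_D_sq[OF past_const[of n 1]] by (simp add: P.prob_space)
    finally show ?thesis by simp
  qed
  moreover have "var_rate * Suc n = var_rate * n + 2 * (2 * C\<^sup>2 / p) + (C + C\<^sup>2)"
    by (simp add: var_rate_def p_eq distrib_left)
  ultimately show ?case using eq Suc by linarith
qed

end

section \<open>The driving Poisson process\<close>

definition strip :: "real \<Rightarrow> real \<Rightarrow> int set \<Rightarrow> real \<Rightarrow> (real \<times> int \<times> real) set" where
  "strip s t I v = {s<..t} \<times> (I \<times> {0..v})"

lemma strip_sets [measurable]:
  assumes "0 \<le> s" shows "strip s t I v \<in> sets driving_intensity"
  unfolding strip_def driving_intensity_def
  by (intro pair_measureI) (use assms in \<open>auto simp: sets_restrict_space_iff\<close>)

lemma emeasure_strip: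
  assumes "0 \<le> s" "s \<le> t" "finite I" "0 \<le> v"
  shows "emeasure driving_intensity (strip s t I v) = ennreal ((t - s) * card I * v)"
proof -
  interpret R: sigma_finite_measure "restrict_space lborel {0 :: real..}"
    by (rule sigma_finite_measure_restrict_space) (auto intro: sigma_finite_lborel)
  interpret Z: sigma_finite_measure "count_space (UNIV :: int set) \<Otimes>\<^sub>M restrict_space lborel {0 :: real..}"
    by (intro sigma_finite_pair_measure sigma_finite_measure_count_space R.sigma_finite_measure_axioms)
  have "{s<..t} \<in> sets (restrict_space lborel {0..})" "{0..v} \<in> sets (restrict_space lborel {0..})"
    using assms by (auto simp: sets_restrict_space_iff)
  then have "emeasure driving_intensity (strip s t I v)
      = emeasure (restrict_space lborel {0..}) {s<..t}
        * (emeasure (count_space UNIV) I * emeasure (restrict_space lborel {0..}) {0..v})"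
    unfolding strip_def driving_intensity_def
    by (simp only: Z.emeasure_pair_measure_Times R.emeasure_pair_measure_Times pair_measureI
      sets_count_space Pow_UNIV UNIV_I)
  also have "\<dots> = ennreal (t - s) * (of_nat (card I) * ennreal v)"
    using assms by (simp add: emeasure_restrict_space subset_eq)
  also have "\<dots> = ennreal ((t - s) * card I * v)"
    using assms by (simp add: ennreal_mult ennreal_of_nat_eq_real_of_nat mult.assoc)
  finally show ?thesis .
qed

lemma measure_strip:
  assumes "0 \<le> s" "s \<le> t" "finite I" "0 \<le> v"
  shows "measure driving_intensity (strip s t I v) = (t - s) * card I * v"
    and "emeasure driving_intensity (strip s t I v) < \<infinity>"
  using emeasure_strip[OF assms] assms by (auto simp: measure_def)

locale driven = prob_space M for M :: "'w measure" +
  fixes pts :: "'w \<Rightarrow> (real \<times> int \<times> real) measure"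
  assumes ppp: "poisson_point_process M driving_intensity pts"
begin

abbreviation count :: "'w \<Rightarrow> (real \<times> int \<times> real) set \<Rightarrow> ennreal" where
  "count \<omega> A \<equiv> emeasure (pts \<omega>) A"

lemma sets_pts: "\<omega> \<in> space M \<Longrightarrow> sets (pts \<omega>) = sets driving_intensity"
  using ppp unfolding poisson_point_process_def by blast

lemma count_values:
  "\<omega> \<in> space M \<Longrightarrow> A \<in> sets driving_intensity \<Longrightarrow> count \<omega> A \<in> insert \<infinity> (range of_nat)"
  using ppp unfolding poisson_point_process_def by blast

lemma count_measurable [measurable]:
  "A \<in> sets driving_intensity \<Longrightarrow> (\<lambda>\<omega>. count \<omega> A) \<in> borel_measurable M"
  using ppp unfolding poisson_point_process_def by blast

lemma prob_count:
  assumes "A \<in> sets driving_intensity" "emeasure driving_intensity A < \<infinity>"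
  shows "prob {\<omega> \<in> space M. count \<omega> A = of_nat n} =
    measure driving_intensity A ^ n / fact n * exp (- measure driving_intensity A)"
  using ppp assms unfolding poisson_point_process_def by blast

lemma prob_void:
  assumes "A \<in> sets driving_intensity" "emeasure driving_intensity A < \<infinity>"
  shows "prob {\<omega> \<in> space M. count \<omega> A = 0} = exp (- measure driving_intensity A)"
  using prob_count[OF assms, of 0] by simp

lemma prob_not_void:
  assumes "A \<in> sets driving_intensity" "emeasure driving_intensity A < \<infinity>"
  shows "prob {\<omega> \<in> space M. count \<omega> A \<noteq> 0} = 1 - exp (- measure driving_intensity A)"
proof -
  note [measurable] = assms(1)
  have "{\<omega> \<in> space M. count \<omega> A \<noteq> 0} = space M - {\<omega> \<in> space M. count \<omega> A = 0}" by auto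
  then show ?thesis using prob_compl[of "{\<omega> \<in> space M. count \<omega> A = 0}"] prob_void[OF assms] by simp
qed

text \<open>Two points in a small set have a probability of second order, by \<open>exp (- a) \<ge> 1 - a\<close>.\<close>

lemma prob_many:
  assumes A: "A \<in> sets driving_intensity" "emeasure driving_intensity A < \<infinity>"
  shows "prob {\<omega> \<in> space M. \<not> count \<omega> A \<le> 1} \<le> (measure driving_intensity A)\<^sup>2"
proof -
  note [measurable] = A(1)
  define a where "a = measure driving_intensity A"
  let ?E = "\<lambda>n :: nat. {\<omega> \<in> space M. count \<omega> A = of_nat n}"
  have E: "?E n \<in> events" for n by measurable
  have "{\<omega> \<in> space M. \<not> count \<omega> A \<le> 1} \<subseteq> space M - (?E 0 \<union> ?E 1)" by auto
  then have "prob {\<omega> \<in> space M. \<not> count \<omega> A \<le> 1} \<le> prob (space M - (?E 0 \<union> ?E 1))"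
    using E[of 0] E[of 1] by (intro finite_measure_mono sets.Diff sets.Un) auto
  also have "\<dots> = 1 - prob (?E 0 \<union> ?E 1)"
    using E[of 0] E[of 1] by (intro prob_compl sets.Un)
  also have "prob (?E 0 \<union> ?E 1) = prob (?E 0) + prob (?E 1)"
    using E[of 0] E[of 1] by (intro finite_measure_Union) auto
  also have "\<dots> = (1 + a) * exp (- a)"
    unfolding prob_count[OF A] by (simp add: a_def algebra_simps)
  also have "1 - (1 + a) * exp (- a) \<le> a\<^sup>2"
  proof -
    have "(1 + a) * (1 + - a) \<le> (1 + a) * exp (- a)"
      by (intro mult_left_mono exp_ge_add_one_self) (simp add: a_def)
    then show ?thesis by (simp add: algebra_simps power2_eq_square)
  qed
  finally show ?thesis unfolding a_def .
qed

lemma prob_counts_indep: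
  assumes J: "finite J" and B: "\<And>j. j \<in> J \<Longrightarrow> B j \<in> sets driving_intensity"
    and disj: "disjoint_family_on B J" and Z: "\<And>j. j \<in> J \<Longrightarrow> Z j \<in> sets borel"
  shows "prob {\<omega> \<in> space M. \<forall>j\<in>J. count \<omega> (B j) \<in> Z j}
    = (\<Prod>j\<in>J. prob {\<omega> \<in> space M. count \<omega> (B j) \<in> Z j})"
proof (cases "J = {}")
  case True then show ?thesis using prob_space by simp
next
  case False
  obtain f where f: "bij_betw f {..<card J} J"
    using ex_bij_betw_nat_finite[OF J] by (auto simp: atLeast0LessThan)
  have fJ: "f i \<in> J" if "i < card J" for i using bij_betwE[OF f] that by blast
  define A where "A i = (if i < card J then B (f i) else {})" for i
  have "range A \<subseteq> sets driving_intensity" using B fJ by (auto simp: A_def)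
  moreover have "disjoint_family A"
    unfolding disjoint_family_on_def
  proof (intro ballI impI)
    fix i j :: nat assume ne: "i \<noteq> j"
    show "A i \<inter> A j = {}"
    proof (cases "i < card J \<and> j < card J")
      case True
      then have "f i \<noteq> f j" using bij_betw_imp_inj_on[OF f] ne by (auto dest: inj_onD)
      then show ?thesis using disj fJ True unfolding A_def disjoint_family_on_def by simp
    qed (auto simp: A_def)
  qed
  ultimately have ind: "indep_vars (\<lambda>_. borel) (\<lambda>i \<omega>. count \<omega> (A i)) UNIV"
    using ppp unfolding poisson_point_process_def by blast
  have "prob (\<Inter>i\<in>{..<card J}. (\<lambda>\<omega>. count \<omega> (A i)) -` Z (f i) \<inter> space M)
      = (\<Prod>i\<in>{..<card J}. prob ((\<lambda>\<omega>. count \<omega> (A i)) -` Z (f i) \<inter> space M))"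
  proof (rule indep_varsD[OF ind])
    show "{..<card J} \<noteq> {}" using False J by (simp add: lessThan_empty_iff)
  qed (use Z fJ in auto)
  also have "(\<Prod>i\<in>{..<card J}. prob ((\<lambda>\<omega>. count \<omega> (A i)) -` Z (f i) \<inter> space M))
      = (\<Prod>i\<in>{..<card J}. prob {\<omega> \<in> space M. count \<omega> (B (f i)) \<in> Z (f i)})"
    by (intro prod.cong refl arg_cong[where f = prob]) (auto simp: A_def)
  also have "\<dots> = (\<Prod>j\<in>J. prob {\<omega> \<in> space M. count \<omega> (B j) \<in> Z j})"
    by (rule prod.reindex_bij_betw[OF f])
  also have "(\<Inter>i\<in>{..<card J}. (\<lambda>\<omega>. count \<omega> (A i)) -` Z (f i) \<inter> space M)
      = {\<omega> \<in> space M. \<forall>j\<in>J. count \<omega> (B j) \<in> Z j}"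
  proof -
    have "{\<omega> \<in> space M. \<forall>j\<in>J. count \<omega> (B j) \<in> Z j}
        = {\<omega> \<in> space M. \<forall>i\<in>{..<card J}. count \<omega> (B (f i)) \<in> Z (f i)}"
      unfolding bij_betw_ball[OF f] ..
    moreover have "card J > 0" using False J by (simp add: card_gt_0_iff)
    ultimately show ?thesis by (auto simp: A_def)
  qed
  finally show ?thesis .
qed

text \<open>Infinitely many independent void events of equal positive probability cannot all fail.\<close>

lemma AE_void_somewhere:
  fixes A :: "nat \<Rightarrow> (real \<times> int \<times> real) set"
  assumes A: "\<And>n. A n \<in> sets driving_intensity" "disjoint_family A"
    and c: "\<And>n. emeasure driving_intensity (A n) < \<infinity>" "\<And>n. measure driving_intensity (A n) = c"
  shows "AE \<omega> in M. \<exists>n. count \<omega> (A n) = 0"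
proof -
  note [measurable] = A(1)
  define E where "E = {\<omega> \<in> space M. \<forall>n. count \<omega> (A n) \<noteq> 0}"
  have E: "E \<in> events" unfolding E_def by measurable
  have c0: "c \<ge> 0" using c(2)[of 0] by (metis measure_nonneg)
  have "prob E \<le> (1 - exp (- c)) ^ k" for k
  proof -
    have "prob E \<le> prob {\<omega> \<in> space M. \<forall>n\<in>{..<k}. count \<omega> (A n) \<in> - {0}}"
      by (rule finite_measure_mono) (auto simp: E_def)
    also have "\<dots> = (\<Prod>n\<in>{..<k}. prob {\<omega> \<in> space M. count \<omega> (A n) \<in> - {0}})"
      by (rule prob_counts_indep) (use A in \<open>auto intro: disjoint_family_on_mono\<close>)
    also have "\<dots> = (1 - exp (- c)) ^ k"
      using prob_not_void[OF A(1) c(1)] c(2) by simp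
    finally show ?thesis .
  qed
  moreover have "(\<lambda>k. (1 - exp (- c)) ^ k) \<longlonglongrightarrow> 0"
    using c0 by (intro LIMSEQ_power_zero) auto
  ultimately have "prob E \<le> 0" by (intro LIMSEQ_le_const[where X = "\<lambda>k. (1 - exp (- c)) ^ k"]) auto
  then have "E \<in> null_sets M" using E by (simp add: null_sets_def emeasure_eq_measure measure_le_0_iff)
  then show ?thesis by (rule AE_I') (auto simp: E_def)
qed

lemma AE_void_null:
  assumes "A \<in> sets driving_intensity" "emeasure driving_intensity A = 0"
  shows "AE \<omega> in M. count \<omega> A = 0"
proof -
  note [measurable] = assms(1)
  have "prob {\<omega> \<in> space M. count \<omega> A = 0} = 1"
    using prob_void[OF assms(1)] assms(2) by (simp add: measure_def)
  then have "AE \<omega> in M. \<omega> \<in> {\<omega> \<in> space M. count \<omega> A = 0}"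
    by (subst (asm) prob_eq_1) auto
  then show ?thesis by auto
qed

text \<open>A unit of time has \<open>N 2\<^sup>n\<close> cells, each of which contains two points with a probability of
  order \<open>4\<^sup>-\<^sup>n\<close>.  The sum over the cells is summable over \<open>n\<close>.\<close>

lemma AE_cells:
  assumes v: "v \<ge> 0" and N: "N \<ge> 1"
  shows "AE \<omega> in M. \<forall>\<^sub>F n in sequentially. \<forall>t<m * (N * 2 ^ n).
    count \<omega> (strip (real t / real (N * 2 ^ n)) (real (Suc t) / real (N * 2 ^ n)) {- int l..int l} v) \<le> 1"
proof -
  define S :: "nat \<Rightarrow> nat" where "S n = N * 2 ^ n" for n
  define B where "B n t = strip (real t / S n) (real (Suc t) / S n) {- int l..int l} v" for n t
  define k where "k = real (2 * l + 1) * v"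
  have S0: "real (S n) > 0" "2 ^ n \<le> real (S n)" for n
    using N by (auto simp: S_def)
  have B: "B n t \<in> sets driving_intensity" for n t unfolding B_def using S0 by simp
  note [measurable] = B
  have mB: "measure driving_intensity (B n t) = k / S n" "emeasure driving_intensity (B n t) < \<infinity>" for n t
  proof -
    have le: "real t / S n \<le> real (Suc t) / S n" by (simp add: divide_right_mono)
    have *: "0 \<le> real t / S n" "finite {- int l..int l}" by auto
    have card: "real (card {- int l..int l}) * v = k" by (simp add: k_def)
    have diff: "real (Suc t) / S n - real t / S n = 1 / S n"
      by (simp add: diff_divide_distrib[symmetric])
    show "measure driving_intensity (B n t) = k / S n"
      unfolding B_def measure_strip(1)[OF *(1) le *(2) v] diff mult.assoc card by simp
    show "emeasure driving_intensity (B n t) < \<infinity>"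
      unfolding B_def by (rule measure_strip(2)[OF *(1) le *(2) v])
  qed
  define bad where "bad n = (\<Union>t<m * S n. {\<omega> \<in> space M. \<not> count \<omega> (B n t) \<le> 1})" for n
  have bad: "bad n \<in> events" for n unfolding bad_def by measurable
  have "prob (bad n) \<le> m * k\<^sup>2 * (1 / 2) ^ n" for n
  proof -
    have "prob (bad n) \<le> (\<Sum>t<m * S n. prob {\<omega> \<in> space M. \<not> count \<omega> (B n t) \<le> 1})"
      unfolding bad_def by (rule finite_measure_subadditive_finite) auto
    also have "\<dots> \<le> (\<Sum>t<m * S n. (k / S n)\<^sup>2)"
      using prob_many[OF B mB(2)] mB(1) by (intro sum_mono) simp
    also have "\<dots> = m * k\<^sup>2 * (1 / S n)"
      using S0(1)[of n] by (simp add: power2_eq_square)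
    also have "\<dots> \<le> m * k\<^sup>2 * (1 / 2 ^ n)"
      using S0[of n] by (intro mult_left_mono divide_left_mono) auto
    finally show ?thesis by (simp add: power_one_over)
  qed
  moreover have "summable (\<lambda>n. m * k\<^sup>2 * (1 / 2 :: real) ^ n)"
    by (rule summable_mult, rule summable_geometric) simp
  ultimately have "summable (\<lambda>n. prob (bad n))"
    by - (rule summable_comparison_test'[where g = "\<lambda>n. m * k\<^sup>2 * (1 / 2) ^ n" and N = 0], simp_all)
  then have "AE \<omega> in M. \<forall>\<^sub>F n in sequentially. \<omega> \<in> space M - bad n"
    by (rule borel_cantelli_AE1[OF bad, rotated]) (simp add: emeasure_eq_measure)
  then show ?thesis
  proof eventually_elim
    case (elim \<omega>)
    then show ?case
    proof eventually_elim
      case (elim n)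
      then have "\<forall>t<m * S n. count \<omega> (B n t) \<le> 1" by (simp add: bad_def)
      then show ?case unfolding B_def S_def .
    qed
  qed
qed

text \<open>The void probabilities decay exponentially in \<open>k\<close>, whereas the number of sites is linear in \<open>k\<close>.\<close>

lemma AE_no_long_void:
  fixes v \<delta> :: real
  assumes v: "v > 0" and \<delta>: "\<delta> > 0"
  shows "AE \<omega> in M. \<forall>\<^sub>F k in sequentially. \<forall>x\<in>{- int (l * k)..int (l * k)}.
    count \<omega> (strip (real k) (real (k + nat \<lceil>\<delta> * real k\<rceil>)) {x} v) \<noteq> 0"
proof -
  define m where "m k = nat \<lceil>\<delta> * real k\<rceil>" for k
  define B where "B k x = strip (real k) (real (k + m k)) {x} v" for k x
  have B: "B k x \<in> sets driving_intensity" for k x unfolding B_def by simp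
  note [measurable] = B
  have mB: "measure driving_intensity (B k x) = m k * v" "emeasure driving_intensity (B k x) < \<infinity>" for k x
  proof -
    have *: "0 \<le> real k" "real k \<le> real (k + m k)" "finite {x}" "0 \<le> v" using v by auto
    show "measure driving_intensity (B k x) = m k * v"
      unfolding B_def measure_strip(1)[OF *] by simp
    show "emeasure driving_intensity (B k x) < \<infinity>"
      unfolding B_def by (rule measure_strip(2)[OF *])
  qed
  define r where "r = exp (- (\<delta> * v))"
  have r: "0 \<le> r" "r < 1" using assms by (auto simp: r_def)
  define bad where "bad k = (\<Union>x\<in>{- int (l * k)..int (l * k)}. {\<omega> \<in> space M. count \<omega> (B k x) = 0})" for k
  have bad: "bad k \<in> events" for k unfolding bad_def by measurable
  have le: "prob (bad k) \<le> (2 * real l + 1) * ((real k + 1) * r ^ k)" for k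
  proof -
    have "prob (bad k) \<le> (\<Sum>x\<in>{- int (l * k)..int (l * k)}. prob {\<omega> \<in> space M. count \<omega> (B k x) = 0})"
      unfolding bad_def by (rule finite_measure_subadditive_finite) auto
    also have "\<dots> \<le> (\<Sum>x\<in>{- int (l * k)..int (l * k)}. r ^ k)"
    proof (rule sum_mono)
      fix x
      have "\<delta> * real k \<le> real (m k)" unfolding m_def by (rule real_nat_ceiling_ge)
      then have "\<delta> * real k * v \<le> real (m k) * v" using v by (intro mult_right_mono) auto
      then have "- (real (m k) * v) \<le> real k * - (\<delta> * v)" by (simp add: mult_ac)
      then have "exp (- (real (m k) * v)) \<le> exp (real k * - (\<delta> * v))" by (simp only: exp_le_cancel_iff)
      also have "\<dots> = r ^ k" unfolding r_def by (rule exp_of_nat_mult)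
      finally show "prob {\<omega> \<in> space M. count \<omega> (B k x) = 0} \<le> r ^ k"
        by (simp only: prob_void[OF B mB(2)] mB(1))
    qed
    also have "\<dots> = (2 * real l * real k + 1) * r ^ k" by simp
    also have "\<dots> \<le> ((2 * real l + 1) * (real k + 1)) * r ^ k"
    proof (rule mult_right_mono)
      show "2 * real l * real k + 1 \<le> (2 * real l + 1) * (real k + 1)"
        by (simp add: distrib_left distrib_right)
    qed (use r in simp)
    finally show ?thesis by (simp only: mult.assoc)
  qed
  have "summable (\<lambda>k. (real k + 1) * r ^ k)"
    by (rule summableI_nonneg_bounded[OF _ sum_mult_geometric_le[OF r]]) (use r in auto)
  from summable_mult[OF this, of "2 * real l + 1"]
  have "summable (\<lambda>k. prob (bad k))"
    using le by - (rule summable_comparison_test'[where g = "\<lambda>k. (2 * real l + 1) * ((real k + 1) * r ^ k)" and N = 0],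
      simp_all)
  then have "AE \<omega> in M. \<forall>\<^sub>F k in sequentially. \<omega> \<in> space M - bad k"
    by (rule borel_cantelli_AE1[OF bad, rotated]) (simp add: emeasure_eq_measure)
  then show ?thesis
  proof eventually_elim
    case (elim \<omega>)
    then show ?case
    proof eventually_elim
      case (elim k)
      then have "\<forall>x\<in>{- int (l * k)..int (l * k)}. count \<omega> (B k x) \<noteq> 0"
        by (simp add: bad_def del: of_nat_mult)
      then show ?case unfolding B_def m_def .
    qed
  qed
qed

end

section \<open>The marks of a discretisation\<close>

locale driven_model = birth_model N R b + driven M pts
  for N R :: nat and b :: rate and M :: "'w measure" and pts
begin

definition cell :: "nat \<Rightarrow> nat \<Rightarrow> int set \<Rightarrow> real \<Rightarrow> (real \<times> int \<times> real) set" where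
  "cell S t I v = strip (real t / S) (real (Suc t) / S) I v"

lemma cell_sets [measurable]: "cell S t I v \<in> sets driving_intensity"
  unfolding cell_def by simp

lemma measure_cell:
  assumes "S \<ge> 1" "v \<ge> 0"
  shows "measure driving_intensity (cell S t {i} v) = v / S"
    and "emeasure driving_intensity (cell S t {i} v) < \<infinity>"
proof -
  have *: "0 \<le> real t / S" "real t / S \<le> real (Suc t) / S" "finite {i}"
    by (auto simp: divide_right_mono)
  have "real (Suc t) / S - real t / S = 1 / S"
    by (simp add: diff_divide_distrib[symmetric])
  then show "measure driving_intensity (cell S t {i} v) = v / S"
    unfolding cell_def measure_strip(1)[OF * assms(2)] by simp
  show "emeasure driving_intensity (cell S t {i} v) < \<infinity>"
    unfolding cell_def by (rule measure_strip(2)[OF * assms(2)])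
qed

text \<open>The mark is the smallest positive rate below which the cell contains a point: the only thing
  that matters for the discretised process is which rates are at least the height of such a point.  The
  value \<open>bmax + 1\<close> says that there is no such rate.\<close>

definition mark :: "nat \<Rightarrow> 'w \<Rightarrow> marks" where
  "mark S \<omega> = (\<lambda>(t, i). Min (insert (bmax + 1) {v \<in> pos_rates. count \<omega> (cell S t {i} v) \<noteq> 0}))"

lemma count_cell_mono:
  assumes "\<omega> \<in> space M" "v \<le> v'"
  shows "count \<omega> (cell S t I v) \<le> count \<omega> (cell S t I v')"
proof (rule emeasure_mono)
  show "cell S t I v \<subseteq> cell S t I v'" using assms(2) by (auto simp: cell_def strip_def)
  show "cell S t I v' \<in> sets (pts \<omega>)" using sets_pts[OF assms(1)] by simp
qed

lemma mark_gt_iff: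
  assumes \<omega>: "\<omega> \<in> space M" and v: "v \<in> pos_rates"
  shows "mark S \<omega> (t, i) > v \<longleftrightarrow> count \<omega> (cell S t {i} v) = 0"
proof -
  let ?A = "{v \<in> pos_rates. count \<omega> (cell S t {i} v) \<noteq> 0}"
  have fin: "finite (insert (bmax + 1) ?A)" using finite_pos_rates by simp
  have "mark S \<omega> (t, i) > v \<longleftrightarrow> (\<forall>u\<in>?A. v < u)"
    using fin pos_rates_bounds[OF v] by (simp add: mark_def)
  also have "\<dots> \<longleftrightarrow> count \<omega> (cell S t {i} v) = 0"
  proof
    assume "\<forall>u\<in>?A. v < u"
    then show "count \<omega> (cell S t {i} v) = 0" using v by blast
  next
    assume 0: "count \<omega> (cell S t {i} v) = 0"
    show "\<forall>u\<in>?A. v < u"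
    proof (intro ballI, rule ccontr)
      fix u assume u: "u \<in> ?A" "\<not> v < u"
      then have "count \<omega> (cell S t {i} u) \<le> count \<omega> (cell S t {i} v)"
        by (intro count_cell_mono \<omega>) simp
      then show False using 0 u by simp
    qed
  qed
  finally show ?thesis .
qed

lemma mark_values: "mark S \<omega> j \<in> insert (bmax + 1) pos_rates"
proof -
  obtain t i where j: "j = (t, i)" by force
  have "mark S \<omega> j \<in> insert (bmax + 1) {v \<in> pos_rates. count \<omega> (cell S t {i} v) \<noteq> 0}"
    unfolding mark_def j prod.case using finite_pos_rates by (intro Min_in) simp_all
  then show ?thesis by blast
qed

lemma mark_le: "mark S \<omega> j \<le> bmax + 1"
proof (cases "mark S \<omega> j \<in> pos_rates")
  case True then show ?thesis using pos_rates_bounds[OF True] by linarith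
next
  case False then show ?thesis using mark_values[of S \<omega> j] by simp
qed

text \<open>A mark exceeds \<open>v\<close> if and only if the cell is void up to the largest rate that is at most \<open>v\<close>.  Void
  events of disjoint sets are independent.\<close>

definition void_set :: "nat \<Rightarrow> real \<Rightarrow> nat \<times> int \<Rightarrow> (real \<times> int \<times> real) set" where
  "void_set S v = (\<lambda>(t, i). if \<exists>u\<in>pos_rates. u \<le> v
     then cell S t {i} (Max {u \<in> pos_rates. u \<le> v}) else {})"

lemma mark_gt_void:
  assumes \<omega>: "\<omega> \<in> space M" and v: "v < bmax + 1"
  shows "mark S \<omega> j > v \<longleftrightarrow> count \<omega> (void_set S v j) = 0"
proof -
  obtain t i where j: "j = (t, i)" by force
  show ?thesis
  proof (cases "\<exists>u\<in>pos_rates. u \<le> v")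
    case True
    define u where "u = Max {u \<in> pos_rates. u \<le> v}"
    have fin: "finite {u \<in> pos_rates. u \<le> v}" using finite_pos_rates by simp
    then have "u \<in> {u \<in> pos_rates. u \<le> v}" unfolding u_def by (rule Max_in) (use True in blast)
    then have u: "u \<in> pos_rates" "u \<le> v" by auto
    have ge: "u' \<le> u" if "u' \<in> pos_rates" "u' \<le> v" for u'
      unfolding u_def using that fin by (intro Max_ge) auto
    have "mark S \<omega> j > v \<longleftrightarrow> mark S \<omega> j > u"
    proof (cases "mark S \<omega> j \<in> pos_rates")
      case True then show ?thesis using ge[OF True] u(2) by linarith
    next
      case False
      then have "mark S \<omega> j = bmax + 1" using mark_values[of S \<omega> j] by simp
      then show ?thesis using u(2) v by linarith
    qed
    then show ?thesis
      using True mark_gt_iff[OF \<omega> u(1), of S t i] by (simp add: void_set_def j u_def)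
  next
    case False
    then have "mark S \<omega> j \<noteq> u" if "u \<in> pos_rates" "u \<le> v" for u using that by blast
    then have "mark S \<omega> j > v" using mark_values[of S \<omega> j] v by (cases "mark S \<omega> j \<le> v") auto
    then show ?thesis using False by (simp add: void_set_def j)
  qed
qed

lemma void_set_sets [measurable]: "void_set S v j \<in> sets driving_intensity"
  by (cases j) (simp add: void_set_def)

text \<open>The probability depends on the cell only through its length.\<close>

lemma prob_mark_gt_cong:
  assumes "S \<ge> 1"
  shows "prob {\<omega> \<in> space M. mark S \<omega> j > v} = prob {\<omega> \<in> space M. mark S \<omega> j' > v}"
proof (cases "v < bmax + 1")
  case True
  have "prob {\<omega> \<in> space M. mark S \<omega> j > v} = (if \<exists>u\<in>pos_rates. u \<le> v
      then exp (- (Max {u \<in> pos_rates. u \<le> v} / S)) else 1)" for j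
  proof (cases "\<exists>u\<in>pos_rates. u \<le> v")
    case ex: True
    obtain t i where j: "j = (t, i)" by force
    define u where "u = Max {u \<in> pos_rates. u \<le> v}"
    have "u \<in> {u \<in> pos_rates. u \<le> v}" unfolding u_def by (rule Max_in) (use ex finite_pos_rates in auto)
    then have u: "u \<ge> 0" using pos_rates_pos by (auto intro: less_imp_le)
    have "prob {\<omega> \<in> space M. mark S \<omega> j > v} = prob {\<omega> \<in> space M. count \<omega> (cell S t {i} u) = 0}"
      using mark_gt_void[OF _ True] ex by (intro arg_cong[where f = prob]) (auto simp: void_set_def j u_def)
    also have "\<dots> = exp (- (u / S))"
      using prob_void[OF cell_sets measure_cell(2)[OF assms u]] measure_cell(1)[OF assms u] by simp
    finally show ?thesis using ex by (simp add: u_def)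
  next
    case False
    then have "{\<omega> \<in> space M. mark S \<omega> j > v} = space M"
      using mark_gt_void[OF _ True] by (cases j) (auto simp: void_set_def)
    then show ?thesis using False prob_space by simp
  qed
  then show ?thesis by simp
next
  case False
  have "\<not> mark S \<omega> j > v" for j \<omega>
    using mark_le[of S \<omega> j] False by linarith
  then show ?thesis by simp
qed

lemma mark_gt_sets: "{\<omega> \<in> space M. mark S \<omega> j > v} \<in> events"
proof (cases "v < bmax + 1")
  case True
  then have "{\<omega> \<in> space M. mark S \<omega> j > v} = {\<omega> \<in> space M. count \<omega> (void_set S v j) = 0}"
    using mark_gt_void by blast
  then show ?thesis by simp
next
  case False
  have "\<not> mark S \<omega> j > v" for \<omega>
    using mark_le[of S \<omega> j] False by linarith
  then show ?thesis by simp
qed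

lemma mark_measurable [measurable]: "(\<lambda>\<omega>. mark S \<omega> j) \<in> borel_measurable M"
  unfolding borel_measurable_iff_greater using mark_gt_sets by blast

lemma void_set_disjoint: assumes "S \<ge> 1" "j \<noteq> j'" shows "void_set S v j \<inter> void_set S v' j' = {}"
proof -
  obtain t i t' i' where j: "j = (t, i)" "j' = (t', i')" by force
  have "cell S t {i} u \<inter> cell S t' {i'} u' = {}" for u u'
  proof (cases "i = i'")
    case True
    have lt: "{real t / S<..real (Suc t) / S} \<inter> {real t' / S<..real (Suc t') / S} = {}" if "t < t'" for t t'
    proof -
      have "real (Suc t) / S \<le> real t' / S" using that by (intro divide_right_mono) auto
      then show ?thesis by auto
    qed
    have "t \<noteq> t'" using assms(2) j True by auto
    then have "{real t / S<..real (Suc t) / S} \<inter> {real t' / S<..real (Suc t') / S} = {}"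
      using lt[of t t'] lt[of t' t] by (cases "t < t'") (simp_all add: Int_commute)
    then show ?thesis unfolding cell_def strip_def by blast
  qed (auto simp: cell_def strip_def)
  then show ?thesis by (simp add: void_set_def j)
qed

lemma prob_marks_gt:
  assumes S: "S \<ge> 1" and J: "finite J"
  shows "prob {\<omega> \<in> space M. \<forall>j\<in>J. mark S \<omega> j > v j} = (\<Prod>j\<in>J. prob {\<omega> \<in> space M. mark S \<omega> j > v j})"
proof (cases "\<forall>j\<in>J. v j < bmax + 1")
  case True
  have eq: "mark S \<omega> j > v j \<longleftrightarrow> count \<omega> (void_set S (v j) j) \<in> {0}" if "j \<in> J" "\<omega> \<in> space M" for j \<omega>
    using mark_gt_void[OF that(2), of "v j" S j] True that by simp
  have "prob {\<omega> \<in> space M. \<forall>j\<in>J. mark S \<omega> j > v j}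
      = prob {\<omega> \<in> space M. \<forall>j\<in>J. count \<omega> (void_set S (v j) j) \<in> {0}}"
    using eq by (intro arg_cong[where f = prob]) blast
  also have "\<dots> = (\<Prod>j\<in>J. prob {\<omega> \<in> space M. count \<omega> (void_set S (v j) j) \<in> {0}})"
  proof (rule prob_counts_indep[OF J])
    show "disjoint_family_on (\<lambda>j. void_set S (v j) j) J"
      unfolding disjoint_family_on_def using void_set_disjoint[OF S] by blast
  qed simp_all
  also have "\<dots> = (\<Prod>j\<in>J. prob {\<omega> \<in> space M. mark S \<omega> j > v j})"
    using eq by (intro prod.cong refl arg_cong[where f = prob]) blast
  finally show ?thesis .
next
  case False
  then obtain j where j: "j \<in> J" "\<not> v j < bmax + 1" by blast
  have no: "\<not> mark S \<omega> j > v j" for \<omega>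
    using mark_le[of S \<omega> j] j(2) by linarith
  then have "{\<omega> \<in> space M. \<forall>j\<in>J. mark S \<omega> j > v j} = {}" using j(1) by blast
  then have 1: "prob {\<omega> \<in> space M. \<forall>j\<in>J. mark S \<omega> j > v j} = 0" by (simp only: measure_empty)
  have "{\<omega> \<in> space M. mark S \<omega> j > v j} = {}" using no by blast
  then have "prob {\<omega> \<in> space M. mark S \<omega> j > v j} = 0" by (simp only: measure_empty)
  then have "(\<Prod>j\<in>J. prob {\<omega> \<in> space M. mark S \<omega> j > v j}) = 0" using J j(1) by (intro prod_zero) blast+
  with 1 show ?thesis by simp
qed

text \<open>The events that a mark exceeds a level are stable under intersection and generate its
  sigma-algebra.\<close>

lemma indep_marks: assumes "S \<ge> 1" shows "indep_vars (\<lambda>_. borel) (\<lambda>j \<omega>. mark S \<omega> j) UNIV"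
  unfolding indep_vars_def
proof (intro conjI ballI)
  define F where "F j = {{\<omega> \<in> space M. mark S \<omega> j > v} | v. True}" for j
  have F: "F j \<subseteq> events" for j unfolding F_def using mark_gt_sets by blast
  have "indep_sets F UNIV"
  proof (rule indep_setsI)
    fix A J assume J: "J \<noteq> {}" "finite J" and A: "\<forall>j\<in>J. A j \<in> F j"
    have "\<forall>j\<in>J. \<exists>v. A j = {\<omega> \<in> space M. mark S \<omega> j > v}"
      using A unfolding F_def by blast
    from bchoice[OF this] obtain v where v: "\<And>j. j \<in> J \<Longrightarrow> A j = {\<omega> \<in> space M. mark S \<omega> j > v j}"
      by blast
    have "(\<Inter>j\<in>J. A j) = {\<omega> \<in> space M. \<forall>j\<in>J. mark S \<omega> j > v j}"
      using J v by auto
    then show "prob (\<Inter>j\<in>J. A j) = (\<Prod>j\<in>J. prob (A j))"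
      using prob_marks_gt[OF assms J(2), of v] v by simp
  qed (rule F)
  moreover have "Int_stable (F j)" for j
  proof (rule Int_stableI)
    fix A B assume "A \<in> F j" "B \<in> F j"
    then obtain v v' where "A = {\<omega> \<in> space M. mark S \<omega> j > v}" "B = {\<omega> \<in> space M. mark S \<omega> j > v'}"
      unfolding F_def by blast
    then have "A \<inter> B = {\<omega> \<in> space M. mark S \<omega> j > max v v'}" by auto
    then show "A \<inter> B \<in> F j" unfolding F_def by blast
  qed
  ultimately have "indep_sets (\<lambda>j. sigma_sets (space M) (F j)) UNIV" by (intro indep_sets_sigma)
  then show "indep_sets (\<lambda>j. sigma_sets (space M)
      {(\<lambda>\<omega>. mark S \<omega> j) -` A \<inter> space M |A. A \<in> sets borel}) UNIV"
  proof (rule indep_sets_mono_sets)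
    fix j
    have sp: "F j \<subseteq> Pow (space M)" unfolding F_def by blast
    have "(\<lambda>\<omega>. mark S \<omega> j) \<in> borel_measurable (sigma (space M) (F j))"
      unfolding borel_measurable_iff_greater
    proof
      fix v
      show "{w \<in> space (sigma (space M) (F j)). v < mark S w j} \<in> sets (sigma (space M) (F j))"
        using sp by (simp add: space_measure_of sets_measure_of) (auto simp: F_def)
    qed
    from measurable_sets[OF this]
    show "sigma_sets (space M) {(\<lambda>\<omega>. mark S \<omega> j) -` A \<inter> space M |A. A \<in> sets borel}
        \<subseteq> sigma_sets (space M) (F j)"
      using sp by (intro sigma_sets_mono) (auto simp: space_measure_of sets_measure_of)
  qed
qed measurable

definition mark_law :: "nat \<Rightarrow> real measure" where
  "mark_law S = distr M borel (\<lambda>\<omega>. mark S \<omega> (0, 0))"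

lemma distr_mark: assumes "S \<ge> 1" shows "distr M borel (\<lambda>\<omega>. mark S \<omega> j) = mark_law S"
  unfolding mark_law_def
proof (rule cdf_unique)
  have rd: "real_distribution (distr M borel (\<lambda>\<omega>. mark S \<omega> j))" for j
    by (rule real_distribution_distr) simp
  show "real_distribution (distr M borel (\<lambda>\<omega>. mark S \<omega> j))"
    "real_distribution (distr M borel (\<lambda>\<omega>. mark S \<omega> (0, 0)))" by (rule rd)+
  have "cdf (distr M borel (\<lambda>\<omega>. mark S \<omega> j)) v = 1 - prob {\<omega> \<in> space M. mark S \<omega> j > v}" for j v
  proof -
    have "cdf (distr M borel (\<lambda>\<omega>. mark S \<omega> j)) v = prob {\<omega> \<in> space M. mark S \<omega> j \<le> v}"
      unfolding cdf_def by (subst measure_distr) (auto intro: arg_cong[where f = prob])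
    also have "{\<omega> \<in> space M. mark S \<omega> j \<le> v} = space M - {\<omega> \<in> space M. mark S \<omega> j > v}" by auto
    finally show ?thesis using prob_compl[OF mark_gt_sets] by simp
  qed
  then show "cdf (distr M borel (\<lambda>\<omega>. mark S \<omega> j)) = cdf (distr M borel (\<lambda>\<omega>. mark S \<omega> (0, 0)))"
    using prob_mark_gt_cong[OF assms, of _ j "(0, 0)"] by (simp add: fun_eq_iff)
qed

lemma distr_marks:
  assumes "S \<ge> 1"
  shows "distr M (PiM UNIV (\<lambda>_. borel)) (mark S) = PiM UNIV (\<lambda>_. mark_law S)"
  using indep_vars_iff_distr_eq_PiM[where I = UNIV and M' = "\<lambda>_. borel" and X = "\<lambda>j \<omega>. mark S \<omega> j"] indep_marks[OF assms]
    distr_mark[OF assms]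
  by (simp add: restrict_UNIV)

lemma iid_field_mark: "iid_field (mark_law S)"
proof (rule iid_field.intro)
  show "prob_space (mark_law S)" unfolding mark_law_def by (rule prob_space_distr) measurable
  show "sets (mark_law S) = sets borel" by (simp add: mark_law_def)
qed

lemma mark_law_above:
  assumes "S \<ge> 1" "v \<in> pos_rates" shows "measure (mark_law S) {v<..} = exp (- v / S)"
proof -
  have v: "v \<ge> 0" using pos_rates_pos[OF assms(2)] by simp
  have "measure (mark_law S) {v<..} = prob {\<omega> \<in> space M. mark S \<omega> (0, 0) > v}"
    unfolding mark_law_def by (subst measure_distr) (auto intro: arg_cong[where f = prob])
  also have "\<dots> = prob {\<omega> \<in> space M. count \<omega> (cell S 0 {0} v) = 0}"
    using mark_gt_iff[OF _ assms(2)] by (intro arg_cong[where f = prob]) blast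
  also have "\<dots> = exp (- v / S)"
    using prob_void[OF cell_sets measure_cell(2)[OF assms(1) v]] measure_cell(1)[OF assms(1) v] by simp
  finally show ?thesis .
qed

lemma front_chain_mark: assumes "L \<ge> 1" shows "front_chain N R b (mark_law (N * L)) L"
proof (intro front_chain.intro front_chain_axioms.intro)
  have NL: "N * L \<ge> 1" using N_pos assms by simp
  fix v assume "v = bmax \<or> v = bmin"
  then have "v \<in> pos_rates" using bmax_in bmin_in by blast
  then show "measure (mark_law (N * L)) {v<..} = exp (- v / real (N * L))"
    by (rule mark_law_above[OF NL])
qed (rule birth_model_axioms iid_field_mark assms)+

end

section \<open>Paths of the birth process\<close>

lemma config_tendstoD:
  fixes f :: "real \<Rightarrow> config"
  assumes "(f \<longlongrightarrow> l) F" shows "\<forall>\<^sub>F r in F. f r i = l i"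
proof -
  have "continuous_on UNIV (\<lambda>x :: config. x i)" by (rule continuous_on_product_coordinates)
  then have "open ((\<lambda>x :: config. x i) -` {l i})"
    by (intro open_vimage discrete_topology_class.open_discrete)
  from topological_tendstoD[OF assms this] show ?thesis by simp
qed

text \<open>The pathwise properties that hold almost surely and suffice for everything that follows.\<close>

locale birth_path = driven_model N R b M pts
  for N R :: nat and b :: rate and M :: "'w measure" and pts +
  fixes \<omega> :: 'w and f :: "real \<Rightarrow> config"
  assumes \<omega>: "\<omega> \<in> space M"
    and cadlag: "cadlag f"
    and equation: "birth_equation N b single (pts \<omega>) f"
    and configs: "t \<ge> 0 \<Longrightarrow> f t \<in> configs N"
    and no_zero_height: "count \<omega> (strip 0 (real m) {i} 0) = 0"
    and void_right: "\<exists>x\<ge>a. count \<omega> (strip (real m) (real (Suc m)) {x<..x + int R} bmax) = 0"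
    and void_left: "\<exists>x\<le>a. count \<omega> (strip (real m) (real (Suc m)) {x<..x + int R} bmax) = 0"
    and cells: "\<forall>\<^sub>F n in sequentially. \<forall>t<m * (N * 2 ^ n). count \<omega> (cell (N * 2 ^ n) t {- int l..int l} bmax) \<le> 1"
begin

abbreviation void_stretch :: "nat \<Rightarrow> int \<Rightarrow> bool" where
  "void_stretch m x \<equiv> count \<omega> (strip (real m) (real (Suc m)) {x<..x + int R} bmax) = 0"

lemma count_mono: "A \<subseteq> B \<Longrightarrow> B \<in> sets driving_intensity \<Longrightarrow> count \<omega> A \<le> count \<omega> B"
  using sets_pts[OF \<omega>] by (intro emeasure_mono) auto

lemma count_0_mono: "A \<subseteq> B \<Longrightarrow> B \<in> sets driving_intensity \<Longrightarrow> count \<omega> B = 0 \<Longrightarrow> count \<omega> A = 0"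
  using count_mono[of A B] by simp

lemma count_ge_1: "A \<in> sets driving_intensity \<Longrightarrow> count \<omega> A \<noteq> 0 \<Longrightarrow> 1 \<le> count \<omega> A"
  using count_values[OF \<omega>, of A] by auto

lemma mono_aux:
  assumes "0 \<le> s" "s \<le> t" shows "f s k \<le> f t k"
proof -
  have "(of_nat (f s k) :: ennreal) \<le> of_nat (f t k)"
    using equation assms unfolding birth_equation_def
    by (auto intro!: add_left_mono nn_integral_mono mult_right_mono simp: indicator_def)
  then show ?thesis by simp
qed

lemma left_lim:
  assumes "r > 0" shows "\<forall>\<^sub>F s in at_left r. f s i = left_lim f r i"
proof -
  obtain l where l: "(f \<longlongrightarrow> l) (at_left r)" using cadlag assms unfolding cadlag_def by blast
  have "left_lim f r = l"
    unfolding left_lim_def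
  proof (rule the_equality, rule l)
    fix \<xi> assume \<xi>: "(f \<longlongrightarrow> \<xi>) (at_left r)"
    show "\<xi> = l"
    proof
      fix i
      have "\<forall>\<^sub>F s in at_left r. \<xi> i = l i"
        using config_tendstoD[OF \<xi>, of i] config_tendstoD[OF l, of i] by eventually_elim simp
      then show "\<xi> i = l i" by (simp add: trivial_limit_at_left_real)
    qed
  qed
  then show ?thesis using config_tendstoD[OF l] by simp
qed

lemma left_lim_witness:
  assumes "0 \<le> s" "s < r" obtains r' where "s < r'" "r' < r" "f r' i = left_lim f r i"
proof -
  have "0 < r" using assms by simp
  from eventually_conj[OF left_lim[OF this, of i] eventually_at_left_real[OF assms(2)]]
  have "\<exists>q. f q i = left_lim f r i \<and> q \<in> {s<..<r}"
    by (rule eventually_happens'[OF trivial_limit_at_left_real])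
  then show thesis using that by auto
qed

lemma left_lim_ge: assumes "0 \<le> s" "s < r" shows "f s i \<le> left_lim f r i"
proof -
  obtain r' where "s < r'" "r' < r" "f r' i = left_lim f r i" using left_lim_witness[OF assms] .
  then show ?thesis using mono_aux[of s r' i] assms by simp
qed

lemma left_lim_le: assumes "0 < r" shows "left_lim f r i \<le> f r i"
proof -
  obtain r' where "0 < r'" "r' < r" "f r' i = left_lim f r i" using left_lim_witness[OF order_refl assms] .
  then show ?thesis using mono_aux[of r' r i] by simp
qed

lemma left_lim_configs: "0 < r \<Longrightarrow> left_lim f r \<in> configs N"
  using left_lim_le configs[of r] unfolding configs_def by (auto intro: order_trans)

lemma left_lim_mono: assumes "0 < r" "r \<le> r'" shows "left_lim f r i \<le> left_lim f r' i"
proof (cases "r = r'")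
  case False
  then show ?thesis using left_lim_le[OF assms(1), of i] left_lim_ge[of r r' i] assms by simp
qed simp

text \<open>The integrand of the equation is the indicator of such a set, whose mass is therefore an increment of
  the state.\<close>

definition births :: "real \<Rightarrow> real \<Rightarrow> int \<Rightarrow> (real \<times> int \<times> real) set" where
  "births s t k = {(r, i, u). s < r \<and> r \<le> t \<and> i = k \<and> 0 \<le> u \<and> left_lim f r k < N \<and> u \<le> b k (left_lim f r)}"

lemma births_subset: assumes "0 \<le> s" shows "births s t k \<subseteq> strip s t {k} bmax"
proof -
  have "u \<le> bmax" if "s < r" "u \<le> b k (left_lim f r)" for r u
    using b_le_bmax[OF left_lim_configs, of r k] that assms by simp
  then show ?thesis unfolding births_def strip_def by auto
qed

text \<open>The rate at a site depends on finitely many coordinates of the left limit, each of which is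
  monotone in time.\<close>

lemma births_sets [measurable]:
  assumes s: "0 \<le> s" shows "births s t k \<in> sets driving_intensity"
proof -
  define I where "I = {k - int R..k + int R}"
  have finW: "finite (window I)" by (rule finite_window) (simp add: I_def)
  have WN: "c \<in> configs N" if "c \<in> window I" for c using that by (simp add: window_def)
  define g where "g z r = (if r > 0 then real (left_lim f r z) else 0)" for z r
  have g: "g z \<in> borel_measurable borel" for z
    by (rule borel_measurable_mono) (auto simp: g_def mono_def intro: left_lim_mono)
  define T where "T c = {r \<in> {s<..t}. \<forall>z\<in>I. g z r = real (c z)}" for c
  have T: "T c \<in> sets (restrict_space lborel {0..})" for c
  proof -
    have "{r \<in> space borel. \<forall>z\<in>I. g z r = real (c z)} \<in> sets borel"
    proof (rule sets.sets_Collect_finite_All)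
      fix z show "{r \<in> space borel. g z r = real (c z)} \<in> sets borel"
        using g[of z] by measurable
    qed (simp add: I_def)
    then have "{s<..t} \<inter> {r \<in> space borel. \<forall>z\<in>I. g z r = real (c z)} \<in> sets borel"
      by (intro sets.Int) auto
    moreover have "T c = {s<..t} \<inter> {r \<in> space borel. \<forall>z\<in>I. g z r = real (c z)}"
      by (auto simp: T_def)
    ultimately have "T c \<in> sets borel" by simp
    moreover have "T c \<subseteq> {0..}" using s by (auto simp: T_def)
    ultimately show ?thesis by (simp add: sets_restrict_space_iff)
  qed
  have "births s t k = (\<Union>c\<in>{c \<in> window I. c k < N}. T c \<times> ({k} \<times> {0..b k c}))"
  proof (intro set_eqI iffI)
    fix x assume "x \<in> births s t k"
    then obtain r u where x: "x = (r, k, u)" and r: "s < r" "r \<le> t" and u: "0 \<le> u"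
      "left_lim f r k < N" "u \<le> b k (left_lim f r)"
      unfolding births_def by blast
    have r0: "0 < r" using r s by simp
    define c where "c z = (if z \<in> I then left_lim f r z else 0)" for z
    have c: "c \<in> window I"
      unfolding c_def[abs_def] by (rule windowI[OF left_lim_configs[OF r0]])
    have "b k (left_lim f r) = b k c"
      by (rule b_cong[OF left_lim_configs[OF r0] WN[OF c]]) (auto simp: c_def I_def)
    moreover have "c k = left_lim f r k" by (simp add: c_def I_def)
    moreover have "r \<in> T c" using r r0 by (simp add: T_def g_def c_def)
    ultimately show "x \<in> (\<Union>c\<in>{c \<in> window I. c k < N}. T c \<times> ({k} \<times> {0..b k c}))"
      using c u x by auto
  next
    fix x assume "x \<in> (\<Union>c\<in>{c \<in> window I. c k < N}. T c \<times> ({k} \<times> {0..b k c}))"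
    then obtain c r u where c: "c \<in> window I" "c k < N" and x: "x = (r, k, u)" and u: "0 \<le> u" "u \<le> b k c"
      and r: "r \<in> T c" by auto
    have r0: "0 < r" and rst: "s < r" "r \<le> t" using r s by (auto simp: T_def)
    have eq: "left_lim f r z = c z" if "z \<in> I" for z
      using r r0 that by (simp add: T_def g_def)
    have "b k (left_lim f r) = b k c"
    proof (rule b_cong[OF left_lim_configs[OF r0] WN[OF c(1)]])
      fix z assume "\<bar>k - z\<bar> \<le> int R"
      then have "z \<in> I" unfolding I_def by auto
      then show "left_lim f r z = c z" by (rule eq)
    qed
    moreover have "left_lim f r k = c k" by (rule eq) (simp add: I_def)
    ultimately show "x \<in> births s t k" using x u c rst by (simp add: births_def)
  qed
  moreover have "T c \<times> ({k} \<times> {0..b k c}) \<in> sets driving_intensity" for c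
    unfolding driving_intensity_def
    by (intro pair_measureI T) (auto simp: sets_restrict_space_iff)
  ultimately show ?thesis using finW by (auto intro!: sets.finite_UN)
qed

lemma state_eq: assumes "t \<ge> 0" shows "(of_nat (f t k) :: ennreal) = of_nat (single k) + count \<omega> (births 0 t k)"
proof -
  have "(of_nat (f t k) :: ennreal) = of_nat (single k) +
          (\<integral>\<^sup>+ (s, i, u). indicator ({0<..t} \<times> {k} \<times> {0..}) (s, i, u) *
             (indicator {\<xi>. \<xi> i < N} (left_lim f s) * indicator {0..b i (left_lim f s)} u) \<partial>(pts \<omega>))"
    using equation assms unfolding birth_equation_def by blast
  also have "(\<lambda>(s, i, u). indicator ({0<..t} \<times> {k} \<times> {0..}) (s, i, u) *
             (indicator {\<xi>. \<xi> i < N} (left_lim f s) * indicator {0..b i (left_lim f s)} u) :: ennreal)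
      = indicator (births 0 t k)"
    by (auto simp: indicator_def births_def fun_eq_iff)
  also have "(\<integral>\<^sup>+ x. indicator (births 0 t k) x \<partial>(pts \<omega>)) = count \<omega> (births 0 t k)"
    by (rule nn_integral_indicator) (use births_sets[of 0 t k] sets_pts[OF \<omega>] in simp)
  finally show ?thesis .
qed

lemma state_incr:
  assumes "0 \<le> s" "s \<le> t"
  shows "(of_nat (f t k) :: ennreal) = of_nat (f s k) + count \<omega> (births s t k)"
proof -
  have un: "births 0 t k = births 0 s k \<union> births s t k" and disj: "births 0 s k \<inter> births s t k = {}"
    using assms by (auto simp: births_def)
  have "count \<omega> (births 0 t k) = count \<omega> (births 0 s k) + count \<omega> (births s t k)"
    unfolding un using disj assms sets_pts[OF \<omega>] births_sets
    by (intro plus_emeasure[symmetric]) auto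
  then show ?thesis using state_eq[of t k] state_eq[of s k] assms by (simp add: add.assoc)
qed

lemma state_0: "f 0 = single"
proof
  fix k
  have "births 0 0 k = {}" by (auto simp: births_def)
  then have "(of_nat (f 0 k) :: ennreal) = of_nat (single k)" using state_eq[of 0 k] by simp
  then show "f 0 k = single k" by simp
qed

lemma state_void:
  assumes "0 \<le> s" "s \<le> t" "count \<omega> (strip s t {k} bmax) = 0" shows "f t k = f s k"
proof -
  have "count \<omega> (births s t k) = 0"
    by (rule count_0_mono[OF births_subset _ assms(3)]) (use assms in auto)
  then show ?thesis using state_incr[OF assms(1,2), of k] by simp
qed

text \<open>While there is at most one point near a site, the left limit at the time of this point is still
  the state at the beginning, so that the birth rule can be evaluated in that state.\<close>

lemma state_one_point:
  assumes st: "0 \<le> s" "s \<le> t" and one: "count \<omega> (strip s t \<Lambda> bmax) \<le> 1"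
    and win: "{k - int R..k + int R} \<subseteq> \<Lambda>"
  shows "f t k = (if f s k < N \<and> count \<omega> (strip s t {k} (b k (f s))) \<noteq> 0 then Suc (f s k) else f s k)"
proof -
  define Q where "Q = {q \<in> \<rat>. s < q \<and> q < t \<and> count \<omega> (strip s q \<Lambda> bmax) \<noteq> 0}"
  \<comment> \<open>If the interval up to \<open>q\<close> contains the only point, then no point comes later.  Rational times \<open>q\<close>
      make the exceptional set a countable union.\<close>
  define Z where "Z = (\<Union>q\<in>Q. strip q t \<Lambda> bmax)"
  have null: "strip q t \<Lambda> bmax \<in> null_sets (pts \<omega>)" if q: "q \<in> Q" for q
  proof -
    have q': "s < q" "q < t" "count \<omega> (strip s q \<Lambda> bmax) \<noteq> 0" using q by (auto simp: Q_def)
    have sets: "strip s q \<Lambda> bmax \<in> sets (pts \<omega>)" "strip q t \<Lambda> bmax \<in> sets (pts \<omega>)"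
      using sets_pts[OF \<omega>] st q' by auto
    have "strip s t \<Lambda> bmax = strip s q \<Lambda> bmax \<union> strip q t \<Lambda> bmax"
      using q' by (auto simp: strip_def)
    moreover have "strip s q \<Lambda> bmax \<inter> strip q t \<Lambda> bmax = {}" by (auto simp: strip_def)
    ultimately have "count \<omega> (strip s q \<Lambda> bmax) + count \<omega> (strip q t \<Lambda> bmax) \<le> 1"
      using one plus_emeasure[OF sets] by simp
    moreover have "1 + count \<omega> (strip q t \<Lambda> bmax) \<le> count \<omega> (strip s q \<Lambda> bmax) + count \<omega> (strip q t \<Lambda> bmax)"
      by (rule add_right_mono) (use count_ge_1 q' st in simp)
    ultimately have "1 + count \<omega> (strip q t \<Lambda> bmax) \<le> 1 + 0" by (simp only: add_0_right)
    then have "count \<omega> (strip q t \<Lambda> bmax) = 0" by (subst (asm) ennreal_add_left_cancel_le) auto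
    then show ?thesis using sets by (simp add: null_sets_def)
  qed
  have Z: "Z \<in> null_sets (pts \<omega>)"
    unfolding Z_def by (rule null_sets_UN') (auto intro: null countable_subset[OF _ countable_rat] simp: Q_def)
  have same: "left_lim f r z = f s z" if x: "(r, i, u) \<in> strip s t \<Lambda> bmax" "(r, i, u) \<notin> Z" and z: "z \<in> \<Lambda>" for r i u z
  proof (rule ccontr)
    assume ne: "left_lim f r z \<noteq> f s z"
    have r: "s < r" "r \<le> t" using x by (auto simp: strip_def)
    obtain r' where r': "s < r'" "r' < r" "f r' z = left_lim f r z"
      using left_lim_witness[OF st(1) r(1)] .
    obtain q where q: "q \<in> \<rat>" "r' < q" "q < r" using Rats_dense_in_real[OF r'(2)] by blast
    have "f s z \<le> f r' z" "f r' z \<le> f q z"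
      using mono_aux[of s r' z] mono_aux[of r' q z] r'(1) q(2) st by auto
    then have "f q z \<noteq> f s z" using ne r' by simp
    then have "count \<omega> (strip s q {z} bmax) \<noteq> 0" using state_void[of s q z] st r' q by auto
    then have "count \<omega> (strip s q \<Lambda> bmax) \<noteq> 0"
      using count_0_mono[of "strip s q {z} bmax" "strip s q \<Lambda> bmax"] z st strip_sets[OF st(1)]
      unfolding strip_def by blast
    then have "q \<in> Q" using q r r' by (auto simp: Q_def)
    moreover have "(r, i, u) \<in> strip q t \<Lambda> bmax" using x q by (auto simp: strip_def)
    ultimately show False using x(2) unfolding Z_def by blast
  qed
  have win_in: "z \<in> \<Lambda>" if "\<bar>k - z\<bar> \<le> int R" for z
  proof -
    have "z \<in> {k - int R..k + int R}" using that by auto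
    then show ?thesis using win by blast
  qed
  define A where "A = (if f s k < N then strip s t {k} (b k (f s)) else {})"
  have kL: "k \<in> \<Lambda>" using win by auto
  have fs: "f s \<in> configs N" using configs st by simp
  have "(r, k, u) \<in> births s t k \<longleftrightarrow> (r, k, u) \<in> A"
    if x: "(r, k, u) \<in> strip s t \<Lambda> bmax" "(r, k, u) \<notin> Z" for r u
  proof -
    have eq: "left_lim f r z = f s z" if "z \<in> \<Lambda>" for z using same x that by blast
    have "0 < r" using x(1) st by (auto simp: strip_def)
    then have "b k (left_lim f r) = b k (f s)"
      by (intro b_cong left_lim_configs fs eq win_in)
    then show ?thesis using eq[OF kL] by (auto simp: A_def births_def strip_def)
  qed
  moreover have AL: "A \<subseteq> strip s t \<Lambda> bmax"
    using kL b_le_bmax[OF fs, of k] by (auto simp: A_def strip_def)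
  moreover have "births s t k \<subseteq> strip s t \<Lambda> bmax"
    using births_subset[OF st(1), of t k] kL unfolding strip_def by auto
  moreover have "i = k" if "(r, i, u) \<in> births s t k \<union> A" for r i u
    using that by (auto simp: births_def A_def strip_def split: if_splits)
  ultimately have "births s t k - Z = A - Z" by fast
  moreover have "births s t k \<in> sets (pts \<omega>)" "A \<in> sets (pts \<omega>)"
    using sets_pts[OF \<omega>] st by (simp_all add: A_def)
  ultimately have cA: "count \<omega> (births s t k) = count \<omega> A"
    using emeasure_Diff_null_set[OF Z, of A] emeasure_Diff_null_set[OF Z, of "births s t k"] by simp
  have "count \<omega> A \<le> 1" using count_mono[OF AL] one st by (meson order_trans strip_sets)
  moreover have "A \<in> sets driving_intensity" using st by (simp add: A_def)
  ultimately have "count \<omega> A = of_nat (if count \<omega> A = 0 then 0 else 1)"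
    using count_ge_1[of A] by (cases "count \<omega> A = 0") simp_all
  then have "(of_nat (f t k) :: ennreal) = of_nat (f s k + (if count \<omega> A = 0 then 0 else 1))"
    unfolding state_incr[OF st, of k] cA of_nat_add by simp
  then have "f t k = f s k + (if count \<omega> A = 0 then 0 else 1)" by (simp only: of_nat_eq_iff)
  then show ?thesis by (simp add: A_def)
qed

lemma zero_height: assumes "0 \<le> s" shows "count \<omega> (strip s t {k} 0) = 0"
proof (rule count_0_mono[OF _ _ no_zero_height])
  show "strip s t {k} 0 \<subseteq> strip 0 (real (nat \<lceil>t\<rceil>)) {k} 0"
  proof -
    have "t \<le> real (nat \<lceil>t\<rceil>)" by (rule real_nat_ceiling_ge)
    then have "r \<le> real (nat \<lceil>t\<rceil>)" if "r \<le> t" for r using that by linarith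
    then show ?thesis using assms unfolding strip_def by (auto simp del: of_nat_ceiling)
  qed
qed simp

text \<open>The simultaneous update evaluates the rates at the beginning of the cell, which is correct as long as
  nothing nearby changes before the only point of the cell.\<close>

lemma state_step:
  assumes S: "S \<ge> 1" and one: "count \<omega> (cell S t \<Lambda> bmax) \<le> 1"
    and win: "{k - int R..k + int R} \<subseteq> \<Lambda>"
  shows "f (real (Suc t) / S) k = step (f (real t / S)) (\<lambda>i. mark S \<omega> (t, i)) k"
proof -
  let ?s = "real t / S" and ?t = "real (Suc t) / S"
  have st: "0 \<le> ?s" "?s \<le> ?t" by (auto simp: divide_right_mono)
  have fs: "f ?s \<in> configs N" by (rule configs[OF st(1)])
  have "count \<omega> (strip ?s ?t {k} (b k (f ?s))) \<noteq> 0 \<longleftrightarrow> 0 < b k (f ?s) \<and> mark S \<omega> (t, k) \<le> b k (f ?s)"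
  proof (cases "b k (f ?s) > 0")
    case True
    from mark_gt_iff[OF \<omega> b_pos_rates[OF fs True], of S t k] show ?thesis
      using True by (auto simp: cell_def)
  next
    case False
    then have "b k (f ?s) = 0" using b_nonneg[OF fs, of k] by simp
    then show ?thesis using zero_height[OF st(1)] by simp
  qed
  then show ?thesis
    using state_one_point[OF st one[unfolded cell_def] win] by (simp add: step_def)
qed

lemma state_gap:
  assumes S: "S \<ge> 1" and one: "count \<omega> (cell S t \<Lambda> bmax) \<le> 1"
    and win: "{k - int R..k + int R} \<subseteq> \<Lambda>" and zero: "\<And>z. z \<in> {k - int R..k + int R} \<Longrightarrow> f (real t / S) z = 0"
  shows "f (real (Suc t) / S) k = 0"
proof -
  have "f (real t / S) \<in> configs N" by (rule configs) simp
  then have "b k (f (real t / S)) = 0"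
  proof (rule b_eq_0)
    fix y assume "y \<in> occ (f (real t / S))"
    then have "y \<notin> {k - int R..k + int R}" using zero[of y] by (auto simp: occ_def)
    then show "int R < \<bar>k - y\<bar>" by auto
  qed
  then show ?thesis
    using state_step[OF S one win] zero[of k] by (simp add: step_def)
qed

text \<open>An empty region bounded by two stretches of \<open>R\<close> sites without points stays empty: nothing
  enters it from outside.\<close>

lemma region_stays_empty:
  assumes x0: "void_stretch m x0"
    and x1: "void_stretch m x1"
    and zero: "\<And>z. z \<in> {x0<..x1 + int R} \<Longrightarrow> f (real m) z = 0"
    and z: "z \<in> {x0<..x1 + int R}"
  shows "f (real (Suc m)) z = 0"
proof -
  define \<Lambda> where "\<Lambda> = {x0<..x1 + int R}"
  define l where "l = nat (\<bar>x0\<bar> + \<bar>x1\<bar> + int R)"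
  have l: "\<Lambda> \<subseteq> {- int l..int l}" by (auto simp: \<Lambda>_def l_def)
  have "\<exists>n. \<forall>t<Suc m * (N * 2 ^ n). count \<omega> (cell (N * 2 ^ n) t {- int l..int l} bmax) \<le> 1"
    using cells[of "Suc m" l] by (rule eventually_happens'[OF sequentially_bot])
  then obtain n where n: "\<And>t. t < Suc m * (N * 2 ^ n) \<Longrightarrow> count \<omega> (cell (N * 2 ^ n) t {- int l..int l} bmax) \<le> 1"
    by blast
  define S where "S = N * 2 ^ n"
  have S: "S \<ge> 1" using N_pos by (simp add: S_def)
  have one: "count \<omega> (cell S t \<Lambda> bmax) \<le> 1" if "t < Suc m * S" for t
  proof -
    have "count \<omega> (cell S t \<Lambda> bmax) \<le> count \<omega> (cell S t {- int l..int l} bmax)"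
      by (rule count_mono[OF _ cell_sets]) (use l in \<open>auto simp: cell_def strip_def\<close>)
    then show ?thesis using n[of t] that unfolding S_def by (meson order_trans)
  qed
  have quiet: "f (real (Suc t) / S) z = f (real t / S) z"
    if t: "m * S \<le> t" "t < Suc m * S" and x: "void_stretch m x"
      and z: "z \<in> {x<..x + int R}" for t x z
  proof -
    have *: "real m \<le> real t / S" "real (Suc t) / S \<le> real (Suc m)"
    proof -
      have "real (m * S) \<le> real t" "real (Suc t) \<le> real (Suc m * S)"
        using t by (simp_all only: of_nat_le_iff Suc_le_eq)
      then show "real m \<le> real t / S" "real (Suc t) / S \<le> real (Suc m)"
        using S unfolding of_nat_mult by (simp_all only: pos_le_divide_eq pos_divide_le_eq of_nat_0_less_iff)
    qed
    show ?thesis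
    proof (rule state_void)
      show "real t / S \<le> real (Suc t) / S" by (simp add: divide_right_mono)
      show "count \<omega> (strip (real t / S) (real (Suc t) / S) {z} bmax) = 0"
        by (rule count_0_mono[OF _ strip_sets x]) (use * z in \<open>auto simp: strip_def\<close>)
    qed simp
  qed
  have "\<forall>z\<in>\<Lambda>. f (real t / S) z = 0" if "m * S \<le> t" "t \<le> Suc m * S" for t
    using that
  proof (induction t rule: dec_induct)
    case base
    have "real (m * S) / S = real m" using S by simp
    then show ?case using zero by (simp add: \<Lambda>_def)
  next
    case (step t)
    then have IH: "\<forall>z\<in>\<Lambda>. f (real t / S) z = 0" and t: "m * S \<le> t" "t < Suc m * S" by auto
    show ?case
    proof
      fix z assume z: "z \<in> \<Lambda>"
      consider "z \<in> {x0<..x0 + int R}" | "z \<in> {x1<..x1 + int R}" | "{z - int R..z + int R} \<subseteq> \<Lambda>"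
        using z unfolding \<Lambda>_def by fastforce
      then show "f (real (Suc t) / S) z = 0"
      proof cases
        case 1 then show ?thesis using quiet[OF t x0] IH z by simp
      next
        case 2 then show ?thesis using quiet[OF t x1] IH z by simp
      next
        case 3
        show ?thesis by (rule state_gap[OF S one[OF t(2)] 3]) (use IH 3 in blast)
      qed
    qed
  qed
  from this[of "Suc m * S"] have "f (real (Suc m * S) / S) z = 0" using z by (simp add: \<Lambda>_def)
  moreover have "real (Suc m * S) / S = real (Suc m)"
    using S unfolding of_nat_mult by (intro nonzero_mult_div_cancel_right) simp
  ultimately show ?thesis by simp
qed

text \<open>Stretches without points exist arbitrarily far out.  Together with one next to the occupied sites, they
  bound finite regions that cover everything else, and each of these regions stays empty.\<close>

lemma state_finite: "\<exists>A\<ge>0. \<forall>x. \<bar>x\<bar> > A \<longrightarrow> f (real m) x = 0"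
proof (induction m)
  case 0
  show ?case by (rule exI[of _ 0]) (auto simp: state_0 single_def)
next
  case (Suc m)
  then obtain A where A: "A \<ge> 0" "\<And>x. \<bar>x\<bar> > A \<Longrightarrow> f (real m) x = 0" by blast
  obtain x0 where x0: "x0 \<ge> A" "void_stretch m x0"
    using void_right by blast
  obtain y0 where y0: "y0 \<le> - A - int R - 1" "void_stretch m y0"
    using void_left by blast
  have right: "f (real (Suc m)) z = 0" if "z > x0" for z
  proof -
    obtain x1 where x1: "x1 \<ge> z" "void_stretch m x1"
      using void_right by blast
    show ?thesis
      by (rule region_stays_empty[OF x0(2) x1(2)]) (use A x0 x1 that in auto)
  qed
  have left: "f (real (Suc m)) z = 0" if "z \<le> y0" for z
  proof -
    obtain x1 where x1: "x1 \<le> z - 1" "void_stretch m x1"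
      using void_left by blast
    show ?thesis
    proof (rule region_stays_empty[OF x1(2) y0(2)])
      fix z assume "z \<in> {x1<..y0 + int R}"
      then show "f (real m) z = 0" using y0(1) A(1) by (intro A(2)) auto
    qed (use x1 y0 that in auto)
  qed
  show ?case
  proof (intro exI[of _ "x0 + \<bar>y0\<bar>"] conjI allI impI)
    fix x assume "x0 + \<bar>y0\<bar> < \<bar>x\<bar>"
    then have "x > x0 \<or> x \<le> y0" using x0(1) A(1) by linarith
    then show "f (real (Suc m)) x = 0" using right left by blast
  qed (use x0 A in auto)
qed

text \<open>Once the range of the solution up to time \<open>k\<close> is known to be finite, the one-point condition is needed
  for finitely many cells only.  It is imposed on a margin of width \<open>2 R\<close>: the outer half of the margin
  consists of neighbours of sites in the inner half, where the discretised process could grow.\<close>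

lemma run_eq_state:
  "\<forall>\<^sub>F n in sequentially. run single (mark (N * 2 ^ n) \<omega>) (k * (N * 2 ^ n)) = f (real k)"
proof -
  obtain A where A: "A \<ge> 0" "\<And>x. \<bar>x\<bar> > A \<Longrightarrow> f (real k) x = 0" using state_finite by blast
  define l where "l = nat (A + 2 * int R)"
  have l: "int l = A + 2 * int R" using A(1) by (simp add: l_def)
  show ?thesis
    using cells[of k l]
  proof eventually_elim
    case (elim n)
    define S where "S = N * 2 ^ n"
    have S: "S \<ge> 1" using N_pos by (simp add: S_def)
    have "run single (mark S \<omega>) t = f (real t / S)" if "t \<le> k * S" for t
      using that
    proof (induction t)
      case 0 then show ?case by (simp add: state_0)
    next
      case (Suc t)
      then have IH: "run single (mark S \<omega>) t = f (real t / S)" by simp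
      have one: "count \<omega> (cell S t {- int l..int l} bmax) \<le> 1" using elim Suc.prems unfolding S_def by simp
      have out: "f (real u / S) x = 0" if "u \<le> k * S" "\<bar>x\<bar> > A" for u x
      proof -
        have "real u \<le> real (k * S)" using that(1) by (simp only: of_nat_le_iff)
        then have "real u / S \<le> real k" using S by (simp add: pos_divide_le_eq)
        then show ?thesis using mono_aux[of "real u / S" "real k" x] A(2)[OF that(2)] by simp
      qed
      have "step (f (real t / S)) (\<lambda>i. mark S \<omega> (t, i)) x = f (real (Suc t) / S) x" for x
      proof (cases "\<bar>x\<bar> \<le> A + int R")
        case True
        then have "{x - int R..x + int R} \<subseteq> {- int l..int l}" by (auto simp: l)
        from state_step[OF S one this] show ?thesis by simp
      next
        case False
        have c: "f (real t / S) \<in> configs N" by (rule configs) simp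
        have "b x (f (real t / S)) = 0"
        proof (rule b_eq_0[OF c])
          fix y assume "y \<in> occ (f (real t / S))"
          then have "\<bar>y\<bar> \<le> A" using out[of t y] Suc.prems by (force simp: occ_def)
          then show "int R < \<bar>x - y\<bar>" using False by linarith
        qed
        moreover have "f (real t / S) x = 0" "f (real (Suc t) / S) x = 0"
          using out[of t x] out[of "Suc t" x] Suc.prems False by auto
        ultimately show ?thesis by (simp add: step_def)
      qed
      then show ?case using IH by auto
    qed
    from this[of "k * S"] have "run single (mark S \<omega>) (k * S) = f (real (k * S) / S)" by simp
    moreover have "real (k * S) / S = real k" using S by simp
    ultimately show ?case by (simp add: S_def)
  qed
qed

text \<open>While \<open>x\<close> is empty, its rate is at least \<open>bmin\<close>, because the particle at \<open>y\<close> does not disappear.\<close>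

lemma state_filled:
  assumes st: "0 \<le> s" "s \<le> t" and y: "y \<in> occ (f s)" "\<bar>x - y\<bar> \<le> int R"
    and pt: "count \<omega> (strip s t {x} bmin) \<noteq> 0"
  shows "x \<in> occ (f t)"
proof (rule ccontr)
  assume "x \<notin> occ (f t)"
  then have ft: "f t x = 0" by (simp add: occ_def)
  have "strip s t {x} bmin \<subseteq> births s t x"
  proof
    fix p assume "p \<in> strip s t {x} bmin"
    then obtain r u where p: "p = (r, x, u)" "s < r" "r \<le> t" "0 \<le> u" "u \<le> bmin"
      by (auto simp: strip_def)
    have r0: "0 < r" using p st by simp
    have "left_lim f r x \<le> f t x" using left_lim_le[OF r0, of x] mono_aux[of r t x] p r0 by simp
    then have "left_lim f r x < N" using ft N_pos by simp
    moreover have "y \<in> occ (left_lim f r)"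
      using left_lim_ge[OF st(1) p(2), of y] y(1) by (simp add: occ_def)
    then have "bmin \<le> b x (left_lim f r)"
      using b_ge_bmin[OF left_lim_configs[OF r0]] y(2) by blast
    ultimately show "p \<in> births s t x" using p by (simp add: births_def)
  qed
  then have "count \<omega> (births s t x) \<noteq> 0"
    using count_0_mono[of _ "births s t x"] pt st births_sets by blast
  then have "(of_nat (f t x) :: ennreal) \<noteq> 0" using state_incr[OF st, of x] by simp
  then show False using ft by simp
qed

end

section \<open>The speed of the right front\<close>

text \<open>Between consecutive squares, whose ratio tends to \<open>1\<close>, monotonicity controls the sequence.\<close>

lemma tendsto_ratio_from_squares:
  fixes x :: "nat \<Rightarrow> real"
  assumes mono: "\<And>k l. k \<le> l \<Longrightarrow> x k \<le> x l" and x0: "x 0 \<ge> 0"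
    and lim: "(\<lambda>j. x ((Suc j)\<^sup>2) / (real (Suc j))\<^sup>2) \<longlonglongrightarrow> a"
  shows "(\<lambda>k. x k / real k) \<longlonglongrightarrow> a"
proof -
  define s where "s k = floor_sqrt k" for k
  have s: "(s k)\<^sup>2 \<le> k" "k < (Suc (s k))\<^sup>2" for k
    unfolding s_def by (rule floor_sqrt_power2_le, rule Suc_floor_sqrt_power2_gt)
  have nonneg: "x k \<ge> 0" for k using mono[of 0 k] x0 by simp
  have s_top: "filterlim s sequentially sequentially"
    unfolding filterlim_at_top
  proof
    fix n
    have "n \<le> s k" if "n\<^sup>2 \<le> k" for k
      using monoD[OF mono_floor_sqrt that] by (simp add: s_def)
    then show "\<forall>\<^sub>F k in sequentially. n \<le> s k" by (auto simp: eventually_sequentially)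
  qed
  have lim': "(\<lambda>j. x (j\<^sup>2) / (real j)\<^sup>2) \<longlonglongrightarrow> a"
    using lim by (subst (asm) filterlim_sequentially_Suc)
  have ratio: "(\<lambda>j. real j / real (Suc j)) \<longlonglongrightarrow> 1" by (rule LIMSEQ_n_over_Suc_n)
  have lower: "(\<lambda>j. x (j\<^sup>2) / (real j)\<^sup>2 * (real j / real (Suc j))\<^sup>2) \<longlonglongrightarrow> a"
    using tendsto_mult[OF lim' tendsto_power[OF ratio, of 2]] by simp
  have "(\<lambda>j. x ((Suc j)\<^sup>2) / (real (Suc j))\<^sup>2 / (real j / real (Suc j))\<^sup>2) \<longlonglongrightarrow> a / 1\<^sup>2"
    by (intro tendsto_divide lim tendsto_power ratio) simp
  then have upper: "(\<lambda>j. x ((Suc j)\<^sup>2) / (real (Suc j))\<^sup>2 / (real j / real (Suc j))\<^sup>2) \<longlonglongrightarrow> a" by simp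
  show ?thesis
  proof (rule tendsto_sandwich)
    show "(\<lambda>k. x ((s k)\<^sup>2) / (real (s k))\<^sup>2 * (real (s k) / real (Suc (s k)))\<^sup>2) \<longlonglongrightarrow> a"
      by (rule filterlim_compose[OF lower s_top])
    show "(\<lambda>k. x ((Suc (s k))\<^sup>2) / (real (Suc (s k)))\<^sup>2 / (real (s k) / real (Suc (s k)))\<^sup>2) \<longlonglongrightarrow> a"
      by (rule filterlim_compose[OF upper s_top])
    have ev: "\<forall>\<^sub>F k in sequentially. 1 \<le> s k" using s_top unfolding filterlim_at_top by blast
    have sq: "(real (s k))\<^sup>2 \<le> real k" "real k \<le> (real (Suc (s k)))\<^sup>2" for k
      using s[of k] by (simp_all only: of_nat_power[symmetric] of_nat_le_iff less_imp_le)
    show "\<forall>\<^sub>F k in sequentially. x ((s k)\<^sup>2) / (real (s k))\<^sup>2 * (real (s k) / real (Suc (s k)))\<^sup>2 \<le> x k / real k"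
      using ev
    proof eventually_elim
      case (elim k)
      have "x ((s k)\<^sup>2) / (real (s k))\<^sup>2 * (real (s k) / real (Suc (s k)))\<^sup>2 = x ((s k)\<^sup>2) / (real (Suc (s k)))\<^sup>2"
        using elim by (simp add: power_divide)
      also have "\<dots> \<le> x k / real k"
      proof (rule frac_le)
        have "1 \<le> (s k)\<^sup>2" using elim by simp
        then show "0 < real k" using s(1)[of k] by linarith
      qed (use mono[OF s(1)] nonneg sq in auto)
      finally show ?case .
    qed
    show "\<forall>\<^sub>F k in sequentially. x k / real k \<le> x ((Suc (s k))\<^sup>2) / (real (Suc (s k)))\<^sup>2 / (real (s k) / real (Suc (s k)))\<^sup>2"
      using ev
    proof eventually_elim
      case (elim k)
      have "x k / real k \<le> x ((Suc (s k))\<^sup>2) / (real (s k))\<^sup>2"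
        by (rule frac_le) (use elim mono[OF less_imp_le[OF s(2)]] nonneg sq in auto)
      also have "\<dots> = x ((Suc (s k))\<^sup>2) / (real (Suc (s k)))\<^sup>2 / (real (s k) / real (Suc (s k)))\<^sup>2"
        using elim by (simp add: power_divide)
      finally show ?case .
    qed
  qed
qed

lemma bounded_real_subseq:
  fixes s :: "nat \<Rightarrow> real"
  assumes "\<And>n. s n \<in> {a..c}"
  obtains l r where "l \<in> {a..c}" "strict_mono r" "(\<lambda>n. s (r n)) \<longlonglongrightarrow> l"
proof -
  have "seq_compact {a..c}" by (rule compact_imp_seq_compact) simp
  then obtain l r where "l \<in> {a..c}" "strict_mono r" "(s \<circ> r) \<longlonglongrightarrow> l"
    using assms unfolding seq_compact_def by blast
  then show thesis using that by (simp add: comp_def)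
qed

context birth_model
begin

text \<open>The fluctuation bound does not depend on the mesh, so it survives the limit of vanishing mesh
  along a subsequence on which the discrete speeds converge.\<close>

lemma front_speed_exists:
  fixes M :: "'w measure" and F :: "nat \<Rightarrow> 'w \<Rightarrow> int"
  assumes M: "prob_space M"
    and chain: "\<And>n. front_chain N R b (\<nu> n) (2 ^ n)"
    and W [measurable]: "\<And>n. W n \<in> M \<rightarrow>\<^sub>M PiM UNIV (\<lambda>_. borel)"
    and law: "\<And>n. distr M (PiM UNIV (\<lambda>_. borel)) (W n) = PiM UNIV (\<lambda>_. \<nu> n)"
    and lim: "AE \<omega> in M. \<forall>k. \<forall>\<^sub>F n in sequentially. front (run single (W n \<omega>) (k * (N * 2 ^ n))) = F k \<omega>"
  shows "\<exists>lam>0. AE \<omega> in M. (\<lambda>k. real_of_int (F k \<omega>) / real k) \<longlonglongrightarrow> lam"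
proof -
  interpret prob_space M by (rule M)
  define Y where "Y n k w = real_of_int (front (run single w (k * (N * 2 ^ n))))" for n k and w :: marks
  define lo where "lo = front_chain.speed_min N b"
  define hi where "hi = front_chain.C N R b"
  define v where "v = front_chain.var_rate N R b"
  have Ym: "Y n k \<in> borel_measurable (PiM UNIV (\<lambda>_. borel))" for n k
  proof -
    interpret front_chain N R b "\<nu> n" "2 ^ n" by (rule chain)
    have "Y n k \<in> borel_measurable P"
      unfolding Y_def[abs_def] using front_run_bdd[OF single_fin] by (rule bdd_measurable)
    then show ?thesis using measurable_cong_sets[OF sets_P refl] by blast
  qed
  have "\<exists>s. s \<in> {lo..hi} \<and> (\<forall>k. (\<integral>\<^sup>+\<omega>. ennreal ((Y n k (W n \<omega>) - s * k)\<^sup>2) \<partial>M) \<le> ennreal (v * k))" for n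
  proof -
    interpret front_chain N R b "\<nu> n" "2 ^ n" by (rule chain)
    have "(\<integral>\<^sup>+\<omega>. ennreal ((Y n k (W n \<omega>) - speed * k)\<^sup>2) \<partial>M) \<le> ennreal (v * k)" for k
    proof -
      have YX: "Y n k w = real_of_int (X k w)" for w by (simp add: Y_def X_def S_def)
      have b: "bdd (\<lambda>w. (Y n k w - speed * k)\<^sup>2)"
        unfolding Y_def by (intro bdd_power2 bdd_diff bdd_const front_run_bdd single_fin)
      have "(\<integral>\<^sup>+\<omega>. ennreal ((Y n k (W n \<omega>) - speed * k)\<^sup>2) \<partial>M)
          = (\<integral>\<^sup>+w. ennreal ((Y n k w - speed * k)\<^sup>2) \<partial>(distr M (PiM UNIV (\<lambda>_. borel)) (W n)))"
      proof -
        note [measurable] = Ym[of n k]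
        have "(\<lambda>w. ennreal ((Y n k w - speed * k)\<^sup>2)) \<in> borel_measurable (PiM UNIV (\<lambda>_. borel))"
          by measurable
        then have "(\<lambda>w. ennreal ((Y n k w - speed * k)\<^sup>2))
            \<in> borel_measurable (distr M (PiM UNIV (\<lambda>_. borel)) (W n))" by simp
        from nn_integral_distr[OF W this] show ?thesis by simp
      qed
      also have "\<dots> = (\<integral>\<^sup>+w. ennreal ((Y n k w - speed * k)\<^sup>2) \<partial>P)"
        by (simp add: law P_def)
      also have "\<dots> = ennreal (P.expectation (\<lambda>w. (Y n k w - speed * k)\<^sup>2))"
        by (rule nn_integral_eq_integral[OF bdd_integrable[OF b]]) simp
      also have "\<dots> \<le> ennreal (v * k)"
        using fluctuation_bound[of k] by (intro ennreal_leI) (simp add: YX v_def)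
      finally show ?thesis .
    qed
    moreover have "speed \<in> {lo..hi}" using speed_ge speed_le by (simp add: lo_def hi_def)
    ultimately show ?thesis by blast
  qed
  then obtain s where s: "\<And>n. s n \<in> {lo..hi}"
    "\<And>n k. (\<integral>\<^sup>+\<omega>. ennreal ((Y n k (W n \<omega>) - s n * k)\<^sup>2) \<partial>M) \<le> ennreal (v * k)"
    by metis
  obtain l r where l: "l \<in> {lo..hi}" and r: "strict_mono r" "(\<lambda>n. s (r n)) \<longlonglongrightarrow> l"
    using bounded_real_subseq[OF s(1)] .
  have lo: "lo > 0"
  proof -
    interpret front_chain N R b "\<nu> 0" "2 ^ 0" by (rule chain)
    show ?thesis unfolding lo_def by (rule speed_min_pos)
  qed
  have v: "v \<ge> 0"
  proof -
    interpret front_chain N R b "\<nu> 0" "2 ^ 0" by (rule chain)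
    show ?thesis unfolding v_def var_rate_def using C_pos p_min_pos by simp
  qed
  define Q where "Q k \<omega> = liminf (\<lambda>n. ennreal ((Y (r n) k (W (r n) \<omega>) - s (r n) * k)\<^sup>2))" for k \<omega>
  have YW [measurable]: "(\<lambda>\<omega>. Y n k (W n \<omega>)) \<in> borel_measurable M" for n k
    by (rule measurable_compose[OF W Ym])
  have Qm [measurable]: "Q k \<in> borel_measurable M" for k unfolding Q_def[abs_def] by measurable
  have Qint: "(\<integral>\<^sup>+\<omega>. Q k \<omega> \<partial>M) \<le> ennreal (v * k)" for k
  proof -
    have "(\<integral>\<^sup>+\<omega>. Q k \<omega> \<partial>M)
        \<le> liminf (\<lambda>n. \<integral>\<^sup>+\<omega>. ennreal ((Y (r n) k (W (r n) \<omega>) - s (r n) * k)\<^sup>2) \<partial>M)"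
      unfolding Q_def by (rule nn_integral_liminf) measurable
    also have "\<dots> \<le> liminf (\<lambda>n :: nat. ennreal (v * k))"
      by (rule Liminf_mono) (simp add: s(2))
    finally show ?thesis by (simp add: Liminf_const)
  qed
  have "(\<integral>\<^sup>+\<omega>. (\<Sum>j. ennreal (1 / (real (Suc j)) ^ 4) * Q ((Suc j)\<^sup>2) \<omega>) \<partial>M) < \<infinity>"
  proof -
    have "(\<integral>\<^sup>+\<omega>. (\<Sum>j. ennreal (1 / (real (Suc j)) ^ 4) * Q ((Suc j)\<^sup>2) \<omega>) \<partial>M)
        = (\<Sum>j. ennreal (1 / (real (Suc j)) ^ 4) * (\<integral>\<^sup>+\<omega>. Q ((Suc j)\<^sup>2) \<omega> \<partial>M))"
      by (simp add: nn_integral_suminf nn_integral_cmult)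
    also have "\<dots> \<le> (\<Sum>j. ennreal (v * (1 / (real (Suc j))\<^sup>2)))"
    proof (intro suminf_le)
      fix j
      have "ennreal (1 / (real (Suc j)) ^ 4) * (\<integral>\<^sup>+\<omega>. Q ((Suc j)\<^sup>2) \<omega> \<partial>M)
          \<le> ennreal (1 / (real (Suc j)) ^ 4) * ennreal (v * real ((Suc j)\<^sup>2))"
        by (intro mult_left_mono Qint) simp
      also have "\<dots> = ennreal (1 / (real (Suc j)) ^ 4 * (v * real ((Suc j)\<^sup>2)))"
        using v by (intro ennreal_mult[symmetric]) auto
      also have "1 / (real (Suc j)) ^ 4 * (v * real ((Suc j)\<^sup>2)) = v * (1 / (real (Suc j))\<^sup>2)"
      proof -
        define c where "c = (real (Suc j))\<^sup>2"
        have c: "c > 0" "(real (Suc j)) ^ 4 = c\<^sup>2" "real ((Suc j)\<^sup>2) = c"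
          by (simp_all add: c_def)
        show ?thesis unfolding c(2,3) c_def[symmetric] using c(1) by (simp add: power2_eq_square)
      qed
      finally show "ennreal (1 / (real (Suc j)) ^ 4) * (\<integral>\<^sup>+\<omega>. Q ((Suc j)\<^sup>2) \<omega> \<partial>M)
        \<le> ennreal (v * (1 / (real (Suc j))\<^sup>2))" .
    qed auto
    also have "\<dots> < \<infinity>"
    proof -
      have "summable (\<lambda>j. 1 / (real j) ^ 2)"
        using inverse_power_summable[of 2, where 'a = real] by (simp add: inverse_eq_divide)
      then have "summable (\<lambda>j. v * (1 / (real (Suc j))\<^sup>2))"
        by (intro summable_mult) (subst summable_Suc_iff)
      then show ?thesis using v by (simp add: suminf_ennreal2)
    qed
    finally show ?thesis .
  qed
  then have fin: "AE \<omega> in M. (\<Sum>j. ennreal (1 / (real (Suc j)) ^ 4) * Q ((Suc j)\<^sup>2) \<omega>) \<noteq> \<infinity>"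
  proof (intro nn_integral_PInf_AE)
    show "(\<lambda>\<omega>. \<Sum>j. ennreal (1 / (real (Suc j)) ^ 4) * Q ((Suc j)\<^sup>2) \<omega>) \<in> borel_measurable M"
      by measurable
  qed simp
  have "AE \<omega> in M. (\<lambda>k. real_of_int (F k \<omega>) / real k) \<longlonglongrightarrow> l"
    using lim fin
  proof eventually_elim
    case (elim \<omega>)
    note ev = elim(1)[rule_format]
    have X0: "F 0 \<omega> = 0"
    proof -
      have "\<exists>n. front (run single (W n \<omega>) (0 * (N * 2 ^ n))) = F 0 \<omega>"
        using ev[of 0] by (rule eventually_happens'[OF sequentially_bot])
      moreover have "front single = 0" using single_fin by (intro front_eqI) (auto simp: occ_single)
      ultimately show ?thesis by simp
    qed
    have Xmono: "F k \<omega> \<le> F m \<omega>" if "k \<le> m" for k m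
    proof -
      obtain n where "front (run single (W n \<omega>) (k * (N * 2 ^ n))) = F k \<omega>"
        "front (run single (W n \<omega>) (m * (N * 2 ^ n))) = F m \<omega>"
        using eventually_happens'[OF sequentially_bot eventually_conj[OF ev[of k] ev[of m]]] by blast
      moreover have "k * (N * 2 ^ n) \<le> m * (N * 2 ^ n)" using that by (rule mult_right_mono) simp
      ultimately show ?thesis using front_run_mono[OF single_fin] by metis
    qed
    have Q: "Q k \<omega> = ennreal ((real_of_int (F k \<omega>) - l * k)\<^sup>2)" for k
    proof -
      have "\<forall>\<^sub>F n in sequentially. Y (r n) k (W (r n) \<omega>) = real_of_int (F k \<omega>)"
        using eventually_subseq[OF r(1) ev[of k]] by eventually_elim (simp add: Y_def)
      then have "\<forall>\<^sub>F n in sequentially. ennreal ((real_of_int (F k \<omega>) - s (r n) * k)\<^sup>2)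
          = ennreal ((Y (r n) k (W (r n) \<omega>) - s (r n) * k)\<^sup>2)"
        by eventually_elim simp
      moreover have "(\<lambda>n. ennreal ((real_of_int (F k \<omega>) - s (r n) * k)\<^sup>2))
          \<longlonglongrightarrow> ennreal ((real_of_int (F k \<omega>) - l * k)\<^sup>2)"
        by (intro tendsto_intros r(2))
      ultimately have "(\<lambda>n. ennreal ((Y (r n) k (W (r n) \<omega>) - s (r n) * k)\<^sup>2))
          \<longlonglongrightarrow> ennreal ((real_of_int (F k \<omega>) - l * k)\<^sup>2)"
        by (rule Lim_transform_eventually[rotated])
      then show ?thesis unfolding Q_def by (intro lim_imp_Liminf) auto
    qed
    define a where "a j = (real_of_int (F ((Suc j)\<^sup>2) \<omega>) / (real (Suc j))\<^sup>2 - l)\<^sup>2" for j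
    have "ennreal (1 / (real (Suc j)) ^ 4) * Q ((Suc j)\<^sup>2) \<omega> = ennreal (a j)" for j
    proof -
      have "1 / (real (Suc j)) ^ 4 * (real_of_int (F ((Suc j)\<^sup>2) \<omega>) - l * real ((Suc j)\<^sup>2))\<^sup>2 = a j"
      proof -
        define c where "c = (real (Suc j))\<^sup>2"
        have c: "c > 0" "(real (Suc j)) ^ 4 = c\<^sup>2" "real ((Suc j)\<^sup>2) = c"
          by (simp_all add: c_def)
        have "real_of_int (F ((Suc j)\<^sup>2) \<omega>) / c - l = (real_of_int (F ((Suc j)\<^sup>2) \<omega>) - l * c) / c"
          using c(1) by (simp add: diff_divide_distrib)
        then show ?thesis unfolding a_def c_def[symmetric] c(2,3) by (simp add: power_divide)
      qed
      then show ?thesis unfolding Q by (subst ennreal_mult[symmetric]) auto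
    qed
    then have "(\<Sum>j. ennreal (a j)) \<noteq> \<top>" using elim(2) by simp
    then have "summable a" by (intro summable_suminf_not_top) (auto simp: a_def)
    then have "a \<longlonglongrightarrow> 0" by (rule summable_LIMSEQ_zero)
    then have "(\<lambda>j. sqrt (a j)) \<longlonglongrightarrow> sqrt 0" by (rule tendsto_real_sqrt)
    then have "(\<lambda>j. real_of_int (F ((Suc j)\<^sup>2) \<omega>) / (real (Suc j))\<^sup>2 - l) \<longlonglongrightarrow> 0"
      by (simp add: a_def[abs_def] tendsto_rabs_zero_iff)
    then have "(\<lambda>j. real_of_int (F ((Suc j)\<^sup>2) \<omega>) / (real (Suc j))\<^sup>2) \<longlonglongrightarrow> l"
      by (simp only: LIM_zero_iff)
    then show ?case
      using Xmono X0 by (intro tendsto_ratio_from_squares[where x = "\<lambda>k. real_of_int (F k \<omega>)"]) auto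
  qed
  moreover have "l > 0" using l lo by simp
  ultimately show ?thesis by blast
qed

end

section \<open>Reflection\<close>

definition reflect :: "config \<Rightarrow> config" where "reflect \<eta> = (\<lambda>z. \<eta> (- z))"

definition rear :: "config \<Rightarrow> int" where "rear \<eta> = Min (occ \<eta>)"

lemma occ_reflect: "occ (reflect \<eta>) = uminus ` occ \<eta>"
  by (force simp: occ_def reflect_def image_iff)

lemma front_reflect: assumes "finite (occ \<eta>)" "occ \<eta> \<noteq> {}" shows "front (reflect \<eta>) = - rear \<eta>"
  unfolding front_def rear_def occ_reflect
proof (rule Max_eqI)
  show "- Min (occ \<eta>) \<in> uminus ` occ \<eta>" using assms by (intro imageI Min_in)
qed (use assms in auto)

context birth_model
begin

text \<open>The rate of the reflected process.  It takes the same values, so that the reflected marks drive it.\<close>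

definition b_refl :: rate where "b_refl x \<eta> = b (- x) (reflect \<eta>)"

lemma reflect_reflect: "reflect (reflect \<eta>) = \<eta>" by (simp add: reflect_def)

lemma reflect_configs: "\<eta> \<in> configs N \<Longrightarrow> reflect \<eta> \<in> configs N"
  by (simp add: reflect_def configs_def)

lemma birth_model_refl: "birth_model N R b_refl"
proof (rule birth_model.intro)
  show "birth_rate N b_refl"
    using b_nonneg reflect_configs by (auto simp: birth_rate_def b_refl_def)
  show "translation_invariant N b_refl"
    unfolding translation_invariant_def
  proof (intro allI ballI)
    fix x y \<eta> assume "\<eta> \<in> configs N"
    then have "b (- x + - y) (shift (reflect \<eta>) (- y)) = b (- x) (reflect \<eta>)"
      by (intro b_shift reflect_configs)
    moreover have "shift (reflect \<eta>) (- y) = reflect (shift \<eta> y)"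
      by (simp add: shift_def reflect_def fun_eq_iff)
    ultimately show "b_refl (x + y) (shift \<eta> y) = b_refl x \<eta>" by (simp add: b_refl_def)
  qed
  show "finite_range N R b_refl"
    unfolding finite_range_def
  proof (intro allI ballI impI)
    fix x \<eta> \<xi> assume c: "\<eta> \<in> configs N" "\<xi> \<in> configs N" and eq: "\<forall>z. \<bar>x - z\<bar> \<le> int R \<longrightarrow> \<eta> z = \<xi> z"
    show "b_refl x \<eta> = b_refl x \<xi>"
      unfolding b_refl_def
    proof (rule b_cong[OF reflect_configs[OF c(1)] reflect_configs[OF c(2)]])
      fix z assume "\<bar>- x - z\<bar> \<le> int R"
      then have "\<bar>x - (- z)\<bar> \<le> int R" by linarith
      then show "reflect \<eta> z = reflect \<xi> z" using eq by (simp add: reflect_def)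
    qed
  qed
  show "nondegenerate N R b_refl"
    unfolding nondegenerate_def
  proof (intro allI ballI)
    fix x \<eta> assume "\<eta> \<in> configs N"
    then have "b_refl x \<eta> > 0 \<longleftrightarrow> (\<exists>y\<in>occ (reflect \<eta>). \<bar>- x - y\<bar> \<le> int R)"
      unfolding b_refl_def by (intro b_pos_iff reflect_configs)
    also have "\<dots> \<longleftrightarrow> (\<exists>y\<in>occ \<eta>. \<bar>x - y\<bar> \<le> int R)"
      by (simp add: occ_reflect abs_minus_commute)
    finally show "b_refl x \<eta> > 0 \<longleftrightarrow> (\<exists>y\<in>occ \<eta>. \<bar>x - y\<bar> \<le> int R)" .
  qed
qed (rule N_pos R_pos)+

lemma pos_rates_refl: "birth_model.pos_rates N b_refl = pos_rates"
proof -
  interpret r: birth_model N R b_refl by (rule birth_model_refl)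
  show ?thesis
  proof (intro set_eqI iffI)
    fix v assume "v \<in> r.pos_rates"
    then show "v \<in> pos_rates" unfolding r.pos_rates_def pos_rates_def b_refl_def using reflect_configs by blast
  next
    fix v assume "v \<in> pos_rates"
    then obtain x \<eta> where "v = b x \<eta>" "\<eta> \<in> configs N" "b x \<eta> > 0" unfolding pos_rates_def by blast
    then have "v = b_refl (- x) (reflect \<eta>)" "reflect \<eta> \<in> configs N" "b_refl (- x) (reflect \<eta>) > 0"
      by (simp_all add: b_refl_def reflect_reflect reflect_configs)
    then show "v \<in> r.pos_rates" unfolding r.pos_rates_def by blast
  qed
qed

lemma run_refl: "birth_model.run N b_refl single (\<lambda>(t, i). w (t, - i)) t = reflect (run single w t)"
proof -
  interpret r: birth_model N R b_refl by (rule birth_model_refl)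
  show ?thesis
  proof (induction t)
    case 0 then show ?case by (simp add: single_def reflect_def)
  next
    case (Suc t)
    have "r.step (reflect \<eta>) (\<lambda>i. u (- i)) = reflect (step \<eta> u)" for \<eta> u
    proof
      fix i
      have "b_refl i (reflect \<eta>) = b (- i) \<eta>" by (simp add: b_refl_def reflect_reflect)
      then show "r.step (reflect \<eta>) (\<lambda>i. u (- i)) i = reflect (step \<eta> u) i"
        unfolding r.step_def step_def reflect_def by simp
    qed
    then show ?case using Suc by simp
  qed
qed

end

section \<open>The shape theorem\<close>

context driven_model
begin

lemma marks_measurable: "mark S \<in> M \<rightarrow>\<^sub>M PiM UNIV (\<lambda>_. borel)"
  by (rule measurable_PiM_single') (auto simp: space_PiM)

lemma front_chain_refl: "front_chain N R b_refl (mark_law (N * 2 ^ n)) (2 ^ n)"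
proof (intro front_chain.intro front_chain_axioms.intro)
  interpret r: birth_model N R b_refl by (rule birth_model_refl)
  have eq: "r.bmax = bmax" "r.bmin = bmin"
    unfolding r.bmax_def r.bmin_def bmax_def bmin_def pos_rates_refl by simp_all
  interpret fc: front_chain N R b "mark_law (N * 2 ^ n)" "2 ^ n" by (rule front_chain_mark) simp
  show "measure (mark_law (N * 2 ^ n)) {v<..} = exp (- v / real (N * 2 ^ n))"
    if "v = r.bmax \<or> v = r.bmin" for v
    using fc.mark_above that unfolding eq by blast
qed (simp_all add: birth_model_refl iid_field_mark)

lemma distr_marks_refl:
  assumes "S \<ge> 1"
  shows "distr M (PiM UNIV (\<lambda>_. borel)) (\<lambda>\<omega> (t, i). mark S \<omega> (t, - i)) = PiM UNIV (\<lambda>_. mark_law S)"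
proof -
  interpret iid_field "mark_law S" by (rule iid_field_mark)
  let ?B = "PiM UNIV (\<lambda>_. borel) :: marks measure"
  let ?T = "\<lambda>w :: marks. \<lambda>n\<in>UNIV. w ((\<lambda>(t, i). (t, - i)) n)"
  have T: "?T \<in> ?B \<rightarrow>\<^sub>M ?B"
    by (rule measurable_PiM_single') (auto simp: space_PiM)
  have "distr M ?B (\<lambda>\<omega> (t, i). mark S \<omega> (t, - i)) = distr M ?B (?T \<circ> mark S)"
    by (intro distr_cong) (auto simp: fun_eq_iff)
  also have "\<dots> = distr (distr M ?B (mark S)) ?B ?T"
    by (rule distr_distr[OF T marks_measurable, symmetric])
  also have "\<dots> = distr (PiM UNIV (\<lambda>_. mark_law S)) (PiM UNIV (\<lambda>_. mark_law S)) ?T"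
    unfolding distr_marks[OF assms]
    by (intro distr_cong) (auto intro!: sets_PiM_cong simp: mark_law_def)
  also have "\<dots> = PiM UNIV (\<lambda>_. mark_law S)"
    by (rule distr_PiM_reindex) (auto simp: inj_on_def intro: prob_\<nu>)
  finally show ?thesis .
qed

text \<open>The void stretches far out are found among the translates of one stretch by multiples of \<open>R\<close>, to the
  right (\<open>c = 1\<close>) and to the left (\<open>c = - 1\<close>).\<close>

lemma AE_birth_path:
  assumes meas: "\<And>t. t \<ge> 0 \<Longrightarrow> \<eta> t \<in> M \<rightarrow>\<^sub>M config_space N"
    and cadlag: "AE \<omega> in M. cadlag (\<lambda>t. \<eta> t \<omega>)"
    and equation: "AE \<omega> in M. birth_equation N b single (pts \<omega>) (\<lambda>t. \<eta> t \<omega>)"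
  shows "AE \<omega> in M. birth_path N R b M pts \<omega> (\<lambda>t. \<eta> t \<omega>)"
proof -
  let ?V = "\<lambda>m \<omega> x. count \<omega> (strip (real m) (real (Suc m)) {x<..x + int R} bmax) = 0"
  have zero: "AE \<omega> in M. \<forall>m i. count \<omega> (strip 0 (real m) {i} 0) = 0"
    unfolding AE_all_countable
  proof (intro allI AE_void_null)
    fix m :: nat and i :: int
    show "emeasure driving_intensity (strip 0 (real m) {i} 0) = 0" by (subst emeasure_strip) auto
  qed simp
  have void: "AE \<omega> in M. \<exists>n :: nat. ?V m \<omega> (a + c * (int n * int R))" if c: "c = 1 \<or> c = - 1" for m a c
  proof (rule AE_void_somewhere)
    show "disjoint_family (\<lambda>n. strip (real m) (real (Suc m))
      {a + c * (int n * int R)<..a + c * (int n * int R) + int R} bmax)"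
      unfolding disjoint_family_on_def
    proof (intro ballI impI)
      fix k l :: nat assume "k \<noteq> l"
      have le: "int k * int R + int R \<le> int l * int R" if "k < l" for k l :: nat
      proof -
        have "(int k + 1) * int R \<le> int l * int R" using that by (intro mult_right_mono) auto
        then show ?thesis by (simp add: algebra_simps)
      qed
      have "{a + c * (int k * int R)<..a + c * (int k * int R) + int R}
          \<inter> {a + c * (int l * int R)<..a + c * (int l * int R) + int R} = {}"
        using le[of k l] le[of l k] \<open>k \<noteq> l\<close> c by (cases "k < l") auto
      then show "strip (real m) (real (Suc m)) {a + c * (int k * int R)<..a + c * (int k * int R) + int R} bmax
          \<inter> strip (real m) (real (Suc m)) {a + c * (int l * int R)<..a + c * (int l * int R) + int R} bmax = {}"
        unfolding strip_def by blast
    qed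
    fix n
    have *: "0 \<le> real m" "real m \<le> real (Suc m)"
      "finite {a + c * (int n * int R)<..a + c * (int n * int R) + int R}" "0 \<le> bmax"
      using bmax_pos by auto
    show "emeasure driving_intensity (strip (real m) (real (Suc m))
      {a + c * (int n * int R)<..a + c * (int n * int R) + int R} bmax) < \<infinity>"
      by (rule measure_strip(2)[OF *])
    show "measure driving_intensity (strip (real m) (real (Suc m))
      {a + c * (int n * int R)<..a + c * (int n * int R) + int R} bmax) = real R * bmax"
      unfolding measure_strip(1)[OF *] by simp
  qed simp
  have right: "AE \<omega> in M. \<forall>m a. \<exists>x\<ge>a. ?V m \<omega> x"
    unfolding AE_all_countable
  proof (intro allI)
    fix m a show "AE \<omega> in M. \<exists>x\<ge>a. ?V m \<omega> x"
      using void[OF disjI1[OF refl], of m a]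
    proof eventually_elim
      case (elim \<omega>)
      then obtain n where "?V m \<omega> (a + 1 * (int n * int R))" by blast
      then show ?case by (intro exI[of _ "a + 1 * (int n * int R)"]) auto
    qed
  qed
  have left: "AE \<omega> in M. \<forall>m a. \<exists>x\<le>a. ?V m \<omega> x"
    unfolding AE_all_countable
  proof (intro allI)
    fix m a show "AE \<omega> in M. \<exists>x\<le>a. ?V m \<omega> x"
      using void[OF disjI2[OF refl], of m a]
    proof eventually_elim
      case (elim \<omega>)
      then obtain n where "?V m \<omega> (a + - 1 * (int n * int R))" by blast
      then show ?case by (intro exI[of _ "a + - 1 * (int n * int R)"]) auto
    qed
  qed
  have cells: "AE \<omega> in M. \<forall>m l. \<forall>\<^sub>F n in sequentially. \<forall>t<m * (N * 2 ^ n).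
      count \<omega> (cell (N * 2 ^ n) t {- int l..int l} bmax) \<le> 1"
    unfolding AE_all_countable cell_def using AE_cells[of bmax N] bmax_pos N_pos by simp
  show ?thesis
    using zero right left cells cadlag equation AE_space
  proof eventually_elim
    case (elim \<omega>)
    show ?case
    proof (intro birth_path.intro birth_path_axioms.intro)
      fix t :: real assume "0 \<le> t"
      then have "\<eta> t \<omega> \<in> space (config_space N)" using measurable_space[OF meas] elim by blast
      then show "\<eta> t \<omega> \<in> configs N" by (auto simp: config_space_def space_PiM configs_def PiE_iff)
    qed (use elim driven_model_axioms in blast)+
  qed
qed

end

context birth_path
begin

lemma state_fin: "f (real k) \<in> fin_configs" and state_no_gaps: "no_gaps (f (real k))"
proof -
  obtain n where "run single (mark (N * 2 ^ n) \<omega>) (k * (N * 2 ^ n)) = f (real k)"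
    using eventually_happens'[OF sequentially_bot run_eq_state[of k]] by blast
  then show "f (real k) \<in> fin_configs" "no_gaps (f (real k))"
    using run_fin[OF single_fin] no_gaps_run by metis+
qed

lemma occ_mono: "0 \<le> s \<Longrightarrow> s \<le> t \<Longrightarrow> occ (f s) \<subseteq> occ (f t)"
  using mono_aux[of s t] by (auto simp: occ_def intro: less_le_trans)

lemma rear_in: "rear (f (real k)) \<in> occ (f (real k))"
  unfolding rear_def using fin_configsD[OF state_fin] by (intro Min_in)

lemma rear_le: "y \<in> occ (f (real k)) \<Longrightarrow> rear (f (real k)) \<le> y"
  unfolding rear_def using fin_configsD[OF state_fin] by simp

text \<open>Rounding the time up to an integer is absorbed by \<open>\<epsilon> / 2\<close>.\<close>

lemma eventually_outer_shape:
  assumes lr: "lr > 0" "(\<lambda>k. real_of_int (front (f (real k))) / real k) \<longlonglongrightarrow> lr"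
    and ll: "ll > 0" "(\<lambda>k. real_of_int (- rear (f (real k))) / real k) \<longlonglongrightarrow> ll"
    and \<epsilon>: "\<epsilon> > 0"
  shows "\<forall>\<^sub>F t in at_top. real_of_int ` occ (f t) \<subseteq> scaled_interval (1 + \<epsilon>) (- ll * t) (lr * t)"
proof -
  have "\<forall>\<^sub>F k in sequentially. real_of_int (front (f (real k))) / real k < (1 + \<epsilon> / 2) * lr"
    using lr \<epsilon> by (intro order_tendstoD(2)[OF lr(2)]) simp
  moreover have "\<forall>\<^sub>F k in sequentially. real_of_int (- rear (f (real k))) / real k < (1 + \<epsilon> / 2) * ll"
    using ll \<epsilon> by (intro order_tendstoD(2)[OF ll(2)]) simp
  ultimately have "\<forall>\<^sub>F k in sequentially. real_of_int (front (f (real k))) / real k < (1 + \<epsilon> / 2) * lr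
      \<and> real_of_int (- rear (f (real k))) / real k < (1 + \<epsilon> / 2) * ll"
    by eventually_elim simp
  then obtain K where K: "\<And>k. k \<ge> K \<Longrightarrow> real_of_int (front (f (real k))) / real k < (1 + \<epsilon> / 2) * lr"
    "\<And>k. k \<ge> K \<Longrightarrow> real_of_int (- rear (f (real k))) / real k < (1 + \<epsilon> / 2) * ll"
    unfolding eventually_sequentially by blast
  define T where "T = max (real K + 1) ((1 + \<epsilon> / 2) / (\<epsilon> / 2))"
  have "real_of_int ` occ (f t) \<subseteq> scaled_interval (1 + \<epsilon>) (- ll * t) (lr * t)" if t: "t \<ge> T" for t
  proof (intro subsetI)
    fix z assume "z \<in> real_of_int ` occ (f t)"
    then obtain x where x: "z = real_of_int x" "x \<in> occ (f t)" by blast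
    define k where "k = nat \<lceil>t\<rceil>"
    have t0: "t \<ge> real K + 1" "t \<ge> 1" using t by (auto simp: T_def)
    have k: "t \<le> real k" "real k \<le> t + 1" using t0 unfolding k_def by linarith+
    have kK: "k \<ge> K" "real k > 0" using k t0 by linarith+
    have "(1 + \<epsilon> / 2) \<le> \<epsilon> / 2 * t"
      using t \<epsilon> by (simp add: T_def pos_divide_le_eq mult.commute)
    moreover have "(1 + \<epsilon> / 2) * real k \<le> (1 + \<epsilon> / 2) * (t + 1)" using k \<epsilon> by (intro mult_left_mono) auto
    moreover have "(1 + \<epsilon> / 2) * (t + 1) = t + \<epsilon> / 2 * t + (1 + \<epsilon> / 2)"
      "(1 + \<epsilon>) * t = t + \<epsilon> / 2 * t + \<epsilon> / 2 * t" by (simp_all add: algebra_simps)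
    ultimately have kt: "(1 + \<epsilon> / 2) * real k \<le> (1 + \<epsilon>) * t" by linarith
    have xk: "x \<in> occ (f (real k))" using occ_mono[of t "real k"] k t0 x(2) by auto
    have "real_of_int x \<le> real_of_int (front (f (real k)))"
      using front_ge[OF state_fin xk] by simp
    also have "\<dots> \<le> (1 + \<epsilon> / 2) * lr * real k"
      using K(1)[OF kK(1)] unfolding pos_divide_less_eq[OF kK(2)] by (rule less_imp_le)
    also have "\<dots> = lr * ((1 + \<epsilon> / 2) * real k)" by simp
    also have "\<dots> \<le> lr * ((1 + \<epsilon>) * t)" using kt lr by (intro mult_left_mono) auto
    finally have up: "real_of_int x \<le> lr * ((1 + \<epsilon>) * t)" .
    have "- real_of_int x \<le> real_of_int (- rear (f (real k)))" using rear_le[OF xk] by simp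
    also have "\<dots> \<le> (1 + \<epsilon> / 2) * ll * real k"
      using K(2)[OF kK(1)] unfolding pos_divide_less_eq[OF kK(2)] by (rule less_imp_le)
    also have "\<dots> = ll * ((1 + \<epsilon> / 2) * real k)" by simp
    also have "\<dots> \<le> ll * ((1 + \<epsilon>) * t)" using kt ll by (intro mult_left_mono) auto
    finally have "- real_of_int x \<le> ll * ((1 + \<epsilon>) * t)" .
    with up show "z \<in> scaled_interval (1 + \<epsilon>) (- ll * t) (lr * t)"
      by (simp add: scaled_interval_def x(1) mult_ac)
  qed
  then show ?thesis unfolding eventually_at_top_linorder by blast
qed

text \<open>The time \<open>t\<close> is split: at the integer time \<open>k \<approx> (1 - \<epsilon> / 2) t\<close> both fronts have passed the
  points of the smaller interval, and in the remaining time, at least \<open>\<epsilon> k / 2\<close>, all holes are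
  filled.\<close>

lemma eventually_inner_shape:
  assumes lr: "lr > 0" "(\<lambda>k. real_of_int (front (f (real k))) / real k) \<longlonglongrightarrow> lr"
    and ll: "ll > 0" "(\<lambda>k. real_of_int (- rear (f (real k))) / real k) \<longlonglongrightarrow> ll"
    and \<epsilon>: "\<epsilon> > 0" "\<epsilon> < 1"
    and fill: "\<forall>\<^sub>F k in sequentially. \<forall>x\<in>{- int (l * k)..int (l * k)}.
      count \<omega> (strip (real k) (real (k + nat \<lceil>\<epsilon> / 2 * real k\<rceil>)) {x} bmin) \<noteq> 0"
    and l: "lr \<le> real l" "ll \<le> real l"
  shows "\<forall>\<^sub>F t in at_top. scaled_interval (1 - \<epsilon>) (- ll * t) (lr * t) \<inter> \<int> \<subseteq> real_of_int ` occ (f t)"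
proof -
  have "\<forall>\<^sub>F k in sequentially. (1 - \<epsilon> / 4) * lr < real_of_int (front (f (real k))) / real k"
    using lr \<epsilon> by (intro order_tendstoD(1)[OF lr(2)]) simp
  moreover have "\<forall>\<^sub>F k in sequentially. (1 - \<epsilon> / 4) * ll < real_of_int (- rear (f (real k))) / real k"
    using ll \<epsilon> by (intro order_tendstoD(1)[OF ll(2)]) simp
  ultimately have "\<forall>\<^sub>F k in sequentially. (1 - \<epsilon> / 4) * lr < real_of_int (front (f (real k))) / real k
      \<and> (1 - \<epsilon> / 4) * ll < real_of_int (- rear (f (real k))) / real k
      \<and> (\<forall>x\<in>{- int (l * k)..int (l * k)}.
        count \<omega> (strip (real k) (real (k + nat \<lceil>\<epsilon> / 2 * real k\<rceil>)) {x} bmin) \<noteq> 0)"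
    using fill by eventually_elim simp
  then obtain K where K: "\<And>k. k \<ge> K \<Longrightarrow> (1 - \<epsilon> / 4) * lr < real_of_int (front (f (real k))) / real k"
    "\<And>k. k \<ge> K \<Longrightarrow> (1 - \<epsilon> / 4) * ll < real_of_int (- rear (f (real k))) / real k"
    "\<And>k x. k \<ge> K \<Longrightarrow> x \<in> {- int (l * k)..int (l * k)} \<Longrightarrow>
      count \<omega> (strip (real k) (real (k + nat \<lceil>\<epsilon> / 2 * real k\<rceil>)) {x} bmin) \<noteq> 0"
    unfolding eventually_sequentially by blast
  define T where "T = max (2 * (real K + 2)) (max (4 / \<epsilon>) (4 / \<epsilon>\<^sup>2))"
  have "scaled_interval (1 - \<epsilon>) (- ll * t) (lr * t) \<inter> \<int> \<subseteq> real_of_int ` occ (f t)" if t: "t \<ge> T" for t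
  proof
    fix z assume z: "z \<in> scaled_interval (1 - \<epsilon>) (- ll * t) (lr * t) \<inter> \<int>"
    then obtain x where x: "z = real_of_int x" by (auto elim: Ints_cases)
    have tK: "t \<ge> 2 * (real K + 2)" and t1: "4 / \<epsilon> \<le> t" and t2: "4 / \<epsilon>\<^sup>2 \<le> t"
      using t by (auto simp: T_def)
    have t1': "4 \<le> t * \<epsilon>" using t1 \<epsilon>(1) by (simp add: pos_divide_le_eq)
    have t2': "4 \<le> t * \<epsilon>\<^sup>2" using t2 \<epsilon>(1) by (simp add: pos_divide_le_eq)
    have "0 < 2 * (real K + 2)" by simp
    then have t0: "t > 0" using tK by (rule less_le_trans)
    \<comment> \<open>The fronts have passed \<open>x\<close> at the integer time \<open>k\<close>, and the remaining time suffices to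
      fill \<open>x\<close>.\<close>
    define k where "k = nat \<lfloor>(1 - \<epsilon> / 2) * t\<rfloor>"
    have half: "t / 2 \<le> (1 - \<epsilon> / 2) * t" using mult_right_mono[of "1 / 2" "1 - \<epsilon> / 2" t] \<epsilon> t0 by simp
    have k: "real k \<le> (1 - \<epsilon> / 2) * t" "(1 - \<epsilon> / 2) * t - 1 \<le> real k"
      using half t0 unfolding k_def by linarith+
    have "real K + 2 \<le> t / 2" using tK by simp
    then have "real K + 1 \<le> real k" using k(2) half by linarith
    then have kK: "k \<ge> K" "real k > 0" by simp_all
    have late: "real (k + nat \<lceil>\<epsilon> / 2 * real k\<rceil>) \<le> t"
    proof -
      have "real (nat \<lceil>\<epsilon> / 2 * real k\<rceil>) \<le> \<epsilon> / 2 * real k + 1"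
        using \<epsilon>(1) kK(2) mult_nonneg_nonneg[of "\<epsilon> / 2" "real k"] by linarith
      then have "real (k + nat \<lceil>\<epsilon> / 2 * real k\<rceil>) \<le> (1 + \<epsilon> / 2) * real k + 1" by (simp add: algebra_simps)
      also have "\<dots> \<le> (1 + \<epsilon> / 2) * ((1 - \<epsilon> / 2) * t) + 1"
        using k(1) \<epsilon>(1) by (intro add_right_mono mult_left_mono) auto
      also have "\<dots> = t - t * \<epsilon>\<^sup>2 / 4 + 1" by (simp add: algebra_simps power2_eq_square)
      also have "\<dots> \<le> t" using t2' by simp
      finally show ?thesis .
    qed
    have slack: "(1 - \<epsilon>) * t \<le> (1 - \<epsilon> / 4) * real k"
    proof -
      have "(1 - \<epsilon> / 4) * ((1 - \<epsilon> / 2) * t - 1) \<le> (1 - \<epsilon> / 4) * real k"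
        using k(2) \<epsilon> by (intro mult_left_mono) auto
      moreover have "(1 - \<epsilon> / 4) * ((1 - \<epsilon> / 2) * t - 1)
          = (1 - \<epsilon>) * t + (t * \<epsilon> / 4 - 1) + (t * \<epsilon>\<^sup>2 / 8 + \<epsilon> / 4)"
        by (simp add: algebra_simps power2_eq_square)
      moreover have "0 \<le> t * \<epsilon>\<^sup>2 / 8 + \<epsilon> / 4" using t0 \<epsilon>(1) by simp
      ultimately show ?thesis using t1' by linarith
    qed
    have xr: "real_of_int x \<le> lr * ((1 - \<epsilon>) * t)" and xl: "- real_of_int x \<le> ll * ((1 - \<epsilon>) * t)"
      using z by (simp_all add: scaled_interval_def x mult_ac)
    have tk: "(1 - \<epsilon>) * t \<le> real k" using slack kK(2) \<epsilon>(1) mult_right_mono[of "1 - \<epsilon> / 4" 1 "real k"] by linarith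
    have "real_of_int x \<le> lr * ((1 - \<epsilon> / 4) * real k)"
      using xr mult_left_mono[OF slack, of lr] lr by linarith
    also have "\<dots> \<le> real_of_int (front (f (real k)))"
      using K(1)[OF kK(1)] unfolding pos_less_divide_eq[OF kK(2)] by (simp add: mult_ac)
    finally have right: "x \<le> front (f (real k))" by simp
    have "- real_of_int x \<le> ll * ((1 - \<epsilon> / 4) * real k)"
      using xl mult_left_mono[OF slack, of ll] ll by linarith
    also have "\<dots> \<le> real_of_int (- rear (f (real k)))"
      using K(2)[OF kK(1)] unfolding pos_less_divide_eq[OF kK(2)] by (simp add: mult_ac)
    finally have left: "rear (f (real k)) \<le> x" by simp
    obtain y where y: "y \<in> occ (f (real k))" "\<bar>x - y\<bar> \<le> int R"
      using state_no_gaps[of k] left right rear_in[of k] front_in[OF state_fin[of k]]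
      unfolding no_gaps_def by blast
    have "x \<in> {- int (l * k)..int (l * k)}"
    proof -
      have "real_of_int x \<le> real l * real k"
        using xr mult_mono[OF l(1) tk] t0 \<epsilon> by (smt (verit) mult_nonneg_nonneg of_nat_0_le_iff)
      moreover have "- real_of_int x \<le> real l * real k"
        using xl mult_mono[OF l(2) tk] t0 \<epsilon> by (smt (verit) mult_nonneg_nonneg of_nat_0_le_iff)
      ultimately have "real_of_int x \<le> real_of_int (int (l * k))" "real_of_int (- x) \<le> real_of_int (int (l * k))"
        by simp_all
      then show ?thesis by (simp only: of_int_le_iff) auto
    qed
    then have "x \<in> occ (f (real (k + nat \<lceil>\<epsilon> / 2 * real k\<rceil>)))"
      by (intro state_filled[OF _ _ y] K(3) kK(1)) auto
    then have "x \<in> occ (f t)" using occ_mono[OF _ late] by auto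
    then show "z \<in> real_of_int ` occ (f t)" by (simp add: x)
  qed
  then show ?thesis unfolding eventually_at_top_linorder by blast
qed

text \<open>For \<open>\<epsilon> \<ge> 1\<close> the interval contains at most the origin.\<close>

lemma inner_shape_trivial:
  assumes "lr > 0" "ll > 0" "\<epsilon> \<ge> 1" "t \<ge> 0"
  shows "scaled_interval (1 - \<epsilon>) (- ll * t) (lr * t) \<inter> \<int> \<subseteq> real_of_int ` occ (f t)"
proof
  fix z assume "z \<in> scaled_interval (1 - \<epsilon>) (- ll * t) (lr * t) \<inter> \<int>"
  then have z: "(1 - \<epsilon>) * (- ll * t) \<le> z" "z \<le> (1 - \<epsilon>) * (lr * t)" by (auto simp: scaled_interval_def)
  have "0 \<le> (\<epsilon> - 1) * (ll * t)" "0 \<le> (\<epsilon> - 1) * (lr * t)" using assms by auto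
  then have "z = 0" using z by (simp add: algebra_simps)
  moreover have "0 \<in> occ (f t)" using occ_mono[of 0 t] assms(4) by (auto simp: state_0 occ_single)
  ultimately show "z \<in> real_of_int ` occ (f t)" by force
qed

end

context driven_model
begin

lemma AE_speeds:
  assumes path: "AE \<omega> in M. birth_path N R b M pts \<omega> (\<lambda>t. \<eta> t \<omega>)"
  shows "\<exists>lr>0. AE \<omega> in M. (\<lambda>k. real_of_int (front (\<eta> (real k) \<omega>)) / real k) \<longlonglongrightarrow> lr"
    and "\<exists>ll>0. AE \<omega> in M. (\<lambda>k. real_of_int (- rear (\<eta> (real k) \<omega>)) / real k) \<longlonglongrightarrow> ll"
proof -
  have S: "N * 2 ^ n \<ge> 1" for n :: nat using N_pos by simp
  have run: "AE \<omega> in M. \<forall>k. \<forall>\<^sub>F n in sequentially. run single (mark (N * 2 ^ n) \<omega>) (k * (N * 2 ^ n)) = \<eta> (real k) \<omega>"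
    using path
  proof eventually_elim
    case (elim \<omega>)
    then interpret birth_path N R b M pts \<omega> "\<lambda>t. \<eta> t \<omega>" .
    show ?case using run_eq_state by blast
  qed
  show "\<exists>lr>0. AE \<omega> in M. (\<lambda>k. real_of_int (front (\<eta> (real k) \<omega>)) / real k) \<longlonglongrightarrow> lr"
  proof (rule front_speed_exists[OF prob_space_axioms])
    show "front_chain N R b (mark_law (N * 2 ^ n)) (2 ^ n)" for n by (rule front_chain_mark) simp
    show "mark (N * 2 ^ n) \<in> M \<rightarrow>\<^sub>M PiM UNIV (\<lambda>_. borel)" for n by (rule marks_measurable)
    show "distr M (PiM UNIV (\<lambda>_. borel)) (mark (N * 2 ^ n)) = PiM UNIV (\<lambda>_. mark_law (N * 2 ^ n))" for n
      by (rule distr_marks[OF S])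
    show "AE \<omega> in M. \<forall>k. \<forall>\<^sub>F n in sequentially.
        front (run single (mark (N * 2 ^ n) \<omega>) (k * (N * 2 ^ n))) = front (\<eta> (real k) \<omega>)"
      using run
    proof eventually_elim
      case (elim \<omega>)
      show ?case
      proof
        fix k
        from elim[rule_format, of k]
        show "\<forall>\<^sub>F n in sequentially. front (run single (mark (N * 2 ^ n) \<omega>) (k * (N * 2 ^ n))) = front (\<eta> (real k) \<omega>)"
          by eventually_elim simp
      qed
    qed
  qed
  interpret r: birth_model N R b_refl by (rule birth_model_refl)
  let ?W = "\<lambda>n \<omega> (t, i). mark (N * 2 ^ n) \<omega> (t, - i)"
  show "\<exists>ll>0. AE \<omega> in M. (\<lambda>k. real_of_int (- rear (\<eta> (real k) \<omega>)) / real k) \<longlonglongrightarrow> ll"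
  proof (rule r.front_speed_exists[OF prob_space_axioms])
    show "front_chain N R b_refl (mark_law (N * 2 ^ n)) (2 ^ n)" for n by (rule front_chain_refl)
    show "?W n \<in> M \<rightarrow>\<^sub>M PiM UNIV (\<lambda>_. borel)" for n
    proof (rule measurable_PiM_single')
      fix j :: "nat \<times> int"
      show "(\<lambda>\<omega>. ?W n \<omega> j) \<in> borel_measurable M" by (cases j) simp
    qed (simp add: space_PiM)
    show "distr M (PiM UNIV (\<lambda>_. borel)) (?W n) = PiM UNIV (\<lambda>_. mark_law (N * 2 ^ n))" for n
      by (rule distr_marks_refl[OF S])
    show "AE \<omega> in M. \<forall>k. \<forall>\<^sub>F n in sequentially.
        front (r.run single (?W n \<omega>) (k * (N * 2 ^ n))) = - rear (\<eta> (real k) \<omega>)"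
      using run
    proof eventually_elim
      case (elim \<omega>)
      show ?case
      proof
        fix k
        from elim[rule_format, of k]
        show "\<forall>\<^sub>F n in sequentially. front (r.run single (?W n \<omega>) (k * (N * 2 ^ n))) = - rear (\<eta> (real k) \<omega>)"
        proof eventually_elim
          case (elim n)
          have "run single (mark (N * 2 ^ n) \<omega>) (k * (N * 2 ^ n)) \<in> fin_configs"
            by (rule run_fin[OF single_fin])
          then show ?case
            unfolding run_refl using elim by (subst front_reflect) (auto dest: fin_configsD)
        qed
      qed
    qed
  qed
qed

lemma shape:
  assumes path: "AE \<omega> in M. birth_path N R b M pts \<omega> (\<lambda>t. \<eta> t \<omega>)"
  shows "\<exists>lr ll. lr > 0 \<and> ll > 0 \<and>
    (\<forall>\<epsilon>>0. AE \<omega> in M. \<forall>\<^sub>F t in at_top.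
       scaled_interval (1 - \<epsilon>) (- ll * t) (lr * t) \<inter> \<int> \<subseteq> real_of_int ` occ (\<eta> t \<omega>) \<and>
       real_of_int ` occ (\<eta> t \<omega>) \<subseteq> scaled_interval (1 + \<epsilon>) (- ll * t) (lr * t))"
proof -
  obtain lr where lr: "lr > 0" "AE \<omega> in M. (\<lambda>k. real_of_int (front (\<eta> (real k) \<omega>)) / real k) \<longlonglongrightarrow> lr"
    using AE_speeds(1)[OF path] by blast
  obtain ll where ll: "ll > 0" "AE \<omega> in M. (\<lambda>k. real_of_int (- rear (\<eta> (real k) \<omega>)) / real k) \<longlonglongrightarrow> ll"
    using AE_speeds(2)[OF path] by blast
  define l where "l = nat \<lceil>max lr ll\<rceil>"
  have l: "lr \<le> real l" "ll \<le> real l" unfolding l_def by linarith+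
  have "AE \<omega> in M. \<forall>\<^sub>F t in at_top.
       scaled_interval (1 - \<epsilon>) (- ll * t) (lr * t) \<inter> \<int> \<subseteq> real_of_int ` occ (\<eta> t \<omega>) \<and>
       real_of_int ` occ (\<eta> t \<omega>) \<subseteq> scaled_interval (1 + \<epsilon>) (- ll * t) (lr * t)" if \<epsilon>: "\<epsilon> > 0" for \<epsilon>
  proof -
    have "AE \<omega> in M. \<forall>\<^sub>F k in sequentially. \<forall>x\<in>{- int (l * k)..int (l * k)}.
        count \<omega> (strip (real k) (real (k + nat \<lceil>\<epsilon> / 2 * real k\<rceil>)) {x} bmin) \<noteq> 0"
      by (rule AE_no_long_void) (use bmin_pos \<epsilon> in auto)
    with path lr(2) ll(2) show ?thesis
    proof eventually_elim
      case (elim \<omega>)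
      then interpret birth_path N R b M pts \<omega> "\<lambda>t. \<eta> t \<omega>" by simp
      have "\<forall>\<^sub>F t in at_top. scaled_interval (1 - \<epsilon>) (- ll * t) (lr * t) \<inter> \<int> \<subseteq> real_of_int ` occ (\<eta> t \<omega>)"
      proof (cases "\<epsilon> < 1")
        case True
        show ?thesis by (rule eventually_inner_shape[OF lr(1) elim(2) ll(1) elim(3) \<epsilon> True elim(4) l])
      next
        case False
        show ?thesis
          using eventually_ge_at_top[of 0]
          by eventually_elim (rule inner_shape_trivial[OF lr(1) ll(1)], use False in auto)
      qed
      then show ?case
        using eventually_outer_shape[OF lr(1) elim(2) ll(1) elim(3) \<epsilon>] by eventually_elim simp
    qed
  qed
  then show ?thesis using lr(1) ll(1) by blast
qed

end

theorem theorem2p4: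
  fixes N R :: nat and b :: rate and M :: "'w measure" and \<eta> :: "real \<Rightarrow> 'w \<Rightarrow> config"
  assumes "N \<ge> 1" and "R \<ge> 1"
    and "birth_rate N b"
    and "translation_invariant N b"
    and "finite_range N R b"
    and "nondegenerate N R b"
    and "prob_space M"
    and "birth_process M N b (\<lambda>k. if k = 0 then 1 else 0) \<eta>"
  shows "\<exists>lam\<^sub>r lam\<^sub>l. lam\<^sub>r > 0 \<and> lam\<^sub>l > 0 \<and>
    (\<forall>\<epsilon>>0. AE \<omega> in M. \<forall>\<^sub>F t in at_top.
       scaled_interval (1 - \<epsilon>) (- lam\<^sub>l * t) (lam\<^sub>r * t) \<inter> \<int> \<subseteq> real_of_int ` occ (\<eta> t \<omega>) \<and>
       real_of_int ` occ (\<eta> t \<omega>) \<subseteq> scaled_interval (1 + \<epsilon>) (- lam\<^sub>l * t) (lam\<^sub>r * t))"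
proof -
  obtain pts where pts: "poisson_point_process M driving_intensity pts"
    and eq: "AE \<omega> in M. birth_equation N b single (pts \<omega>) (\<lambda>t. \<eta> t \<omega>)"
    and meas: "\<And>t. t \<ge> 0 \<Longrightarrow> \<eta> t \<in> M \<rightarrow>\<^sub>M config_space N"
    and cadlag: "AE \<omega> in M. cadlag (\<lambda>t. \<eta> t \<omega>)"
    using assms(8) unfolding birth_process_def single_def by blast
  interpret driven_model N R b M pts
    by (intro driven_model.intro birth_model.intro driven.intro driven_axioms.intro assms pts)
  show ?thesis by (rule shape[OF AE_birth_path[OF meas cadlag eq]])
qed

end
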